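(* Let $\Omega\subset\mathbb R^n$ be open and bounded with smooth boundary. Suppose $\psi:\Omega\times\mathbb R^m\to\mathbb R\cup\{-\infty\}$ is upper-semicontinuous and satisfies: (1) for each $x\in\Omega$ the function $y\mapsto\psi(x,y)$ is convex; and (2) for each affine function $\Gamma:\mathbb R^n\to\mathbb R^m$ the function $x\mapsto\psi(x,\Gamma(x))$ is subharmonic on $\Omega$. Then the function $$x\mapsto-\log\int_{\mathbb R^m}e^{-\psi(x,y)}\,dy$$ is subharmonic on $\Omega$. In particular this applies to the harmonic interpolation of a family of convex functions: if $\phi_\tau:\mathbb R^m\to\mathbb R$ ($\tau\in\partial\Omega$) are convex functions such that $(\tau,y)\mapsto\phi_\tau(y)$ is continuous on $\partial\Omega\times\mathbb R^m$, then their harmonic interpolation $\psi(x,y)=\phi_x(y)$, where $$\phi_x=\Big(\int_{\partial\Omega}\phi_\tau^*\,d\mu_x(\tau)\Big)^*\quad(x\in\Omega),$$ is upper-semicontinuous and satisfies (1) and (2), so that $x\mapsto-\log\int_{\mathbb R^m}e^{-\psi(x,y)}\,dy$ is subharmonic on $\Omega$.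
   Context: Subharmonic functions are upper-semicontinuous with values in $\mathbb R\cup\{-\infty\}$, and the function identically $-\infty$ is allowed. The convention $-\log(+\infty)=-\infty$ is used. For a function $\eta$ on $\mathbb R^m$, $\eta^*(u)=\sup_{y\in\mathbb R^m}\{y\cdot u-\eta(y)\}$ is its Legendre transform (possibly $\pm\infty$ valued). The harmonic measure $d\mu_x$ of $\Omega$ with respect to $x\in\Omega$ is the Borel probability measure on $\partial\Omega$ such that for every continuous $g:\partial\Omega\to\mathbb R$ the function $x\mapsto\int_{\partial\Omega}g\,d\mu_x$ is the harmonic function on $\Omega$ with boundary values $g$. In the harmonic interpolation, $\int_{\partial\Omega}\phi^*_\tau\,d\mu_x(\tau)$ denotes the function $u\mapsto\int_{\partial\Omega}\phi_\tau^*(u)\,d\mu_x(\tau)\in(-\infty,+\infty]$. *)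

theory Defs
  imports "HOL-Analysis.Analysis" "HOL-Probability.Probability_Measure"
begin

text \<open>Functions with values in the reals extended by one or both infinities are \<^typ>\<open>ereal\<close>-valued;
  exclusion of the value \<open>\<infinity>\<close> is stated explicitly where it is meant.\<close>

section \<open>Smooth functions and domains\<close>

text \<open>Only meant for open \<open>S\<close>.\<close>

fun Ck_on :: "nat \<Rightarrow> 'a set \<Rightarrow> ('a::euclidean_space \<Rightarrow> real) \<Rightarrow> bool" where
  "Ck_on 0 S f \<longleftrightarrow> continuous_on S f"
| "Ck_on (Suc k) S f \<longleftrightarrow>
     f differentiable_on S \<and> (\<forall>b\<in>Basis. Ck_on k S (\<lambda>x. frechet_derivative f (at x) b))"

definition smooth_fun_on :: "'a set \<Rightarrow> ('a::euclidean_space \<Rightarrow> real) \<Rightarrow> bool" where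
  "smooth_fun_on S f \<longleftrightarrow> (\<forall>k. Ck_on k S f)"

text \<open>Near each boundary point the set is a sublevel set of a smooth function without critical
  points (so the set lies locally on one side of its boundary).\<close>

definition smooth_boundary :: "'a::euclidean_space set \<Rightarrow> bool" where
  "smooth_boundary \<Omega> \<longleftrightarrow>
     (\<forall>p\<in>frontier \<Omega>. \<exists>U \<rho>. open U \<and> p \<in> U \<and> smooth_fun_on U \<rho>
        \<and> (\<forall>x\<in>U. frechet_derivative \<rho> (at x) \<noteq> (\<lambda>v. 0))
        \<and> \<Omega> \<inter> U = {x\<in>U. \<rho> x < 0})"

section \<open>Extended-valued functions\<close>

definition usc_on :: "'a::topological_space set \<Rightarrow> ('a \<Rightarrow> ereal) \<Rightarrow> bool" where
  "usc_on S f \<longleftrightarrow> (\<forall>c. openin (top_of_set S) {x\<in>S. f x < c})"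

text \<open>Used for functions without the value \<open>\<infinity>\<close>, so that the right-hand side is never
  of the form \<open>\<infinity> - \<infinity>\<close>; note \<^prop>\<open>0 * (-\<infinity>) = (0::ereal)\<close>.\<close>

definition ereal_convex :: "('b::real_vector \<Rightarrow> ereal) \<Rightarrow> bool" where
  "ereal_convex f \<longleftrightarrow>
     (\<forall>y z. \<forall>t\<in>{0..1::real}.
        f ((1 - t) *\<^sub>R y + t *\<^sub>R z) \<le> ereal (1 - t) * f y + ereal t * f z)"

text \<open>Integral of the positive part minus integral of the negative part. Below, at least one of the
  two is always finite: the positive part for averages over compact balls of upper-semicontinuous
  functions without the value \<open>\<infinity>\<close>, the negative part in the harmonic interpolation.\<close>

definition ereal_integral :: "'a measure \<Rightarrow> ('a \<Rightarrow> ereal) \<Rightarrow> ereal" where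
  "ereal_integral M f =
     enn2ereal (\<integral>\<^sup>+ x. e2ennreal (f x) \<partial>M) - enn2ereal (\<integral>\<^sup>+ x. e2ennreal (- f x) \<partial>M)"

definition ereal_exp :: "ereal \<Rightarrow> ennreal" where
  "ereal_exp a = (if a = \<infinity> then \<infinity> else if a = -\<infinity> then 0 else ennreal (exp (real_of_ereal a)))"

definition ennreal_ln :: "ennreal \<Rightarrow> ereal" where
  "ennreal_ln z = (if z = \<infinity> then \<infinity> else if z = 0 then -\<infinity> else ereal (ln (enn2real z)))"

definition legendre :: "('b::real_inner \<Rightarrow> ereal) \<Rightarrow> 'b \<Rightarrow> ereal" where
  "legendre \<eta> u = (SUP y. ereal (y \<bullet> u) - \<eta> y)"

section \<open>Subharmonic and harmonic functions\<close>

text \<open>Sub-mean value property over solid balls.\<close>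

definition subharmonic_on :: "'a::euclidean_space set \<Rightarrow> ('a \<Rightarrow> ereal) \<Rightarrow> bool" where
  "subharmonic_on \<Omega> f \<longleftrightarrow>
     (\<forall>x\<in>\<Omega>. f x \<noteq> \<infinity>) \<and> usc_on \<Omega> f \<and>
     (\<forall>x r. r > 0 \<and> cball x r \<subseteq> \<Omega> \<longrightarrow>
        f x \<le> ereal (1 / measure lborel (cball x r))
                * ereal_integral (restrict_space lborel (cball x r)) f)"

definition laplacian :: "('a::euclidean_space \<Rightarrow> real) \<Rightarrow> 'a \<Rightarrow> real" where
  "laplacian h x = (\<Sum>b\<in>Basis. (deriv ^^ 2) (\<lambda>t. h (x + t *\<^sub>R b)) 0)"

definition harmonic_on :: "'a::euclidean_space set \<Rightarrow> ('a \<Rightarrow> real) \<Rightarrow> bool" where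
  "harmonic_on \<Omega> h \<longleftrightarrow> Ck_on 2 \<Omega> h \<and> (\<forall>x\<in>\<Omega>. laplacian h x = 0)"

text \<open>\<open>\<mu> x\<close>, for \<open>x\<close> in \<open>\<Omega>\<close>, is the harmonic measure of \<open>\<Omega>\<close> with respect to \<open>x\<close>;
  this determines \<open>\<mu> x\<close> uniquely when \<open>\<Omega>\<close> is bounded and open.\<close>

definition harmonic_measure :: "'a::euclidean_space set \<Rightarrow> ('a \<Rightarrow> 'a measure) \<Rightarrow> bool" where
  "harmonic_measure \<Omega> \<mu> \<longleftrightarrow>
     (\<forall>x\<in>\<Omega>. prob_space (\<mu> x) \<and> sets (\<mu> x) = sets (restrict_space borel (frontier \<Omega>))) \<and>
     (\<forall>g :: 'a \<Rightarrow> real. continuous_on (frontier \<Omega>) g \<longrightarrow>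
        harmonic_on \<Omega> (\<lambda>x. \<integral>\<tau>. g \<tau> \<partial>\<mu> x) \<and>
        (\<forall>\<sigma>\<in>frontier \<Omega>. ((\<lambda>x. \<integral>\<tau>. g \<tau> \<partial>\<mu> x) \<longlongrightarrow> g \<sigma>) (at \<sigma> within \<Omega>)))"

definition harmonic_interpolation ::
    "('a \<Rightarrow> 'a measure) \<Rightarrow> ('a \<Rightarrow> 'b::real_inner \<Rightarrow> real) \<Rightarrow> 'a \<Rightarrow> 'b \<Rightarrow> ereal" where
  "harmonic_interpolation \<mu> \<phi> x =
     legendre (\<lambda>u. ereal_integral (\<mu> x) (\<lambda>\<tau>. legendre (\<lambda>y. ereal (\<phi> \<tau> y)) u))"

end

theory Submission
  imports Defs
begin

text \<open>Integrating out one variable \<open>t\<close> over a bounded interval turns a smooth \<open>f\<close> into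
  \<open>-log \<integral> exp (- f (w + t b)) dt\<close>, whose second derivative in direction \<open>v\<close> is the mean of the second derivative of
  \<open>f\<close> minus the variance of the first one. By the one-dimensional Brascamp--Lieb argument it is at least the mean
  of the second derivative of \<open>f\<close> in direction \<open>v + a(t) b\<close> for a suitable function \<open>a\<close>; hence the infinitesimal form of
  subharmonicity along affine graphs is inherited, one coordinate of \<open>y\<close> at a time. In general \<open>\<psi>\<close> is truncated
  from below and mollified; subharmonicity in \<open>x\<close> and convexity in \<open>y\<close> make the mollifications lie above \<open>\<psi>\<close>,
  upper semicontinuity makes them converge to it, and the sub-mean value property passes to the limit, first on
  boxes and then by monotone convergence.

  For the harmonic interpolation, the mean Legendre transform is an increasing limit of harmonic functions of \<open>x\<close>,
  so \<open>\<psi>(x, \<Gamma>(x))\<close> is a supremum of functions with the sub-mean value property.\<close>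

section \<open>Infinitesimal Prekopa inequality on slabs\<close>

text \<open>The property that one integration step has to preserve is chosen so that the witness
  \<open>a\<close> of the Brascamp--Lieb argument can be absorbed. That witness tilts a direction
  \<open>(e, A e)\<close> along \<open>b\<close>, by an amount that changes with \<open>t\<close>.
  Nonnegativity is demanded for all linear \<open>A\<close>, so a rank-one change of
  \<open>A\<close> accounts for the tilt. The inequality appears in dual form, with a test function
  in place of a squared derivative divided by a second derivative, so second derivatives along
  \<open>b\<close> may vanish. Subharmonicity is stated by averages over solid balls. The weight
  \<open>(1 - |z|^2) / 2\<close> in the ball integrals, and the description of the mollifier as a
  mixture of balls, keep every argument at Lebesgue integrals over balls, away from surface measure
  on spheres. Boundedness governs the limits: on a compact piece the truncated function is bounded,
  so limits there are dominated. Only the last one, over truncation levels and cubes, is monotone,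
  because it may have to reach -\<infinity>.\<close>

text \<open>\<open>d1 w v\<close> and \<open>d2 w v u\<close> are the derivatives of \<open>f\<close> at \<open>w\<close> in the directions \<open>v\<close>, and \<open>v\<close> and \<open>u\<close>.
  Linearity and symmetry are carried along explicitly, so that only derivatives along lines are ever taken.\<close>

definition C2 :: "('a::euclidean_space \<Rightarrow> real) \<Rightarrow> ('a \<Rightarrow> 'a \<Rightarrow> real) \<Rightarrow> ('a \<Rightarrow> 'a \<Rightarrow> 'a \<Rightarrow> real) \<Rightarrow> bool"
  where "C2 f d1 d2 \<longleftrightarrow>
    (\<forall>w v. ((\<lambda>s. f (w + s *\<^sub>R v)) has_real_derivative d1 w v) (at 0)) \<and>
    (\<forall>w v u. ((\<lambda>s. d1 (w + s *\<^sub>R u) v) has_real_derivative d2 w v u) (at 0)) \<and>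
    continuous_on UNIV f \<and> (\<forall>v. continuous_on UNIV (\<lambda>w. d1 w v)) \<and>
    (\<forall>v u. continuous_on UNIV (\<lambda>w. d2 w v u)) \<and>
    (\<forall>w. linear (d1 w)) \<and> (\<forall>w u. linear (\<lambda>v. d2 w v u)) \<and> (\<forall>w v u. d2 w v u = d2 w u v)"

lemma has_real_derivative_along_shift:
  fixes f :: "'a::real_vector \<Rightarrow> real"
  assumes "\<And>w. ((\<lambda>s. f (w + s *\<^sub>R v)) has_real_derivative f' w) (at 0)"
  shows "((\<lambda>s. f (w + s *\<^sub>R v)) has_real_derivative f' (w + s *\<^sub>R v)) (at s)"
proof -
  have "((\<lambda>r. f ((w + s *\<^sub>R v) + (r + - s) *\<^sub>R v)) has_real_derivative f' (w + s *\<^sub>R v)) (at s)"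
    using DERIV_shift[of "\<lambda>r. f ((w + s *\<^sub>R v) + r *\<^sub>R v)" "f' (w + s *\<^sub>R v)" s "-s"] assms
    by simp
  then show ?thesis by (simp add: algebra_simps)
qed

lemma C2D:
  assumes "C2 f d1 d2"
  shows "((\<lambda>s. f (w + s *\<^sub>R v)) has_real_derivative d1 (w + s *\<^sub>R v) v) (at s)"
    and "((\<lambda>s. d1 (w + s *\<^sub>R u) v) has_real_derivative d2 (w + s *\<^sub>R u) v u) (at s)"
    and "continuous_on UNIV f" "continuous_on UNIV (\<lambda>w. d1 w v)" "continuous_on UNIV (\<lambda>w. d2 w v u)"
    and "linear (d1 w)" "linear (\<lambda>v. d2 w v u)" "linear (d2 w v)" "d2 w v u = d2 w u v"
proof -
  show "((\<lambda>s. f (w + s *\<^sub>R v)) has_real_derivative d1 (w + s *\<^sub>R v) v) (at s)"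
    by (rule has_real_derivative_along_shift) (use assms C2_def in blast)
  show "((\<lambda>s. d1 (w + s *\<^sub>R u) v) has_real_derivative d2 (w + s *\<^sub>R u) v u) (at s)"
    by (rule has_real_derivative_along_shift) (use assms C2_def in blast)
  have s: "\<And>v u. d2 w v u = d2 w u v" and l: "\<And>u. linear (\<lambda>v. d2 w v u)" using assms by (auto simp: C2_def)
  have "d2 w v = (\<lambda>x. d2 w x v)" using s by auto
  then show "linear (d2 w v)" using l by metis
qed (use assms in \<open>auto simp: C2_def\<close>)

text \<open>With \<open>c\<close> the mean of \<open>g\<close> for the density \<open>exp (- p)\<close>, the witness \<open>a\<close> solves
  \<open>(a exp (- p))' = (g - c) exp (- p)\<close> and vanishes at both end points.\<close>

lemma brascamp_lieb_interval:
  fixes p p1 p2 g g1 :: "real \<Rightarrow> real"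
  assumes lr: "l \<le> r"
    and p: "\<And>t. (p has_real_derivative p1 t) (at t)"
    and p1: "\<And>t. (p1 has_real_derivative p2 t) (at t)"
    and g: "\<And>t. (g has_real_derivative g1 t) (at t)"
    and cont: "continuous_on {l..r} p2" "continuous_on {l..r} g1"
    and Z: "integral {l..r} (\<lambda>t. exp (- p t)) = Z" "Z > 0"
  obtains a where "continuous_on {l..r} a"
    "integral {l..r} (\<lambda>t. exp (- p t) * (2 * a t * g1 t + (a t)\<^sup>2 * p2 t))
      \<le> (integral {l..r} (\<lambda>t. exp (- p t) * g t))\<^sup>2 / Z - integral {l..r} (\<lambda>t. exp (- p t) * (g t)\<^sup>2)"
proof -
  define G where "G = integral {l..r} (\<lambda>t. exp (- p t) * g t)"
  define c where "c = G / Z"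
  define A where "A x = integral {l..x} (\<lambda>t. exp (- p t) * (g t - c))" for x
  have cp: "continuous_on S p" and cp1: "continuous_on S p1" and cg: "continuous_on S g" for S
    using DERIV_continuous_on p p1 g by (meson has_field_derivative_at_within)+
  note [continuous_intros] = cp cp1 cg cont
  have Ac: "(A has_real_derivative exp (- p x) * (g x - c)) (at x within {l..r})" if "x \<in> {l..r}" for x
    unfolding A_def using that
    by (intro integral_has_real_derivative continuous_intros)
  have A_l: "A l = 0" by (simp add: A_def)
  have ig: "(\<lambda>t. exp (- p t) * g t) integrable_on {l..r}" "(\<lambda>t. exp (- p t)) integrable_on {l..r}"
    "(\<lambda>t. exp (- p t) * (g t)\<^sup>2) integrable_on {l..r}"
    by (intro integrable_continuous_interval continuous_intros)+
  have A_r: "A r = 0"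
  proof -
    have "A r = integral {l..r} (\<lambda>t. exp (- p t) * g t - c * exp (- p t))"
      unfolding A_def by (intro integral_cong) (simp add: algebra_simps)
    also have "\<dots> = G - c * Z"
      using Z by (subst integral_diff) (auto intro!: integrable_on_mult_right ig simp: G_def)
    finally show ?thesis using Z by (simp add: c_def)
  qed
  define a where "a x = A x * exp (p x)" for x
  have cA: "continuous_on {l..r} A" by (rule DERIV_continuous_on[OF Ac])
  have ca: "continuous_on {l..r} a" unfolding a_def by (intro continuous_intros cA)
  \<comment> \<open>\<open>\<Phi>\<close> gathers the boundary terms of two integrations by parts,
    one taking the derivative off \<open>g1\<close>, the other off \<open>p2\<close>. The derivative
    of \<open>a\<close> being \<open>g - c + a * p1\<close>, that of \<open>\<Phi>\<close> is the
    integrand of the claim plus \<open>exp (- p)\<close> times the squares of \<open>g - c\<close>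
    and of the derivative of \<open>a\<close>.\<close>
  define \<Phi> where "\<Phi> t = 2 * (g t - c) * A t + (A t)\<^sup>2 * exp (p t) * p1 t" for t
  define \<Phi>' where "\<Phi>' t = exp (- p t) * (2 * a t * g1 t + (a t)\<^sup>2 * p2 t)
      + exp (- p t) * ((g t - c)\<^sup>2 + (g t - c + a t * p1 t)\<^sup>2)" for t
  have d\<Phi>: "(\<Phi> has_real_derivative \<Phi>' x) (at x within {l..r})" if "x \<in> {l..r}" for x
  proof -
    have D: "(\<Phi> has_real_derivative
       2 * g1 x * A x + 2 * (g x - c) * (exp (- p x) * (g x - c))
       + (2 * A x * (exp (- p x) * (g x - c)) * exp (p x) * p1 x + (A x)\<^sup>2 * (exp (p x) * p1 x) * p1 x
       + (A x)\<^sup>2 * exp (p x) * p2 x)) (at x within {l..r})"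
      unfolding \<Phi>_def
      by (rule derivative_eq_intros Ac[OF that] g[THEN has_field_derivative_at_within]
          p[THEN has_field_derivative_at_within] p1[THEN has_field_derivative_at_within] refl)+
         (simp add: algebra_simps power2_eq_square)
    \<comment> \<open>With \<open>exp (p x)\<close> generalised to a nonzero \<open>E\<close>, what
      remains is an identity between rational functions.\<close>
    have alg: "1 / E * (2 * (A * E) * G + (A * E)\<^sup>2 * q) + 1 / E * (h\<^sup>2 + (h + A * E * m)\<^sup>2)
       = 2 * G * A + 2 * h * (1 / E * h) + (2 * A * (1 / E * h) * E * m + A\<^sup>2 * (E * m) * m + A\<^sup>2 * E * q)"
      if "E \<noteq> 0" for E A G q h m :: real
      using that by (simp add: field_simps power2_eq_square)
    have e: "exp (- p x) = 1 / exp (p x)" by (simp add: exp_minus field_simps)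
    have "\<Phi>' x = 2 * g1 x * A x + 2 * (g x - c) * (exp (- p x) * (g x - c))
       + (2 * A x * (exp (- p x) * (g x - c)) * exp (p x) * p1 x + (A x)\<^sup>2 * (exp (p x) * p1 x) * p1 x
       + (A x)\<^sup>2 * exp (p x) * p2 x)"
      unfolding \<Phi>'_def a_def e
      using alg[of "exp (p x)" "A x" "g1 x" "p2 x" "g x - c" "p1 x"] by (simp add: ac_simps)
    then show ?thesis using D by (simp only: e)
  qed
  have "(\<Phi>' has_integral (\<Phi> r - \<Phi> l)) {l..r}"
    by (intro fundamental_theorem_of_calculus lr) (simp add: d\<Phi> flip: has_real_derivative_iff_has_vector_derivative)
  then have 0: "integral {l..r} \<Phi>' = 0" by (simp add: \<Phi>_def A_l A_r integral_unique)
  have i1: "(\<lambda>t. exp (- p t) * (2 * a t * g1 t + (a t)\<^sup>2 * p2 t)) integrable_on {l..r}"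
    by (intro integrable_continuous_interval continuous_intros ca)
  have i2: "(\<lambda>t. exp (- p t) * ((g t - c)\<^sup>2 + (g t - c + a t * p1 t)\<^sup>2)) integrable_on {l..r}"
    by (intro integrable_continuous_interval continuous_intros ca)
  have "integral {l..r} (\<lambda>t. exp (- p t) * (2 * a t * g1 t + (a t)\<^sup>2 * p2 t))
      = - integral {l..r} (\<lambda>t. exp (- p t) * ((g t - c)\<^sup>2 + (g t - c + a t * p1 t)\<^sup>2))"
    using 0 integral_add[OF i1 i2] unfolding \<Phi>'_def by simp
  \<comment> \<open>Dropping the square of the derivative of \<open>a\<close> leaves minus the
    unnormalised variance of \<open>g\<close>, whatever the sign of \<open>p2\<close>.\<close>
  also have "\<dots> \<le> - integral {l..r} (\<lambda>t. exp (- p t) * (g t - c)\<^sup>2)"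
    by (simp, intro integral_le i2 integrable_continuous_interval continuous_intros) auto
  also have "integral {l..r} (\<lambda>t. exp (- p t) * (g t - c)\<^sup>2)
     = integral {l..r} (\<lambda>t. exp (- p t) * (g t)\<^sup>2 - 2 * c * (exp (- p t) * g t) + c\<^sup>2 * exp (- p t))"
    by (intro integral_cong) (simp add: algebra_simps power2_eq_square)
  also have "\<dots> = integral {l..r} (\<lambda>t. exp (- p t) * (g t)\<^sup>2) - 2 * c * G + c\<^sup>2 * Z"
  proof -
    have "((\<lambda>t. exp (- p t) * (g t)\<^sup>2 - 2 * c * (exp (- p t) * g t) + c\<^sup>2 * exp (- p t)) has_integral
      (integral {l..r} (\<lambda>t. exp (- p t) * (g t)\<^sup>2) - 2 * c * G + c\<^sup>2 * Z)) {l..r}"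
      unfolding G_def Z(1)[symmetric]
      by (intro has_integral_add has_integral_diff has_integral_mult_right integrable_integral ig)
    then show ?thesis by (rule integral_unique)
  qed
  also have "\<dots> = integral {l..r} (\<lambda>t. exp (- p t) * (g t)\<^sup>2) - G\<^sup>2 / Z"
    using Z by (simp add: c_def field_simps power2_eq_square)
  finally show ?thesis using that[OF ca] by (simp add: G_def)
qed

section \<open>Integrals of \<open>exp (- f)\<close> along segments and their derivatives\<close>

definition log_slab_integral :: "real \<Rightarrow> 'a::real_vector \<Rightarrow> ('a \<Rightarrow> real) \<Rightarrow> 'a \<Rightarrow> real"
  where "log_slab_integral R b f w = - ln (integral {-R..R} (\<lambda>t. exp (- f (w + t *\<^sub>R b))))"

lemma continuous_on_slab_integral:
  fixes G :: "'a::euclidean_space \<Rightarrow> real"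
  assumes "continuous_on UNIV G"
  shows "continuous_on UNIV (\<lambda>w. integral {-R..R} (\<lambda>t. G (w + t *\<^sub>R b)))"
proof -
  have "continuous_on (UNIV \<times> cbox (-R) R) (\<lambda>(w, t). G (w + t *\<^sub>R b))"
    unfolding split_beta by (intro continuous_on_compose2[OF assms] continuous_intros) auto
  from integral_continuous_on_param[OF this] show ?thesis by simp
qed

lemma continuous_on_line:
  fixes G :: "'a::real_normed_vector \<Rightarrow> 'b::topological_space"
  assumes "continuous_on UNIV G"
  shows "continuous_on S (\<lambda>t. G (w + t *\<^sub>R b))"
  by (rule continuous_on_compose2[OF assms]) (auto intro!: continuous_intros)

lemma has_real_derivative_slab_integral:
  fixes G :: "'a::euclidean_space \<Rightarrow> real"
  assumes c: "continuous_on UNIV G" "continuous_on UNIV G'"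
    and d: "\<And>w. ((\<lambda>s. G (w + s *\<^sub>R u)) has_real_derivative G' w) (at 0)"
  shows "((\<lambda>s. integral {-R..R} (\<lambda>t. G (w + s *\<^sub>R u + t *\<^sub>R b)))
     has_real_derivative integral {-R..R} (\<lambda>t. G' (w + t *\<^sub>R b))) (at 0)"
proof -
  have "((\<lambda>s. integral (cbox (-R) R) (\<lambda>t. G (w + s *\<^sub>R u + t *\<^sub>R b)))
     has_real_derivative integral (cbox (-R) R) (\<lambda>t. G' (w + 0 *\<^sub>R u + t *\<^sub>R b))) (at 0 within UNIV)"
  proof (rule leibniz_rule_field_derivative)
    fix s t
    show "((\<lambda>s. G (w + s *\<^sub>R u + t *\<^sub>R b)) has_real_derivative G' (w + s *\<^sub>R u + t *\<^sub>R b)) (at s)"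
      using has_real_derivative_along_shift[OF d, where w="w + t *\<^sub>R b" and s=s]
      by (simp add: algebra_simps)
  next
    fix s
    show "(\<lambda>t. G (w + s *\<^sub>R u + t *\<^sub>R b)) integrable_on cbox (-R) R"
      by (intro integrable_continuous continuous_on_compose2[OF c(1)] continuous_intros) auto
  next
    show "continuous_on (UNIV \<times> cbox (-R) R) (\<lambda>(s, t). G' (w + s *\<^sub>R u + t *\<^sub>R b))"
      unfolding split_beta by (intro continuous_on_compose2[OF c(2)] continuous_intros) auto
  qed auto
  then show ?thesis by simp
qed

lemma integral_exp_pos:
  fixes f :: "real \<Rightarrow> real"
  assumes "continuous_on {l..r} f" "l < r"
  shows "integral {l..r} (\<lambda>t. exp (f t)) > 0"
proof -
  obtain m where m: "m \<in> {l..r}" "\<And>t. t \<in> {l..r} \<Longrightarrow> f m \<le> f t"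
    using continuous_attains_inf[of "{l..r}" f] assms by auto
  have "0 < exp (f m) * (r - l)" using assms by simp
  also have "\<dots> = integral {l..r} (\<lambda>t. exp (f m))" using assms by simp
  also have "\<dots> \<le> integral {l..r} (\<lambda>t. exp (f t))"
    by (intro integral_le integrable_continuous_interval continuous_intros assms) (use m in auto)
  finally show ?thesis .
qed

context
  fixes f :: "'a::euclidean_space \<Rightarrow> real" and d1 d2 and R :: real and b :: 'a
  assumes C2: "C2 f d1 d2" and R: "R > 0"
begin

text \<open>The unnormalised mean of \<open>G\<close> over the segment through \<open>w\<close> in
  direction \<open>b\<close>, for the density \<open>exp (- f)\<close>; division by the value for
  the constant 1 gives an expectation.\<close>

definition slab_weighted :: "('a \<Rightarrow> real) \<Rightarrow> 'a \<Rightarrow> real"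
  where "slab_weighted G w = integral {-R..R} (\<lambda>t. exp (- f (w + t *\<^sub>R b)) * G (w + t *\<^sub>R b))"

definition slab_d1 :: "'a \<Rightarrow> 'a \<Rightarrow> real"
  where "slab_d1 w v = slab_weighted (\<lambda>w. d1 w v) w / slab_weighted (\<lambda>_. 1) w"

text \<open>The expectation of \<open>d2\<close> minus the covariance of the two first derivatives.
  The covariance is the term that threatens positivity, and the one that the Brascamp--Lieb argument
  compensates.\<close>

definition slab_d2 :: "'a \<Rightarrow> 'a \<Rightarrow> 'a \<Rightarrow> real"
  where "slab_d2 w v u = slab_weighted (\<lambda>w. d2 w v u - d1 w v * d1 w u) w / slab_weighted (\<lambda>_. 1) w
     + slab_weighted (\<lambda>w. d1 w v) w * slab_weighted (\<lambda>w. d1 w u) w / (slab_weighted (\<lambda>_. 1) w)\<^sup>2"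

lemma slab_weighted_continuous:
  "continuous_on UNIV G \<Longrightarrow> continuous_on UNIV (slab_weighted G)"
  unfolding slab_weighted_def
  by (intro continuous_on_slab_integral[where G="\<lambda>w. exp (- f w) * G w"] continuous_intros C2D(3)[OF C2])

lemma slab_weighted_integrable:
  "continuous_on UNIV G \<Longrightarrow> (\<lambda>t. exp (- f (w + t *\<^sub>R b)) * G (w + t *\<^sub>R b)) integrable_on {-R..R}"
  by (intro integrable_continuous_interval continuous_on_mult continuous_on_exp continuous_on_minus
      continuous_on_line C2D(3)[OF C2])

lemma slab_weighted_linear:
  assumes "\<And>v. continuous_on UNIV (\<lambda>w. D w v)" "\<And>w. linear (D w)"
  shows "linear (\<lambda>v. slab_weighted (\<lambda>w. D w v) w)"
proof (rule linearI)
  fix u v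
  show "slab_weighted (\<lambda>w. D w (u + v)) w = slab_weighted (\<lambda>w. D w u) w + slab_weighted (\<lambda>w. D w v) w"
    unfolding slab_weighted_def using assms(1)
    by (subst integral_add[symmetric])
       (auto intro!: slab_weighted_integrable simp: linear_add[OF assms(2)] distrib_left)
next
  fix c v
  show "slab_weighted (\<lambda>w. D w (c *\<^sub>R v)) w = c *\<^sub>R slab_weighted (\<lambda>w. D w v) w"
  proof -
    have "(\<lambda>t. exp (- f (w + t *\<^sub>R b)) * D (w + t *\<^sub>R b) (c *\<^sub>R v))
      = (\<lambda>t. c *\<^sub>R (exp (- f (w + t *\<^sub>R b)) * D (w + t *\<^sub>R b) v))"
      by (simp add: linear_scale[OF assms(2)] mult.left_commute)
    then show ?thesis unfolding slab_weighted_def by (simp only: integral_cmul)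
  qed
qed

lemma slab_weighted_deriv:
  assumes "continuous_on UNIV G" "continuous_on UNIV G'"
    "\<And>w. ((\<lambda>s. G (w + s *\<^sub>R u)) has_real_derivative G' w) (at 0)"
  shows "((\<lambda>s. slab_weighted G (w + s *\<^sub>R u)) has_real_derivative
     slab_weighted (\<lambda>w. G' w - G w * d1 w u) w) (at 0)"
proof -
  have "((\<lambda>s. integral {-R..R} (\<lambda>t. (\<lambda>w. exp (- f w) * G w) (w + s *\<^sub>R u + t *\<^sub>R b)))
     has_real_derivative integral {-R..R} (\<lambda>t. (\<lambda>w. exp (- f w) * (G' w - G w * d1 w u)) (w + t *\<^sub>R b))) (at 0)"
  proof (rule has_real_derivative_slab_integral)
    fix w
    show "((\<lambda>s. exp (- f (w + s *\<^sub>R u)) * G (w + s *\<^sub>R u)) has_real_derivative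
         exp (- f w) * (G' w - G w * d1 w u)) (at 0)"
      by (rule derivative_eq_intros assms(3) C2D(1)[OF C2] refl)+ (simp add: algebra_simps)
  qed (intro continuous_intros C2D(3,4)[OF C2] assms)+
  then show ?thesis by (simp add: slab_weighted_def)
qed

lemma slab_weighted_one_pos: "slab_weighted (\<lambda>_. 1) w > 0"
  unfolding slab_weighted_def using R
  by (simp, intro integral_exp_pos continuous_on_minus continuous_on_line C2D(3)[OF C2]) auto

lemma log_slab_integral_eq: "log_slab_integral R b f = (\<lambda>w. - ln (slab_weighted (\<lambda>_. 1) w))"
  by (auto simp: log_slab_integral_def slab_weighted_def)

text \<open>The class \<open>C2\<close> is reproduced, so the next coordinate can be treated in the
  same way. The interval is compact and all integrands are continuous, hence differentiation under
  the integral asks for no decay of \<open>f\<close>.\<close>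

lemma C2_log_slab_integral: "C2 (log_slab_integral R b f) slab_d1 slab_d2"
proof -
  note cont = C2D(3-5)[OF C2]
  note pos = slab_weighted_one_pos slab_weighted_one_pos[THEN less_imp_neq, THEN not_sym]
  have D1: "((\<lambda>s. slab_weighted (\<lambda>_. 1) (w + s *\<^sub>R u)) has_real_derivative
     - slab_weighted (\<lambda>w. d1 w u) w) (at 0)" for w u
    using slab_weighted_deriv[of "\<lambda>_. 1" "\<lambda>_. 0" u w] by (auto simp: slab_weighted_def)
  have D2: "((\<lambda>s. slab_weighted (\<lambda>w. d1 w v) (w + s *\<^sub>R u)) has_real_derivative
     slab_weighted (\<lambda>w. d2 w v u - d1 w v * d1 w u) w) (at 0)" for w v u
    by (rule slab_weighted_deriv) (use cont C2 C2_def in blast)+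
  have L1: "linear (\<lambda>v. slab_weighted (\<lambda>w. d1 w v) w)" for w
    by (rule slab_weighted_linear) (use C2D[OF C2] in auto)
  have L2: "linear (\<lambda>v. slab_weighted (\<lambda>w. d2 w v u - d1 w v * d1 w u) w)" for w u
    by (rule slab_weighted_linear)
       (auto intro!: continuous_intros cont
         simp: linear_iff algebra_simps linear_add[OF C2D(6)[OF C2]] linear_add[OF C2D(7)[OF C2]]
           linear_scale[OF C2D(6)[OF C2]] linear_scale[OF C2D(7)[OF C2]])
  show ?thesis
    unfolding C2_def log_slab_integral_eq
  proof (intro conjI allI)
    fix w v
    show "((\<lambda>s. - ln (slab_weighted (\<lambda>_. 1) (w + s *\<^sub>R v))) has_real_derivative slab_d1 w v) (at 0)"
      by (rule DERIV_cong[OF DERIV_minus[OF DERIV_chain2[OF DERIV_ln_divide D1]]])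
         (simp_all add: pos slab_d1_def)
  next
    fix w v u
    show "((\<lambda>s. slab_d1 (w + s *\<^sub>R u) v) has_real_derivative slab_d2 w v u) (at 0)"
      unfolding slab_d1_def
      by (rule derivative_eq_intros D1 D2 refl)+
         (simp_all add: pos slab_d2_def field_simps power2_eq_square)
  next
    show "linear (slab_d1 w)" for w
      using L1[of w] by (auto simp: slab_d1_def linear_iff field_simps pos)
  next
    show "linear (\<lambda>v. slab_d2 w v u)" for w u
      using L1[of w] L2[of u w] by (auto simp: slab_d2_def linear_iff field_simps pos)
  next
    show "slab_d2 w v u = slab_d2 w u v" for w v u
      by (simp add: slab_d2_def C2D(9)[OF C2, of _ v u] mult.commute)
  next
    show "continuous_on UNIV (\<lambda>w. - ln (slab_weighted (\<lambda>_. 1) w))"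
      by (intro continuous_intros slab_weighted_continuous) (simp add: pos)
  next
    show "continuous_on UNIV (\<lambda>w. slab_d1 w v)" for v
      unfolding slab_d1_def by (intro continuous_intros slab_weighted_continuous cont) (simp_all add: pos)
  next
    show "continuous_on UNIV (\<lambda>w. slab_d2 w v u)" for v u
      unfolding slab_d2_def by (intro continuous_intros slab_weighted_continuous cont) (simp_all add: pos)
  qed
qed

text \<open>\<open>brascamp_lieb_interval\<close> is applied with \<open>f\<close> along the segment
  as \<open>p\<close> and the derivative in direction \<open>v\<close> as \<open>g\<close>. In the
  quadratic form at \<open>v + a t *\<^sub>R b\<close> the terms containing \<open>a\<close> then
  integrate to at most minus the unnormalised variance, which is what \<open>slab_d2\<close>
  subtracts from the mean of \<open>d2\<close>.\<close>

lemma slab_d2_ge: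
  obtains a where "continuous_on {-R..R} a"
    "integral {-R..R} (\<lambda>t. exp (- f (w + t *\<^sub>R b)) * d2 (w + t *\<^sub>R b) (v + a t *\<^sub>R b) (v + a t *\<^sub>R b))
      \<le> slab_weighted (\<lambda>_. 1) w * slab_d2 w v v"
proof -
  define Z where "Z = slab_weighted (\<lambda>_. 1) w"
  obtain a where a: "continuous_on {-R..R} a"
    and le: "integral {-R..R} (\<lambda>t. exp (- f (w + t *\<^sub>R b)) * (2 * a t * d2 (w + t *\<^sub>R b) v b + (a t)\<^sup>2 * d2 (w + t *\<^sub>R b) b b))
      \<le> (integral {-R..R} (\<lambda>t. exp (- f (w + t *\<^sub>R b)) * d1 (w + t *\<^sub>R b) v))\<^sup>2 / Z
        - integral {-R..R} (\<lambda>t. exp (- f (w + t *\<^sub>R b)) * (d1 (w + t *\<^sub>R b) v)\<^sup>2)"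
    by (rule brascamp_lieb_interval[of "-R" R "\<lambda>t. f (w + t *\<^sub>R b)" "\<lambda>t. d1 (w + t *\<^sub>R b) b"
        "\<lambda>t. d2 (w + t *\<^sub>R b) b b" "\<lambda>t. d1 (w + t *\<^sub>R b) v" "\<lambda>t. d2 (w + t *\<^sub>R b) v b" Z])
       (use C2D[OF C2] R slab_weighted_one_pos[of w] in \<open>auto simp: Z_def slab_weighted_def intro!: continuous_on_line\<close>)
  have Z: "Z > 0" by (simp add: Z_def slab_weighted_one_pos)
  let ?e = "\<lambda>t. exp (- f (w + t *\<^sub>R b))"
  have i: "(\<lambda>t. ?e t * d2 (w + t *\<^sub>R b) v v) integrable_on {-R..R}"
    "(\<lambda>t. ?e t * (d1 (w + t *\<^sub>R b) v)\<^sup>2) integrable_on {-R..R}"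
    using slab_weighted_integrable[of "\<lambda>w. d2 w v v" w] slab_weighted_integrable[of "\<lambda>w. (d1 w v)\<^sup>2" w]
    by (simp_all add: C2D(4,5)[OF C2] continuous_on_power)
  have i': "(\<lambda>t. ?e t * (2 * a t * d2 (w + t *\<^sub>R b) v b + (a t)\<^sup>2 * d2 (w + t *\<^sub>R b) b b)) integrable_on {-R..R}"
    by (intro integrable_continuous_interval continuous_intros a continuous_on_line C2D(3-5)[OF C2])
  have "integral {-R..R} (\<lambda>t. ?e t * d2 (w + t *\<^sub>R b) (v + a t *\<^sub>R b) (v + a t *\<^sub>R b))
     = integral {-R..R} (\<lambda>t. ?e t * d2 (w + t *\<^sub>R b) v v
          + ?e t * (2 * a t * d2 (w + t *\<^sub>R b) v b + (a t)\<^sup>2 * d2 (w + t *\<^sub>R b) b b))"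
    by (intro integral_cong)
       (simp add: linear_add[OF C2D(7)[OF C2]] linear_add[OF C2D(8)[OF C2]] linear_scale[OF C2D(7)[OF C2]]
         linear_scale[OF C2D(8)[OF C2]] C2D(9)[OF C2, of _ b v] algebra_simps power2_eq_square)
  also have "\<dots> \<le> integral {-R..R} (\<lambda>t. ?e t * d2 (w + t *\<^sub>R b) v v) +
      ((integral {-R..R} (\<lambda>t. ?e t * d1 (w + t *\<^sub>R b) v))\<^sup>2 / Z
        - integral {-R..R} (\<lambda>t. ?e t * (d1 (w + t *\<^sub>R b) v)\<^sup>2))"
    using le by (subst integral_add[OF i(1) i']) simp
  also have "\<dots> = Z * slab_d2 w v v"
  proof -
    have "slab_weighted (\<lambda>w. d2 w v v - d1 w v * d1 w v) w
      = integral {-R..R} (\<lambda>t. ?e t * d2 (w + t *\<^sub>R b) v v)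
        - integral {-R..R} (\<lambda>t. ?e t * (d1 (w + t *\<^sub>R b) v)\<^sup>2)"
      unfolding slab_weighted_def by (subst integral_diff[OF i, symmetric])
        (simp add: right_diff_distrib power2_eq_square)
    then have e: "slab_d2 w v v = (integral {-R..R} (\<lambda>t. ?e t * d2 (w + t *\<^sub>R b) v v)
        - integral {-R..R} (\<lambda>t. ?e t * (d1 (w + t *\<^sub>R b) v)\<^sup>2)) / Z
        + (integral {-R..R} (\<lambda>t. ?e t * d1 (w + t *\<^sub>R b) v))\<^sup>2 / Z\<^sup>2"
      unfolding slab_d2_def Z_def by (simp add: slab_weighted_def power2_eq_square)
    have alg: "x + (y / Z - q) = Z * ((x - q) / Z + y / Z\<^sup>2)" for x y q :: real
      using Z by (simp add: distrib_left power2_eq_square)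
    show ?thesis unfolding e by (rule alg)
  qed
  finally show ?thesis by (intro that[OF a]) (simp add: Z_def)
qed

text \<open>This is Prekopa's theorem in infinitesimal form, for sums of second derivatives along a family of directions.\<close>

lemma sum_slab_d2_nonneg:
  assumes "finite I"
    and nn: "\<And>t a. \<bar>t\<bar> \<le> R \<Longrightarrow> (\<Sum>i\<in>I. d2 (w + t *\<^sub>R b) (v i + a i *\<^sub>R b) (v i + a i *\<^sub>R b)) \<ge> 0"
  shows "(\<Sum>i\<in>I. slab_d2 w (v i) (v i)) \<ge> 0"
proof -
  let ?e = "\<lambda>t. exp (- f (w + t *\<^sub>R b))"
  have "\<exists>a. continuous_on {-R..R} a \<and>
    integral {-R..R} (\<lambda>t. ?e t * d2 (w + t *\<^sub>R b) (v i + a t *\<^sub>R b) (v i + a t *\<^sub>R b))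
      \<le> slab_weighted (\<lambda>_. 1) w * slab_d2 w (v i) (v i)" for i
    using slab_d2_ge[of w "v i"] by blast
  then have "\<forall>i. \<exists>a. continuous_on {-R..R} a \<and>
    integral {-R..R} (\<lambda>t. ?e t * d2 (w + t *\<^sub>R b) (v i + a t *\<^sub>R b) (v i + a t *\<^sub>R b))
      \<le> slab_weighted (\<lambda>_. 1) w * slab_d2 w (v i) (v i)" by blast
  from choice[OF this] obtain a where a: "\<And>i. continuous_on {-R..R} (a i)"
    and le: "\<And>i. integral {-R..R} (\<lambda>t. ?e t * d2 (w + t *\<^sub>R b) (v i + a i t *\<^sub>R b) (v i + a i t *\<^sub>R b))
      \<le> slab_weighted (\<lambda>_. 1) w * slab_d2 w (v i) (v i)"
    by blast
  have i: "(\<lambda>t. ?e t * d2 (w + t *\<^sub>R b) (v i + a i t *\<^sub>R b) (v i + a i t *\<^sub>R b)) integrable_on {-R..R}" for i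
  proof -
    have "(\<lambda>t. ?e t * d2 (w + t *\<^sub>R b) (v i + a i t *\<^sub>R b) (v i + a i t *\<^sub>R b))
      = (\<lambda>t. ?e t * (d2 (w + t *\<^sub>R b) (v i) (v i) + 2 * a i t * d2 (w + t *\<^sub>R b) (v i) b + (a i t)\<^sup>2 * d2 (w + t *\<^sub>R b) b b))"
      by (simp add: linear_add[OF C2D(7)[OF C2]] linear_add[OF C2D(8)[OF C2]] linear_scale[OF C2D(7)[OF C2]]
         linear_scale[OF C2D(8)[OF C2]] C2D(9)[OF C2, of _ b "v i"] algebra_simps power2_eq_square)
    then show ?thesis
      by (simp only:) (intro integrable_continuous_interval continuous_intros a continuous_on_line C2D(3-5)[OF C2])
  qed
  \<comment> \<open>For a fixed \<open>t\<close> the numbers \<open>a i t\<close> are admissible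
    constants in \<open>nn\<close>. Each index comes with a witness of its own, which is why the
    tilts in \<open>nn\<close> are independent of one another.\<close>
  have "0 \<le> integral {-R..R} (\<lambda>t. \<Sum>i\<in>I. ?e t * d2 (w + t *\<^sub>R b) (v i + a i t *\<^sub>R b) (v i + a i t *\<^sub>R b))"
    by (intro integral_nonneg integrable_sum i \<open>finite I\<close>)
       (use nn in \<open>auto simp: sum_distrib_left[symmetric]\<close>)
  also have "\<dots> = (\<Sum>i\<in>I. integral {-R..R} (\<lambda>t. ?e t * d2 (w + t *\<^sub>R b) (v i + a i t *\<^sub>R b) (v i + a i t *\<^sub>R b)))"
    by (intro integral_sum i \<open>finite I\<close>)
  also have "\<dots> \<le> slab_weighted (\<lambda>_. 1) w * (\<Sum>i\<in>I. slab_d2 w (v i) (v i))"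
    unfolding sum_distrib_left by (intro sum_mono le)
  finally show ?thesis using slab_weighted_one_pos[of w] by (simp add: zero_le_mult_iff)
qed

end

section \<open>Integration over boxes\<close>

fun log_box_integral :: "real \<Rightarrow> 'a list \<Rightarrow> ('a::real_vector \<Rightarrow> real) \<Rightarrow> 'a \<Rightarrow> real"
  where "log_box_integral R [] f = f"
  | "log_box_integral R (b # bs) f = log_slab_integral R b (log_box_integral R bs f)"

text \<open>Nonnegative Laplacian at \<open>x\<close> along all affine graphs through \<open>(x, y)\<close>.\<close>

definition affine_subharmonic_at :: "('a::euclidean_space \<times> 'b::euclidean_space \<Rightarrow> 'a \<times> 'b \<Rightarrow> 'a \<times> 'b \<Rightarrow> real) \<Rightarrow> 'a \<Rightarrow> 'b \<Rightarrow> bool"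
  where "affine_subharmonic_at d2 x y \<longleftrightarrow> (\<forall>A. linear A \<longrightarrow> (\<Sum>e\<in>Basis. d2 (x, y) (e, A e) (e, A e)) \<ge> 0)"

text \<open>Each integration moves the second component by at most \<open>R\<close>, the directions
  being unit vectors; so the information on \<open>f\<close> has to reach
  \<open>R * length bs\<close> beyond the radius of the conclusion.\<close>

lemma log_box_integral_C2:
  fixes f :: "'a::euclidean_space \<times> 'b::euclidean_space \<Rightarrow> real"
  assumes "R > 0" "C2 f d1 d2" "\<And>b. b \<in> set bs \<Longrightarrow> norm b = 1"
  obtains D1 D2 where "C2 (log_box_integral R (map (Pair 0) bs) f) D1 D2"
    "\<And>x y \<rho>. (\<And>y'. norm y' \<le> \<rho> + R * length bs \<Longrightarrow> affine_subharmonic_at d2 x y') \<Longrightarrow> norm y \<le> \<rho> \<Longrightarrow> affine_subharmonic_at D2 x y"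
proof -
  have "\<exists>D1 D2. C2 (log_box_integral R (map (Pair 0) bs) f) D1 D2 \<and>
    (\<forall>x y \<rho>. (\<forall>y'. norm y' \<le> \<rho> + R * length bs \<longrightarrow> affine_subharmonic_at d2 x y') \<longrightarrow> norm y \<le> \<rho> \<longrightarrow> affine_subharmonic_at D2 x y)"
    using assms(3)
  proof (induction bs)
    case Nil
    then show ?case using assms by auto
  next
    case (Cons b bs)
    obtain D1 D2 where C: "C2 (log_box_integral R (map (Pair 0) bs) f) D1 D2"
      and aff: "\<And>x y \<rho>. (\<And>y'. norm y' \<le> \<rho> + R * length bs \<Longrightarrow> affine_subharmonic_at d2 x y') \<Longrightarrow> norm y \<le> \<rho> \<Longrightarrow> affine_subharmonic_at D2 x y"
      using Cons by auto
    define E2 where "E2 = slab_d2 (log_box_integral R (map (Pair 0) bs) f) D1 D2 R (0, b)"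
    have "C2 (log_box_integral R (map (Pair 0) (b # bs)) f)
      (slab_d1 (log_box_integral R (map (Pair 0) bs) f) D1 R (0, b)) E2"
      unfolding E2_def using C2_log_slab_integral[OF C assms(1)] by simp
    moreover have "affine_subharmonic_at E2 x y"
      if h: "\<And>y'. norm y' \<le> \<rho> + R * length (b # bs) \<Longrightarrow> affine_subharmonic_at d2 x y'" and y: "norm y \<le> \<rho>" for x y \<rho>
      unfolding affine_subharmonic_at_def
    proof (intro allI impI)
      fix A :: "'a \<Rightarrow> 'b" assume A: "linear A"
      show "(\<Sum>e\<in>Basis. E2 (x, y) (e, A e) (e, A e)) \<ge> 0"
        unfolding E2_def
      proof (rule sum_slab_d2_nonneg[OF C assms(1)])
        fix t and a :: "'a \<Rightarrow> real" assume t: "\<bar>t\<bar> \<le> R"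
        have "norm (y + t *\<^sub>R b) \<le> norm y + \<bar>t\<bar> * norm b" by (metis norm_triangle_ineq norm_scaleR)
        then have "norm (y + t *\<^sub>R b) \<le> \<rho> + R" using t y Cons(2)[of b] by simp
        then have aff': "affine_subharmonic_at D2 x (y + t *\<^sub>R b)"
          by (intro aff[of "\<rho> + R"] h) (auto simp: algebra_simps)
        \<comment> \<open>Tilting \<open>(e, A e)\<close> by \<open>a e\<close> along
          \<open>b\<close> gives a graph direction of another linear map: as the basis is
          orthonormal, a rank-one term can take the prescribed value on each
          \<open>e\<close>.\<close>
        define A' where "A' z = A z + (\<Sum>e\<in>Basis. a e * (z \<bullet> e)) *\<^sub>R b" for z
        have "linear A'"
          unfolding A'_def
          by (auto simp: linear_iff linear_add[OF A] linear_scale[OF A] inner_add_left algebra_simps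
              sum.distrib scaleR_sum_left sum_distrib_left scaleR_sum_right)
        then have "(\<Sum>e\<in>Basis. D2 (x, y + t *\<^sub>R b) (e, A' e) (e, A' e)) \<ge> 0"
          using aff' by (simp add: affine_subharmonic_at_def)
        moreover have "A' e = A e + a e *\<^sub>R b" if "e \<in> Basis" for e
          using that by (simp add: A'_def inner_Basis if_distrib cong: if_cong)
        ultimately show "(\<Sum>e\<in>Basis. D2 ((x, y) + t *\<^sub>R (0, b)) ((e, A e) + a e *\<^sub>R (0, b)) ((e, A e) + a e *\<^sub>R (0, b))) \<ge> 0"
          by simp
      qed auto
    qed
    ultimately show ?case by blast
  qed
  then show ?thesis using that by blast
qed

lemma ennreal_exp_log_slab_integral:
  fixes f :: "'a::euclidean_space \<Rightarrow> real"
  assumes f: "continuous_on UNIV f" and R: "R > 0"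
  shows "ennreal (exp (- log_slab_integral R b f w))
    = (\<integral>\<^sup>+t. ennreal (exp (- f (w + t *\<^sub>R b))) * indicator {-R..R} t \<partial>lborel)"
    and "continuous_on UNIV (log_slab_integral R b f)"
proof -
  have c: "continuous_on S (\<lambda>t. - f (w + t *\<^sub>R b))" for S w
    by (intro continuous_on_minus continuous_on_line f)
  have pos: "integral {-R..R} (\<lambda>t. exp (- f (w + t *\<^sub>R b))) > 0" for w
    using R by (intro integral_exp_pos c) auto
  have "(\<integral>\<^sup>+t. ennreal (exp (- f (w + t *\<^sub>R b))) * indicator {-R..R} t \<partial>lborel)
    = ennreal (integral {-R..R} (\<lambda>t. exp (- f (w + t *\<^sub>R b))))"
  proof -
    have "((\<lambda>t. exp (- f (w + t *\<^sub>R b))) has_integral integral {-R..R} (\<lambda>t. exp (- f (w + t *\<^sub>R b)))) {-R..R}"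
      by (intro integrable_integral integrable_continuous_interval continuous_on_exp c)
    from nn_integral_has_integral_lebesgue[OF _ this]
    have "(\<integral>\<^sup>+t. ennreal (indicator {-R..R} t * exp (- f (w + t *\<^sub>R b))) \<partial>lborel)
      = ennreal (integral {-R..R} (\<lambda>t. exp (- f (w + t *\<^sub>R b))))" by simp
    moreover have "ennreal (indicator {-R..R} t * exp (- f (w + t *\<^sub>R b)))
      = ennreal (exp (- f (w + t *\<^sub>R b))) * indicator {-R..R} t" for t
      by (simp add: indicator_def)
    ultimately show ?thesis by simp
  qed
  then show "ennreal (exp (- log_slab_integral R b f w))
    = (\<integral>\<^sup>+t. ennreal (exp (- f (w + t *\<^sub>R b))) * indicator {-R..R} t \<partial>lborel)"
    by (simp add: log_slab_integral_def pos)
  show "continuous_on UNIV (log_slab_integral R b f)"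
    unfolding log_slab_integral_def using pos
    by (intro continuous_intros continuous_on_slab_integral[where G="\<lambda>w. exp (- f w)"] f) (metis less_irrefl)
qed

text \<open>Tonelli, one coordinate at a time. The induction treats all \<open>y\<close>
  simultaneously, because the coordinate \<open>t\<close> that is split off is absorbed into
  \<open>y\<close> as a translation.\<close>

lemma nn_integral_log_box_integral:
  fixes f :: "'a::euclidean_space \<times> 'b::euclidean_space \<Rightarrow> real"
  assumes f: "continuous_on UNIV f" and R: "R > 0" and "distinct bs" "set bs \<subseteq> Basis"
  shows "ennreal (exp (- log_box_integral R (map (Pair 0) bs) f (x, y)))
      = (\<integral>\<^sup>+z. ennreal (exp (- f (x, y + (\<Sum>b\<in>set bs. z b *\<^sub>R b)))) * indicator {z. \<forall>b\<in>set bs. \<bar>z b\<bar> \<le> R} z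
          \<partial>Pi\<^sub>M (set bs) (\<lambda>_. lborel))"
    and "continuous_on UNIV (log_box_integral R (map (Pair 0) bs) f)"
proof -
  have "continuous_on UNIV (log_box_integral R (map (Pair 0) bs) f) \<and>
    (\<forall>y. ennreal (exp (- log_box_integral R (map (Pair 0) bs) f (x, y)))
      = (\<integral>\<^sup>+z. ennreal (exp (- f (x, y + (\<Sum>b\<in>set bs. z b *\<^sub>R b)))) * indicator {z. \<forall>b\<in>set bs. \<bar>z b\<bar> \<le> R} z
          \<partial>Pi\<^sub>M (set bs) (\<lambda>_. lborel)))"
    using assms(3,4)
  proof (induction bs)
    case Nil
    interpret product_sigma_finite "\<lambda>_::'b. lborel :: real measure" ..
    show ?case using f by (auto simp: PiM_empty)
  next
    case (Cons b bs)
    interpret product_sigma_finite "\<lambda>_::'b. lborel :: real measure" ..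
    have [measurable]: "f \<in> borel_measurable borel" using f by (rule borel_measurable_continuous_onI)
    have IH: "continuous_on UNIV (log_box_integral R (map (Pair 0) bs) f)"
      "\<And>y. ennreal (exp (- log_box_integral R (map (Pair 0) bs) f (x, y)))
      = (\<integral>\<^sup>+z. ennreal (exp (- f (x, y + (\<Sum>b\<in>set bs. z b *\<^sub>R b)))) * indicator {z. \<forall>b\<in>set bs. \<bar>z b\<bar> \<le> R} z
          \<partial>Pi\<^sub>M (set bs) (\<lambda>_. lborel))"
      using Cons by auto
    note sl = ennreal_exp_log_slab_integral[OF IH(1) R, of "(0, b)"]
    have b: "b \<notin> set bs" using Cons by simp
    have meas: "(\<lambda>z. ennreal (exp (- f (x, y + (\<Sum>b\<in>set cs. z b *\<^sub>R b)))) * indicator {z. \<forall>b\<in>set cs. \<bar>z b\<bar> \<le> R} z)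
      \<in> borel_measurable (Pi\<^sub>M (set cs) (\<lambda>_. lborel))" for cs y
    proof -
      have [measurable]: "(\<lambda>z. \<Sum>b\<in>set cs. z b *\<^sub>R b) \<in> Pi\<^sub>M (set cs) (\<lambda>_. lborel) \<rightarrow>\<^sub>M borel"
        by measurable
      \<comment> \<open>Written as a finite product of indicators of single coordinates, the cutoff
        is measurable for the product measure.\<close>
      have "(\<lambda>z. indicator {z. \<forall>b\<in>set cs. \<bar>z b\<bar> \<le> R} z :: ennreal) = (\<lambda>z. \<Prod>b\<in>set cs. indicator {-R..R} (z b))"
      proof
        fix z
        show "indicator {z. \<forall>b\<in>set cs. \<bar>z b\<bar> \<le> R} z = (\<Prod>b\<in>set cs. indicator {-R..R} (z b) :: ennreal)"
        proof (cases "\<forall>b\<in>set cs. \<bar>z b\<bar> \<le> R")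
          case True
          then have "indicator {-R..R} (z b) = (1 :: ennreal)" if "b \<in> set cs" for b
            using that by (auto simp: abs_le_iff)
          with True show ?thesis by simp
        next
          case False
          then obtain b where b: "b \<in> set cs" "indicator {-R..R} (z b) = (0 :: ennreal)"
            by (auto simp: abs_le_iff)
          then have "(\<Prod>b\<in>set cs. indicator {-R..R} (z b) :: ennreal) = 0"
            by (intro prod_zero) auto
          with False show ?thesis by auto
        qed
      qed
      then show ?thesis by simp
    qed
    have "ennreal (exp (- log_box_integral R (map (Pair 0) (b # bs)) f (x, y)))
      = (\<integral>\<^sup>+z. ennreal (exp (- f (x, y + (\<Sum>b\<in>set (b # bs). z b *\<^sub>R b)))) * indicator {z. \<forall>b\<in>set (b # bs). \<bar>z b\<bar> \<le> R} z
          \<partial>Pi\<^sub>M (set (b # bs)) (\<lambda>_. lborel))" for y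
    proof -
      have "(\<integral>\<^sup>+z. ennreal (exp (- f (x, y + (\<Sum>b\<in>set (b # bs). z b *\<^sub>R b)))) * indicator {z. \<forall>b\<in>set (b # bs). \<bar>z b\<bar> \<le> R} z
          \<partial>Pi\<^sub>M (set (b # bs)) (\<lambda>_. lborel))
        = (\<integral>\<^sup>+t. (\<integral>\<^sup>+z. ennreal (exp (- f (x, y + (\<Sum>c\<in>set (b # bs). (z(b := t)) c *\<^sub>R c)))) *
               indicator {z. \<forall>b\<in>set (b # bs). \<bar>z b\<bar> \<le> R} (z(b := t)) \<partial>Pi\<^sub>M (set bs) (\<lambda>_. lborel)) \<partial>lborel)"
        using meas[of y "b # bs"] unfolding list.set(2)
        by (intro product_nn_integral_insert_rev b) auto
      also have "\<dots> = (\<integral>\<^sup>+t. (\<integral>\<^sup>+z. ennreal (exp (- f (x, (y + t *\<^sub>R b) + (\<Sum>c\<in>set bs. z c *\<^sub>R c)))) *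
               indicator {z. \<forall>b\<in>set bs. \<bar>z b\<bar> \<le> R} z * indicator {-R..R} t \<partial>Pi\<^sub>M (set bs) (\<lambda>_. lborel)) \<partial>lborel)"
      proof (intro nn_integral_cong)
        fix t z
        have "(\<Sum>c\<in>set bs. (z(b := t)) c *\<^sub>R c) = (\<Sum>c\<in>set bs. z c *\<^sub>R c)"
          using b by (intro sum.cong) auto
        moreover have "(\<forall>c\<in>set bs. \<bar>(z(b := t)) c\<bar> \<le> R) \<longleftrightarrow> (\<forall>c\<in>set bs. \<bar>z c\<bar> \<le> R)"
          using b by (auto simp: fun_upd_def)
        ultimately show "ennreal (exp (- f (x, y + (\<Sum>c\<in>set (b # bs). (z(b := t)) c *\<^sub>R c)))) *
               indicator {z. \<forall>b\<in>set (b # bs). \<bar>z b\<bar> \<le> R} (z(b := t))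
          = ennreal (exp (- f (x, (y + t *\<^sub>R b) + (\<Sum>c\<in>set bs. z c *\<^sub>R c)))) *
               indicator {z. \<forall>b\<in>set bs. \<bar>z b\<bar> \<le> R} z * indicator {-R..R} t"
          using b by (auto simp: indicator_def algebra_simps abs_le_iff fun_upd_same simp del: fun_upd_apply)
      qed
      also have "\<dots> = (\<integral>\<^sup>+t. ennreal (exp (- log_box_integral R (map (Pair 0) bs) f (x, y + t *\<^sub>R b))) * indicator {-R..R} t \<partial>lborel)"
        unfolding IH(2) by (intro nn_integral_cong nn_integral_multc meas)
      also have "\<dots> = ennreal (exp (- log_box_integral R (map (Pair 0) (b # bs)) f (x, y)))"
        using sl(1)[of "(x, y)"] by simp
      finally show ?thesis ..
    qed
    then show ?case using sl(2) by simp
  qed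
  then show "ennreal (exp (- log_box_integral R (map (Pair 0) bs) f (x, y)))
      = (\<integral>\<^sup>+z. ennreal (exp (- f (x, y + (\<Sum>b\<in>set bs. z b *\<^sub>R b)))) * indicator {z. \<forall>b\<in>set bs. \<bar>z b\<bar> \<le> R} z
          \<partial>Pi\<^sub>M (set bs) (\<lambda>_. lborel))"
    and "continuous_on UNIV (log_box_integral R (map (Pair 0) bs) f)" by blast+
qed

definition cube :: "real \<Rightarrow> 'a::euclidean_space set"
  where "cube R = {y. \<forall>b\<in>Basis. \<bar>y \<bullet> b\<bar> \<le> R}"

lemma cube_eq_cbox: "cube R = cbox (- R *\<^sub>R One) (R *\<^sub>R One)"
  by (auto simp: cube_def mem_box abs_le_iff inner_sum_left_Basis minus_le_iff)

text \<open>By \<open>lborel_eq\<close>, Lebesgue measure is the image of the product measure under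
  expansion in the basis; the iterated integral started at second component 0 therefore sweeps out
  the cube.\<close>

lemma exp_log_box_integral_eq_cube:
  fixes f :: "'a::euclidean_space \<times> 'b::euclidean_space \<Rightarrow> real"
  assumes f: "continuous_on UNIV f" and R: "R > 0" and bs: "distinct bs" "set bs = Basis"
  shows "ennreal (exp (- log_box_integral R (map (Pair 0) bs) f (x, 0)))
      = (\<integral>\<^sup>+y. ennreal (exp (- f (x, y))) * indicator (cube R) y \<partial>lborel)"
proof -
  have [measurable]: "f \<in> borel_measurable borel" using f by (rule borel_measurable_continuous_onI)
  have [measurable]: "cube R \<in> sets borel" by (simp add: cube_eq_cbox)
  have "(\<integral>\<^sup>+y. ennreal (exp (- f (x, y))) * indicator (cube R) y \<partial>lborel)
    = (\<integral>\<^sup>+z. ennreal (exp (- f (x, \<Sum>b\<in>Basis. z b *\<^sub>R b))) * indicator (cube R) (\<Sum>b\<in>Basis. z b *\<^sub>R b :: 'b)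
         \<partial>Pi\<^sub>M Basis (\<lambda>_. lborel))"
    by (subst lborel_eq, subst nn_integral_distr) auto
  also have "\<dots> = ennreal (exp (- log_box_integral R (map (Pair 0) bs) f (x, 0)))"
    using bs by (subst nn_integral_log_box_integral[OF f R])
      (auto intro!: nn_integral_cong simp: indicator_def cube_def)
  finally show ?thesis ..
qed

section \<open>Sub-mean values and the Laplacian\<close>

text \<open>The difference quotients are dominated by \<open>w\<close>, so that a derivative almost
  everywhere suffices. This is needed for a weight with a kink along the unit sphere.\<close>

lemma has_real_derivative_integral_dominated:
  fixes F :: "real \<Rightarrow> 'a \<Rightarrow> real"
  assumes "\<delta> > 0"
    and int: "\<And>s. \<bar>s - s0\<bar> < \<delta> \<Longrightarrow> integrable M (F s)"
    and F': "F' \<in> borel_measurable M"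
    and deriv: "AE x in M. ((\<lambda>s. F s x) has_real_derivative F' x) (at s0)"
    and bound: "\<And>s x. x \<in> space M \<Longrightarrow> \<bar>s - s0\<bar> < \<delta> \<Longrightarrow> \<bar>F s x - F s0 x\<bar> \<le> w x * \<bar>s - s0\<bar>"
    and w: "integrable M w"
  shows "((\<lambda>s. \<integral>x. F s x \<partial>M) has_real_derivative (\<integral>x. F' x \<partial>M)) (at s0)"
  unfolding has_field_derivative_iff tendsto_at_iff_sequentially
proof (intro allI impI)
  fix X :: "nat \<Rightarrow> real"
  assume X: "\<forall>i. X i \<in> UNIV - {s0}" "X \<longlonglongrightarrow> s0"
  have "eventually (\<lambda>i. \<bar>X i - s0\<bar> < \<delta>) sequentially"
    using X(2) \<open>\<delta> > 0\<close> by (auto simp: tendsto_iff dist_real_def)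
  then obtain N where N: "\<And>i. i \<ge> N \<Longrightarrow> \<bar>X i - s0\<bar> < \<delta>" by (auto simp: eventually_sequentially)
  have i0: "integrable M (F s0)" using int[of s0] \<open>\<delta> > 0\<close> by simp
  have ne: "X i \<noteq> s0" for i using X(1) by auto
  \<comment> \<open>The bound holds only within \<open>\<delta>\<close> of \<open>s0\<close>, while
    dominated convergence wants it for every index. The first \<open>N\<close> terms are dropped
    here and restored by \<open>LIMSEQ_offset\<close>.\<close>
  have "(\<lambda>i. \<integral>x. (F (X (i + N)) x - F s0 x) / (X (i + N) - s0) \<partial>M) \<longlonglongrightarrow> (\<integral>x. F' x \<partial>M)"
  proof (rule integral_dominated_convergence[where w=w])
    show "(\<lambda>x. (F (X (i + N)) x - F s0 x) / (X (i + N) - s0)) \<in> borel_measurable M" for i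
      using int[OF N[of "i + N"]] i0 by auto
    show "AE x in M. norm ((F (X (i + N)) x - F s0 x) / (X (i + N) - s0)) \<le> w x" for i
      using bound[OF _ N[of "i + N"]] ne[of "i + N"] by (auto simp: field_simps)
    have X': "(\<lambda>i. X (i + N)) \<longlonglongrightarrow> s0" using X(2) by (rule LIMSEQ_ignore_initial_segment)
    show "AE x in M. (\<lambda>i. (F (X (i + N)) x - F s0 x) / (X (i + N) - s0)) \<longlonglongrightarrow> F' x"
      using deriv
    proof eventually_elim
      case (elim x)
      then show ?case using X' ne
        unfolding has_field_derivative_iff tendsto_at_iff_sequentially by (auto simp: o_def)
    qed
  qed (use F' w in auto)
  moreover have "(\<integral>x. (F (X (i + N)) x - F s0 x) / (X (i + N) - s0) \<partial>M)
     = ((\<integral>x. F (X (i + N)) x \<partial>M) - (\<integral>x. F s0 x \<partial>M)) / (X (i + N) - s0)" for i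
    using Bochner_Integration.integral_diff[OF int[OF N[of "i + N"]] i0] by simp
  ultimately have "(\<lambda>i. ((\<integral>x. F (X (i + N)) x \<partial>M) - (\<integral>x. F s0 x \<partial>M)) / (X (i + N) - s0)) \<longlonglongrightarrow> (\<integral>x. F' x \<partial>M)"
    by (simp only:)
  then show "((\<lambda>y. ((\<integral>x. F y x \<partial>M) - (\<integral>x. F s0 x \<partial>M)) / (y - s0)) \<circ> X) \<longlonglongrightarrow> (\<integral>x. F' x \<partial>M)"
    unfolding o_def by (rule LIMSEQ_offset)
qed

lemma abs_diff_le_of_deriv_bound:
  fixes f :: "real \<Rightarrow> real"
  assumes "\<And>r. r \<in> closed_segment s0 s \<Longrightarrow> (f has_real_derivative f' r) (at r)"
    "\<And>r. r \<in> closed_segment s0 s \<Longrightarrow> \<bar>f' r\<bar> \<le> C"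
  shows "\<bar>f s - f s0\<bar> \<le> C * \<bar>s - s0\<bar>"
proof -
  have "norm (f s - f s0) \<le> C * norm (s - s0)"
  proof (rule field_differentiable_bound)
    show "(f has_real_derivative f' r) (at r within closed_segment s0 s)" if "r \<in> closed_segment s0 s" for r
      using assms(1)[OF that] by (rule has_field_derivative_at_within)
  qed (use assms(2) in auto)
  then show ?thesis by simp
qed

lemma lborel_integral_translation:
  fixes f :: "'a::euclidean_space \<Rightarrow> real"
  assumes "f \<in> borel_measurable borel"
  shows "(\<integral>x. f (x + c) \<partial>lborel) = (\<integral>x. f x \<partial>lborel)"
proof -
  have "(\<integral>x. f x \<partial>lborel) = (\<integral>x. f x \<partial>distr lborel borel ((+) c))" by (simp add: lborel_distr_plus)
  also have "\<dots> = (\<integral>x. f (x + c) \<partial>lborel)" using assms by (subst integral_distr) (auto simp: add.commute)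
  finally show ?thesis ..
qed

lemma lborel_integral_cball_scale:
  fixes f :: "'a::euclidean_space \<Rightarrow> real"
  assumes "R > 0" "(\<lambda>y. indicator (cball x R) y * f y) \<in> borel_measurable borel"
  shows "(\<integral>y. indicator (cball x R) y * f y \<partial>lborel)
    = R ^ DIM('a) * (\<integral>z. indicator (cball 0 1) z * f (x + R *\<^sub>R z) \<partial>lborel)"
proof -
  have "(\<integral>y. indicator (cball x R) y * f y \<partial>lborel)
     = (\<integral>y. indicator (cball x R) y * f y \<partial>density (distr lborel borel (\<lambda>z. x + R *\<^sub>R z)) (\<lambda>_. ennreal (\<bar>R\<bar> ^ DIM('a))))"
    using assms(1) by (subst lborel_affine[of R x]) auto
  also have "\<dots> = R ^ DIM('a) * (\<integral>z. indicator (cball x R) (x + R *\<^sub>R z) * f (x + R *\<^sub>R z) \<partial>lborel)"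
    using assms by (subst integral_density) (auto simp: integral_distr)
  also have "(\<lambda>z. indicator (cball x R) (x + R *\<^sub>R z) * f (x + R *\<^sub>R z)) = (\<lambda>z. indicator (cball 0 1) z * f (x + R *\<^sub>R z))"
    using assms(1) by (auto simp: fun_eq_iff indicator_def dist_norm)
  finally show ?thesis .
qed

lemma integrable_indicator_compact:
  fixes f :: "'a::euclidean_space \<Rightarrow> real"
  assumes "compact S" "continuous_on S f"
  shows "integrable lborel (\<lambda>x. indicator S x * f x)"
  using borel_integrable_compact[OF assms] by (simp add: indicator_def if_distrib[of "\<lambda>c. c * _"] cong: if_cong)

lemma measurable_indicator_compact:
  fixes f :: "'a::euclidean_space \<Rightarrow> real"
  assumes "compact S" "continuous_on S f"
  shows "(\<lambda>x. indicator S x * f x) \<in> borel_measurable borel"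
  using integrable_indicator_compact[OF assms] by auto

lemma compact_abs_bound:
  fixes f :: "'a::topological_space \<Rightarrow> real"
  assumes "compact S" "continuous_on S f"
  obtains C where "C \<ge> 0" "\<And>x. x \<in> S \<Longrightarrow> \<bar>f x\<bar> \<le> C"
proof -
  have "bounded (f ` S)" using assms compact_continuous_image compact_imp_bounded by blast
  then obtain C where "\<And>x. x \<in> S \<Longrightarrow> \<bar>f x\<bar> \<le> C" by (auto simp: bounded_iff)
  then show ?thesis using that[of "max C 0"] by force
qed

text \<open>The weight \<open>(1 - |z|\<^sup>2) / 2\<close> vanishes on the unit sphere and has gradient \<open>-z\<close>; the product with \<open>g\<close>,
  extended by zero, is Lipschitz, so differentiating the integral of its translates gives zero.\<close>

lemma unit_ball_integration_by_parts:
  fixes g h :: "'a::euclidean_space \<Rightarrow> real"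
  assumes b: "norm b = 1"
    and cont: "continuous_on (cball 0 1) g" "continuous_on (cball 0 1) h"
    and d: "\<And>z. norm z \<le> 1 \<Longrightarrow> ((\<lambda>s. g (z + s *\<^sub>R b)) has_real_derivative h z) (at 0)"
  shows "(\<integral>z. indicator (cball 0 1) z * (g z * (z \<bullet> b)) \<partial>lborel)
    = (\<integral>z. indicator (cball 0 1) z * ((1 - (norm z)\<^sup>2) / 2 * h z) \<partial>lborel)"
proof -
  obtain Cg where Cg: "Cg \<ge> 0" "\<And>z. z \<in> cball 0 1 \<Longrightarrow> \<bar>g z\<bar> \<le> Cg"
    using compact_abs_bound[OF compact_cball cont(1)] by blast
  obtain Ch where Ch: "Ch \<ge> 0" "\<And>z. z \<in> cball 0 1 \<Longrightarrow> \<bar>h z\<bar> \<le> Ch"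
    using compact_abs_bound[OF compact_cball cont(2)] by blast
  define w :: "'a \<Rightarrow> real" where "w z = max 0 ((1 - (norm z)\<^sup>2) / 2)" for z
  define G where "G z = w z * g z" for z
  define G' where "G' z = indicator (cball 0 1) z * ((1 - (norm z)\<^sup>2) / 2 * h z - g z * (z \<bullet> b))" for z
  have w0: "w z = 0" if "norm z \<ge> 1" for z
    using that power_mono[of 1 "norm z" 2] by (auto simp: w_def)
  have w1: "w z = (1 - (norm z)\<^sup>2) / 2" if "norm z \<le> 1" for z
    using that power_mono[of "norm z" 1 2] by (auto simp: w_def)
  have Gind: "G z = indicator (cball 0 1) z * ((1 - (norm z)\<^sup>2) / 2 * g z)" for z
    using w0[of z] w1[of z] by (auto simp: G_def indicator_def)
  have mG: "G \<in> borel_measurable borel" unfolding Gind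
    by (intro measurable_indicator_compact continuous_intros cont) auto
  have iG: "integrable lborel G" unfolding Gind
    by (intro integrable_indicator_compact continuous_intros cont) auto
  have wb: "0 \<le> w z" "w z \<le> 1" for z by (auto simp: w_def) (smt (verit) zero_le_power2)
  \<comment> \<open>One of the two points lies in the unit ball and the other within distance 1 of
    it, so their norms add up to at most 3; half of \<open>3 * r\<close> is at most
    \<open>2 * r\<close>.\<close>
  have wl: "\<bar>w z' - w z\<bar> \<le> 2 * r" if zz: "norm (z' - z) \<le> r" "r \<le> 1" "norm z \<le> 1 \<or> norm z' \<le> 1" for z z' r
  proof -
    have n: "\<bar>norm z' - norm z\<bar> \<le> r" using norm_triangle_ineq3[of z' z] zz by simp
    then have "norm z + norm z' \<le> 3" using zz by linarith
    then have "\<bar>norm z' - norm z\<bar> * (norm z + norm z') \<le> r * 3"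
      using n by (intro mult_mono) auto
    moreover have "\<bar>(norm z')\<^sup>2 - (norm z)\<^sup>2\<bar> = \<bar>norm z' - norm z\<bar> * (norm z + norm z')"
      by (simp add: power2_eq_square square_diff_square_factored abs_mult add.commute)
    ultimately have "\<bar>(norm z')\<^sup>2 - (norm z)\<^sup>2\<bar> \<le> r * 3" by simp
    then have "\<bar>(1 - (norm z')\<^sup>2) / 2 - (1 - (norm z)\<^sup>2) / 2\<bar> \<le> 2 * r" 
    proof -
      have "0 \<le> r" using n by linarith
      moreover have "\<bar>(1 - p) / 2 - (1 - q) / 2\<bar> \<le> 2 * r" if "\<bar>p - q\<bar> \<le> r * 3" "0 \<le> r" for p q :: real
      proof -
        have "(1 - p) / 2 - (1 - q) / 2 = (q - p) / 2" by (simp add: diff_divide_distrib)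
        then have "\<bar>(1 - p) / 2 - (1 - q) / 2\<bar> = \<bar>p - q\<bar> / 2" by (simp only: abs_divide) (simp add: abs_minus_commute)
        then show ?thesis using that by simp
      qed
      moreover assume "\<bar>(norm z')\<^sup>2 - (norm z)\<^sup>2\<bar> \<le> r * 3"
      ultimately show ?thesis by blast
    qed
    moreover have "\<bar>max 0 p - max 0 q\<bar> \<le> \<bar>p - q\<bar>" for p q :: real by (simp add: max_def)
    ultimately show ?thesis unfolding w_def by (blast intro: order_trans)
  qed
  have gl: "\<bar>g (z + s *\<^sub>R b) - g z\<bar> \<le> Ch * \<bar>s\<bar>" if z: "norm z \<le> 1" "norm (z + s *\<^sub>R b) \<le> 1" for z s
  proof -
    have sg: "norm (z + r *\<^sub>R b) \<le> 1" if r: "r \<in> closed_segment 0 s" for r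
    proof -
      obtain u where u: "0 \<le> u" "u \<le> 1" "r = u * s" using r by (auto simp: in_segment)
      have "z + r *\<^sub>R b = (1 - u) *\<^sub>R z + u *\<^sub>R (z + s *\<^sub>R b)" using u by (simp add: algebra_simps)
      moreover have "\<dots> \<in> cball 0 1"
        using z u by (intro convexD[OF convex_cball]) auto
      ultimately show ?thesis by simp
    qed
    have "((\<lambda>s. g (z + s *\<^sub>R b)) has_real_derivative h (z + r *\<^sub>R b)) (at r)" if "r \<in> closed_segment 0 s" for r
    proof -
      have "((\<lambda>t. g ((z + r *\<^sub>R b) + (t + - r) *\<^sub>R b)) has_real_derivative h (z + r *\<^sub>R b)) (at r)"
        using DERIV_shift[of "\<lambda>t. g ((z + r *\<^sub>R b) + t *\<^sub>R b)" "h (z + r *\<^sub>R b)" r "-r"] d[OF sg[OF that]] by simp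
      then show ?thesis by (simp add: algebra_simps)
    qed
    then have "\<bar>g (z + s *\<^sub>R b) - g (z + 0 *\<^sub>R b)\<bar> \<le> Ch * \<bar>s - 0\<bar>"
      by (rule abs_diff_le_of_deriv_bound) (use Ch(2) sg in auto)
    then show ?thesis by simp
  qed
  \<comment> \<open>\<open>g\<close> is controlled on the closed unit ball only. If one of the two
    points lies outside, the weight vanishes there and its own Lipschitz bound is enough; if both
    do, nothing changes. Shifts by less than 1 keep the affected \<open>z\<close> within
    \<open>cball 0 2\<close>.\<close>
  have lip: "\<bar>G (z + s *\<^sub>R b) - G z\<bar> \<le> (indicator (cball 0 2) z * (2 * Cg + Ch)) * \<bar>s\<bar>" if s: "\<bar>s\<bar> < 1" for z s
  proof -
    let ?z = "z + s *\<^sub>R b"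
    have n: "norm (?z - z) \<le> \<bar>s\<bar>" using b by simp
    have tri: "norm z \<le> norm ?z + \<bar>s\<bar>" using norm_triangle_ineq4[of ?z "s *\<^sub>R b"] b by simp
    consider "norm z \<le> 1" "norm ?z \<le> 1" | "norm z > 1" "norm ?z \<le> 1" | "norm z \<le> 1" "norm ?z > 1"
      | "norm z > 1" "norm ?z > 1" by linarith
    then show ?thesis
    proof cases
      case 1
      have "G ?z - G z = w ?z * (g ?z - g z) + (w ?z - w z) * g z" by (simp add: G_def algebra_simps)
      also have "\<bar>\<dots>\<bar> \<le> w ?z * \<bar>g ?z - g z\<bar> + \<bar>w ?z - w z\<bar> * \<bar>g z\<bar>"
        using abs_triangle_ineq[of "w ?z * (g ?z - g z)" "(w ?z - w z) * g z"] wb(1)[of ?z] by (simp add: abs_mult)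
      also have "\<dots> \<le> 1 * (Ch * \<bar>s\<bar>) + (2 * \<bar>s\<bar>) * Cg"
        using wl[OF n] s 1 Cg(2)[of z] wb[of ?z] gl[OF 1] by (intro add_mono mult_mono) auto
      finally show ?thesis using 1 by (simp add: algebra_simps)
    next
      case 2
      have "\<bar>G ?z - G z\<bar> = \<bar>w ?z - w z\<bar> * \<bar>g ?z\<bar>" using 2 w0[of z] by (simp add: G_def abs_mult)
      also have "\<dots> \<le> (2 * \<bar>s\<bar>) * Cg" using wl[OF n] s 2 Cg(2)[of ?z] by (intro mult_mono) auto
      finally have "\<bar>G ?z - G z\<bar> \<le> (2 * Cg + Ch) * \<bar>s\<bar>" 
        using mult_nonneg_nonneg[OF Ch(1) abs_ge_zero[of s]] by (simp add: algebra_simps)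
      then show ?thesis using 2 tri s by (simp add: indicator_def)
    next
      case 3
      have "\<bar>G ?z - G z\<bar> = \<bar>w ?z - w z\<bar> * \<bar>g z\<bar>" using 3 w0[of ?z] by (simp add: G_def abs_mult)
      also have "\<dots> \<le> (2 * \<bar>s\<bar>) * Cg" using wl[OF n] s 3 Cg(2)[of z] by (intro mult_mono) auto
      finally have "\<bar>G ?z - G z\<bar> \<le> (2 * Cg + Ch) * \<bar>s\<bar>" 
        using mult_nonneg_nonneg[OF Ch(1) abs_ge_zero[of s]] by (simp add: algebra_simps)
      then show ?thesis using 3 by (simp add: indicator_def)
    next
      case 4
      then show ?thesis using w0[of z] w0[of ?z] Cg(1) Ch(1) by (simp add: G_def)
    qed
  qed
  have "((\<lambda>s. \<integral>z. G (z + s *\<^sub>R b) \<partial>lborel) has_real_derivative (\<integral>z. G' z \<partial>lborel)) (at 0)"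
  proof (rule has_real_derivative_integral_dominated[where \<delta>=1 and w="\<lambda>z. indicator (cball 0 2) z * (2 * Cg + Ch)"])
    show "integrable lborel (\<lambda>z. G (z + s *\<^sub>R b))" for s
    proof -
      have "integrable (distr lborel borel ((+) (s *\<^sub>R b))) G" using iG by (simp add: lborel_distr_plus)
      then show ?thesis using mG by (subst (asm) integrable_distr_eq) (auto simp: add.commute)
    qed
    show "G' \<in> borel_measurable lborel" unfolding G'_def
      by (intro borel_measurable_integrable integrable_indicator_compact continuous_intros cont) auto
    \<comment> \<open>Across the unit sphere the weight has a kink and \<open>G\<close> may fail to
      be differentiable, but the sphere is a null set.\<close>
    have "AE z::'a in lborel. norm z \<noteq> 1"
    proof -
      have "sphere (0::'a) 1 \<in> null_sets lborel"
        using negligible_sphere[of "0::'a" 1] by (auto simp: negligible_iff_null_sets null_sets_completion_iff)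
      then have "AE z in lborel. z \<notin> sphere (0::'a) 1" by (rule AE_not_in)
      then show ?thesis by eventually_elim auto
    qed
    then show "AE z in lborel. ((\<lambda>s. G (z + s *\<^sub>R b)) has_real_derivative G' z) (at 0)"
    proof eventually_elim
      case (elim z)
      show ?case
      proof (cases "norm z < 1")
        case True
        have "((\<lambda>s. (1 - (z + s *\<^sub>R b) \<bullet> (z + s *\<^sub>R b)) / 2) has_real_derivative - (z \<bullet> b)) (at 0)"
          unfolding inner_add_left inner_add_right inner_scaleR_left inner_scaleR_right
          by (rule derivative_eq_intros refl | simp add: inner_commute)+
        then have "((\<lambda>s. (1 - (norm (z + s *\<^sub>R b))\<^sup>2) / 2 * g (z + s *\<^sub>R b)) has_real_derivative G' z) (at 0)"
          unfolding power2_norm_eq_inner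
          by (rule DERIV_cong[OF DERIV_mult]) (use d[of z] True in \<open>auto simp: G'_def power2_norm_eq_inner\<close>)
        moreover have "open {s. norm (z + s *\<^sub>R b) < 1}"
          by (intro open_Collect_less continuous_intros)
        ultimately show ?thesis
          by (rule has_field_derivative_transform_within_open) (use True in \<open>auto simp: G_def w1\<close>)
      next
        case False
        have "open {s. norm (z + s *\<^sub>R b) > 1}"
          by (intro open_Collect_less continuous_intros)
        then have "((\<lambda>s. G (z + s *\<^sub>R b)) has_real_derivative 0) (at 0)"
          by (rule has_field_derivative_transform_within_open[OF DERIV_const[of 0]])
             (use False elim in \<open>auto simp: G_def w0\<close>)
        moreover have "G' z = 0" using False elim by (auto simp: G'_def)
        ultimately show ?thesis by simp
      qed
    qed
    show "integrable lborel (\<lambda>z. indicator (cball 0 2) z * (2 * Cg + Ch))"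
      by (intro integrable_indicator_compact continuous_intros) auto
  qed (use lip in auto)
  moreover have "((\<lambda>s. \<integral>z. G (z + s *\<^sub>R b) \<partial>lborel) has_real_derivative 0) (at 0)"
    by (simp add: lborel_integral_translation[OF mG])
  ultimately have "(\<integral>z. G' z \<partial>lborel) = 0" by (rule DERIV_unique)
  moreover have "(\<integral>z. G' z \<partial>lborel) = (\<integral>z. indicator (cball 0 1) z * ((1 - (norm z)\<^sup>2) / 2 * h z) \<partial>lborel)
     - (\<integral>z. indicator (cball 0 1) z * (g z * (z \<bullet> b)) \<partial>lborel)"
    unfolding G'_def right_diff_distrib
    by (intro Bochner_Integration.integral_diff integrable_indicator_compact continuous_intros cont) auto
  ultimately show ?thesis by simp
qed


text \<open>\<open>g b\<close> and \<open>h b\<close> are the first and second pure partial derivatives of \<open>u\<close> in direction \<open>b\<close>.\<close>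

locale pure_second_partials =
  fixes S :: "'a::euclidean_space set" and u :: "'a \<Rightarrow> real" and g h :: "'a \<Rightarrow> 'a \<Rightarrow> real"
  assumes du: "\<And>y v. y \<in> S \<Longrightarrow> ((\<lambda>s. u (y + s *\<^sub>R v)) has_real_derivative (\<Sum>b\<in>Basis. (v \<bullet> b) * g b y)) (at 0)"
    and dg: "\<And>y b. y \<in> S \<Longrightarrow> b \<in> Basis \<Longrightarrow> ((\<lambda>s. g b (y + s *\<^sub>R b)) has_real_derivative h b y) (at 0)"
    and cu: "continuous_on S u"
    and cg: "\<And>b. b \<in> Basis \<Longrightarrow> continuous_on S (g b)"
    and ch: "\<And>b. b \<in> Basis \<Longrightarrow> continuous_on S (h b)"
begin

text \<open>Rescaled to the unit ball, so that the radius enters through the integrand alone and the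
  value at radius 0 makes sense. The volume of the ball is not divided out.\<close>

definition ball_mean :: "'a \<Rightarrow> real \<Rightarrow> real"
  where "ball_mean x \<rho> = (\<integral>z. indicator (cball 0 1) z * u (x + \<rho> *\<^sub>R z) \<partial>lborel)"

text \<open>The radial derivative after integration by parts. The weight is nonnegative on the unit
  ball, so a sign of the Laplacian becomes monotonicity in the radius.\<close>

definition ball_mean_deriv :: "'a \<Rightarrow> real \<Rightarrow> real"
  where "ball_mean_deriv x \<rho> = \<rho> * (\<integral>z. indicator (cball 0 1) z *
     ((1 - (norm z)\<^sup>2) / 2 * (\<Sum>b\<in>Basis. h b (x + \<rho> *\<^sub>R z))) \<partial>lborel)"

lemma scaled_in:
  assumes "cball x R \<subseteq> S" "\<bar>\<rho>\<bar> \<le> R" "norm z \<le> 1"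
  shows "x + \<rho> *\<^sub>R z \<in> S" "x + \<rho> *\<^sub>R z \<in> cball x R"
proof -
  have "\<bar>\<rho>\<bar> * norm z \<le> R * 1" using assms by (intro mult_mono) auto
  then show "x + \<rho> *\<^sub>R z \<in> cball x R" by (simp add: dist_norm)
  then show "x + \<rho> *\<^sub>R z \<in> S" using assms by auto
qed

lemma continuous_on_scaled:
  assumes "continuous_on S f" "cball x R \<subseteq> S" "\<bar>\<rho>\<bar> \<le> R"
  shows "continuous_on (cball 0 1) (\<lambda>z. f (x + \<rho> *\<^sub>R z))"
  by (rule continuous_on_compose2[OF assms(1)]) (auto intro!: continuous_intros scaled_in[OF assms(2,3)])

lemma du_line:
  assumes "x + s *\<^sub>R z \<in> S"
  shows "((\<lambda>s. u (x + s *\<^sub>R z)) has_real_derivative (\<Sum>b\<in>Basis. (z \<bullet> b) * g b (x + s *\<^sub>R z))) (at s)"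
proof -
  have "((\<lambda>t. u ((x + s *\<^sub>R z) + (t + - s) *\<^sub>R z)) has_real_derivative (\<Sum>b\<in>Basis. (z \<bullet> b) * g b (x + s *\<^sub>R z))) (at s)"
    using DERIV_shift[of "\<lambda>t. u ((x + s *\<^sub>R z) + t *\<^sub>R z)" "\<Sum>b\<in>Basis. (z \<bullet> b) * g b (x + s *\<^sub>R z)" s "-s"]
      du[OF assms, of z] by simp
  then show ?thesis by (simp add: algebra_simps)
qed

lemma gradient_bound:
  assumes "cball x R \<subseteq> S"
  obtains C where "C \<ge> 0" "\<And>y z. y \<in> cball x R \<Longrightarrow> norm z \<le> 1 \<Longrightarrow> \<bar>\<Sum>b\<in>Basis. (z \<bullet> b) * g b y\<bar> \<le> C"
proof -
  have "continuous_on (cball x R) (\<lambda>y. \<Sum>b\<in>Basis. \<bar>g b y\<bar>)"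
    by (intro continuous_intros) (use cg assms in \<open>auto intro: continuous_on_subset\<close>)
  then obtain C where C: "C \<ge> 0" "\<And>y. y \<in> cball x R \<Longrightarrow> \<bar>\<Sum>b\<in>Basis. \<bar>g b y\<bar>\<bar> \<le> C"
    using compact_abs_bound[OF compact_cball] by blast
  have "\<bar>\<Sum>b\<in>Basis. (z \<bullet> b) * g b y\<bar> \<le> C" if "y \<in> cball x R" "norm z \<le> 1" for y z
  proof -
    have "\<bar>\<Sum>b\<in>Basis. (z \<bullet> b) * g b y\<bar> \<le> (\<Sum>b\<in>Basis. \<bar>(z \<bullet> b) * g b y\<bar>)" by (rule sum_abs)
    also have "\<dots> \<le> (\<Sum>b\<in>Basis. 1 * \<bar>g b y\<bar>)"
      unfolding abs_mult using that(2) by (intro sum_mono mult_right_mono) (auto intro: order_trans[OF Basis_le_norm])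
    also have "\<dots> \<le> C" using C(2)[OF that(1)] by simp
    finally show ?thesis .
  qed
  then show ?thesis using that C(1) by blast
qed

lemma ball_mean_lipschitz:
  assumes "cball x R \<subseteq> S"
  obtains C where "C \<ge> 0"
    "\<And>s s0 z. \<bar>s\<bar> \<le> R \<Longrightarrow> \<bar>s0\<bar> \<le> R \<Longrightarrow> norm z \<le> 1 \<Longrightarrow> \<bar>u (x + s *\<^sub>R z) - u (x + s0 *\<^sub>R z)\<bar> \<le> C * \<bar>s - s0\<bar>"
proof -
  obtain C where C: "C \<ge> 0" "\<And>y z. y \<in> cball x R \<Longrightarrow> norm z \<le> 1 \<Longrightarrow> \<bar>\<Sum>b\<in>Basis. (z \<bullet> b) * g b y\<bar> \<le> C"
    using gradient_bound[OF assms] by blast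
  have "\<bar>u (x + s *\<^sub>R z) - u (x + s0 *\<^sub>R z)\<bar> \<le> C * \<bar>s - s0\<bar>"
    if "\<bar>s\<bar> \<le> R" "\<bar>s0\<bar> \<le> R" "norm z \<le> 1" for s s0 z
  proof (rule abs_diff_le_of_deriv_bound)
    fix r assume "r \<in> closed_segment s0 s"
    then have r: "\<bar>r\<bar> \<le> R" using that by (auto simp: closed_segment_eq_real_ivl abs_le_iff split: if_splits)
    show "((\<lambda>s. u (x + s *\<^sub>R z)) has_real_derivative (\<Sum>b\<in>Basis. (z \<bullet> b) * g b (x + r *\<^sub>R z))) (at r)"
      by (rule du_line) (rule scaled_in[OF assms r that(3)])
    show "\<bar>\<Sum>b\<in>Basis. (z \<bullet> b) * g b (x + r *\<^sub>R z)\<bar> \<le> C"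
      using C(2) scaled_in(2)[OF assms r that(3)] that(3) by blast
  qed
  then show ?thesis using that C(1) by blast
qed

lemma integrable_scaled:
  fixes f :: "'a \<Rightarrow> real"
  assumes "continuous_on S f" "cball x R \<subseteq> S" "\<bar>\<rho>\<bar> \<le> R"
  shows "integrable lborel (\<lambda>z. indicator (cball 0 1) z * f (x + \<rho> *\<^sub>R z))"
  by (intro integrable_indicator_compact continuous_on_scaled[OF assms]) auto

text \<open>Differentiation under the integral produces the radial derivative of \<open>u\<close>, a
  sum of terms \<open>(z \<bullet> b) * g b\<close>. Integration by parts in each coordinate trades
  the factor \<open>z \<bullet> b\<close> for the weight and \<open>g b\<close> for
  \<open>h b\<close>; the factor \<open>\<rho>\<close> comes from the chain rule.\<close>

lemma ball_mean_has_derivative: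
  assumes sub: "cball x R \<subseteq> S" and \<rho>: "0 < \<rho>" "\<rho> < R"
  shows "(ball_mean x has_real_derivative ball_mean_deriv x \<rho>) (at \<rho>)"
proof -
  obtain C where C: "C \<ge> 0"
    "\<And>s s0 z. \<bar>s\<bar> \<le> R \<Longrightarrow> \<bar>s0\<bar> \<le> R \<Longrightarrow> norm z \<le> 1 \<Longrightarrow> \<bar>u (x + s *\<^sub>R z) - u (x + s0 *\<^sub>R z)\<bar> \<le> C * \<bar>s - s0\<bar>"
    using ball_mean_lipschitz[OF sub] by blast
  have \<rho>': "\<bar>\<rho>\<bar> \<le> R" using \<rho> by simp
  have cgs: "continuous_on (cball 0 1) (\<lambda>z. g b (x + \<rho> *\<^sub>R z))"
    "continuous_on (cball 0 1) (\<lambda>z. h b (x + \<rho> *\<^sub>R z))" if "b \<in> Basis" for b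
    by (intro continuous_on_scaled[OF _ sub \<rho>'] cg ch that)+
  have "((\<lambda>\<rho>. \<integral>z. indicator (cball 0 1) z * u (x + \<rho> *\<^sub>R z) \<partial>lborel) has_real_derivative
     (\<integral>z. indicator (cball 0 1) z * (\<Sum>b\<in>Basis. (z \<bullet> b) * g b (x + \<rho> *\<^sub>R z)) \<partial>lborel)) (at \<rho>)"
  proof (rule has_real_derivative_integral_dominated[where \<delta>="min \<rho> (R - \<rho>)" and w="\<lambda>z. indicator (cball 0 1) z * C"])
    show "min \<rho> (R - \<rho>) > 0" using \<rho> by simp
    show "integrable lborel (\<lambda>z. indicator (cball 0 1) z * u (x + s *\<^sub>R z))" if "\<bar>s - \<rho>\<bar> < min \<rho> (R - \<rho>)" for s
      by (rule integrable_scaled[OF cu sub]) (use that in auto)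
    show "(\<lambda>z. indicator (cball 0 1) z * (\<Sum>b\<in>Basis. (z \<bullet> b) * g b (x + \<rho> *\<^sub>R z))) \<in> borel_measurable lborel"
      by (intro borel_measurable_integrable integrable_indicator_compact continuous_intros cgs) auto
    show "AE z in lborel. ((\<lambda>s. indicator (cball 0 1) z * u (x + s *\<^sub>R z)) has_real_derivative
        indicator (cball 0 1) z * (\<Sum>b\<in>Basis. (z \<bullet> b) * g b (x + \<rho> *\<^sub>R z))) (at \<rho>)"
    proof (intro AE_I2)
      fix z
      show "((\<lambda>s. indicator (cball 0 1) z * u (x + s *\<^sub>R z)) has_real_derivative
        indicator (cball 0 1) z * (\<Sum>b\<in>Basis. (z \<bullet> b) * g b (x + \<rho> *\<^sub>R z))) (at \<rho>)"
      proof (cases "norm z \<le> 1")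
        case True
        then show ?thesis using du_line[OF scaled_in(1)[OF sub \<rho>' True]] by (simp add: indicator_def)
      qed (simp add: indicator_def)
    qed
    show "\<bar>indicator (cball 0 1) z * u (x + s *\<^sub>R z) - indicator (cball 0 1) z * u (x + \<rho> *\<^sub>R z)\<bar>
       \<le> indicator (cball 0 1) z * C * \<bar>s - \<rho>\<bar>" if "\<bar>s - \<rho>\<bar> < min \<rho> (R - \<rho>)" for s z
      using C(2)[of s \<rho> z] that \<rho>' by (auto simp: indicator_def)
    show "integrable lborel (\<lambda>z::'a. indicator (cball 0 1) z * C)"
      by (intro integrable_indicator_compact continuous_intros) auto
  qed
  moreover have "(\<integral>z. indicator (cball 0 1) z * (\<Sum>b\<in>Basis. (z \<bullet> b) * g b (x + \<rho> *\<^sub>R z)) \<partial>lborel)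
     = ball_mean_deriv x \<rho>"
  proof -
    have parts: "(\<integral>z. indicator (cball 0 1) z * (g b (x + \<rho> *\<^sub>R z) * (z \<bullet> b)) \<partial>lborel)
      = (\<integral>z. indicator (cball 0 1) z * ((1 - (norm z)\<^sup>2) / 2 * (\<rho> * h b (x + \<rho> *\<^sub>R z))) \<partial>lborel)" if b: "b \<in> Basis" for b
    proof (rule unit_ball_integration_by_parts)
      fix z :: 'a assume z: "norm z \<le> 1"
      have "((\<lambda>s. g b (x + \<rho> *\<^sub>R z + (\<rho> * s) *\<^sub>R b)) has_real_derivative h b (x + \<rho> *\<^sub>R z) * \<rho>) (at 0)"
        by (rule DERIV_chain2[where f="\<lambda>s. g b (x + \<rho> *\<^sub>R z + s *\<^sub>R b)" and g="\<lambda>s. \<rho> * s"])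
           (use dg[OF scaled_in(1)[OF sub \<rho>' z] b] in \<open>auto intro!: derivative_eq_intros\<close>)
      then show "((\<lambda>s. g b (x + \<rho> *\<^sub>R (z + s *\<^sub>R b))) has_real_derivative \<rho> * h b (x + \<rho> *\<^sub>R z)) (at 0)"
        by (simp add: algebra_simps)
    qed (use b cgs in \<open>auto intro!: continuous_intros\<close>)
    have aux: "(\<Sum>b\<in>Basis. i * (c * (\<rho> * H b))) = \<rho> * (i * (c * (\<Sum>b\<in>Basis. H b)))" for i c and H :: "'a \<Rightarrow> real"
      by (simp add: sum_distrib_left mult.left_commute)
    have "(\<integral>z. indicator (cball 0 1) z * (\<Sum>b\<in>Basis. (z \<bullet> b) * g b (x + \<rho> *\<^sub>R z)) \<partial>lborel)
      = (\<Sum>b\<in>Basis. (\<integral>z. indicator (cball 0 1) z * (g b (x + \<rho> *\<^sub>R z) * (z \<bullet> b)) \<partial>lborel))"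
      unfolding sum_distrib_left
      by (subst Bochner_Integration.integral_sum)
         (auto intro!: integrable_indicator_compact continuous_intros cgs simp: mult.commute)
    also have "\<dots> = (\<Sum>b\<in>Basis. (\<integral>z. indicator (cball 0 1) z * ((1 - (norm z)\<^sup>2) / 2 * (\<rho> * h b (x + \<rho> *\<^sub>R z))) \<partial>lborel))"
      by (intro sum.cong parts) auto
    also have "\<dots> = (\<integral>z. (\<Sum>b\<in>Basis. indicator (cball 0 1) z * ((1 - (norm z)\<^sup>2) / 2 * (\<rho> * h b (x + \<rho> *\<^sub>R z)))) \<partial>lborel)"
      by (intro Bochner_Integration.integral_sum[symmetric] integrable_indicator_compact continuous_intros cgs) auto
    also have "\<dots> = (\<integral>z. \<rho> * (indicator (cball 0 1) z * ((1 - (norm z)\<^sup>2) / 2 * (\<Sum>b\<in>Basis. h b (x + \<rho> *\<^sub>R z)))) \<partial>lborel)"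
      by (intro Bochner_Integration.integral_cong refl aux)
    finally show ?thesis by (simp add: ball_mean_deriv_def)
  qed
  ultimately show ?thesis by (simp add: ball_mean_def[abs_def])
qed

text \<open>The derivative is available strictly between 0 and \<open>R\<close>; a Lipschitz bound
  supplies the continuity at both ends that the monotonicity criteria ask for.\<close>

lemma ball_mean_continuous:
  assumes sub: "cball x R \<subseteq> S"
  shows "continuous_on {0..R} (ball_mean x)"
proof -
  obtain C where C: "C \<ge> 0"
    "\<And>s s0 z. \<bar>s\<bar> \<le> R \<Longrightarrow> \<bar>s0\<bar> \<le> R \<Longrightarrow> norm z \<le> 1 \<Longrightarrow> \<bar>u (x + s *\<^sub>R z) - u (x + s0 *\<^sub>R z)\<bar> \<le> C * \<bar>s - s0\<bar>"
    using ball_mean_lipschitz[OF sub] by blast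
  have i1: "integrable lborel (\<lambda>z::'a. indicator (cball 0 1) z * c)" for c :: real
    by (intro integrable_indicator_compact continuous_intros) auto
  define K where "K = (\<integral>z. indicator (cball (0::'a) 1) z * C \<partial>lborel)"
  have "K \<ge> 0" unfolding K_def by (intro Bochner_Integration.integral_nonneg) (use C in auto)
  have "\<bar>ball_mean x s - ball_mean x t\<bar> \<le> K * \<bar>s - t\<bar>" if st: "s \<in> {0..R}" "t \<in> {0..R}" for s t
  proof -
    have i: "integrable lborel (\<lambda>z. indicator (cball 0 1) z * u (x + s *\<^sub>R z))" if "s \<in> {0..R}" for s
      by (rule integrable_scaled[OF cu sub]) (use that in auto)
    have "ball_mean x s - ball_mean x t = (\<integral>z. indicator (cball 0 1) z * u (x + s *\<^sub>R z) - indicator (cball 0 1) z * u (x + t *\<^sub>R z) \<partial>lborel)"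
      unfolding ball_mean_def by (intro Bochner_Integration.integral_diff[symmetric] i st)
    also have "\<bar>\<dots>\<bar> \<le> (\<integral>z. \<bar>indicator (cball 0 1) z * u (x + s *\<^sub>R z) - indicator (cball 0 1) z * u (x + t *\<^sub>R z)\<bar> \<partial>lborel)"
      by (rule integral_abs_bound)
    also have "\<dots> \<le> (\<integral>z. indicator (cball (0::'a) 1) z * (C * \<bar>s - t\<bar>) \<partial>lborel)"
    proof (rule Bochner_Integration.integral_mono)
      show "integrable lborel (\<lambda>z. \<bar>indicator (cball 0 1) z * u (x + s *\<^sub>R z) - indicator (cball 0 1) z * u (x + t *\<^sub>R z)\<bar>)"
        by (intro integrable_abs Bochner_Integration.integrable_diff i st)
      show "integrable lborel (\<lambda>z::'a. indicator (cball 0 1) z * (C * \<bar>s - t\<bar>))" by (rule i1)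
    qed (use C(2)[of s t] st in \<open>auto simp: indicator_def\<close>)
    also have "\<dots> = K * \<bar>s - t\<bar>" by (simp add: K_def mult.assoc[symmetric])
    finally show ?thesis .
  qed
  then have "K-lipschitz_on {0..R} (ball_mean x)"
    using \<open>K \<ge> 0\<close> by (intro lipschitz_onI) (auto simp: dist_real_def)
  then show ?thesis by (rule lipschitz_on_continuous_on)
qed

lemma ball_mean_eq:
  assumes "cball x R \<subseteq> S" "R > 0"
  shows "(\<integral>y. indicator (cball x R) y * u y \<partial>lborel) = R ^ DIM('a) * ball_mean x R"
  unfolding ball_mean_def
  by (rule lborel_integral_cball_scale)
     (use assms cu in \<open>auto intro!: measurable_indicator_compact intro: continuous_on_subset\<close>)

lemma ball_mean_0:
  assumes "R > 0"
  shows "measure lborel (cball x R) * u x = R ^ DIM('a) * ball_mean x 0"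
proof -
  have "measure lborel (cball x R) = (\<integral>y. indicator (cball x R) y * 1 \<partial>lborel)" by simp
  also have "\<dots> = R ^ DIM('a) * (\<integral>z. indicator (cball (0::'a) 1) z * 1 \<partial>lborel)"
    by (rule lborel_integral_cball_scale[OF assms]) (auto intro!: borel_measurable_indicator borel_closed)
  finally show ?thesis by (simp add: ball_mean_def)
qed

text \<open>The ball mean is nondecreasing in the radius, its derivative being a nonnegative weight
  integrated against the Laplacian. Comparing radius 0 with radius \<open>R\<close> gives the
  claim.\<close>

lemma submean_of_laplacian_nonneg:
  assumes sub: "cball x R \<subseteq> S" and R: "R > 0" and nn: "\<And>y. y \<in> cball x R \<Longrightarrow> (\<Sum>b\<in>Basis. h b y) \<ge> 0"
  shows "measure lborel (cball x R) * u x \<le> (\<integral>y. indicator (cball x R) y * u y \<partial>lborel)"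
proof -
  have "ball_mean x 0 \<le> ball_mean x R"
  proof (rule DERIV_nonneg_imp_increasing_open[OF less_imp_le[OF R]])
    fix \<rho> assume \<rho>: "0 < \<rho>" "\<rho> < R"
    have "(\<integral>z. indicator (cball 0 1) z * ((1 - (norm z)\<^sup>2) / 2 * (\<Sum>b\<in>Basis. h b (x + \<rho> *\<^sub>R z))) \<partial>lborel) \<ge> 0"
    proof (rule Bochner_Integration.integral_nonneg)
      fix z :: 'a
      show "0 \<le> indicator (cball 0 1) z * ((1 - (norm z)\<^sup>2) / 2 * (\<Sum>b\<in>Basis. h b (x + \<rho> *\<^sub>R z)))"
        using nn[OF scaled_in(2)[OF sub, of \<rho> z]] \<rho> power_mono[of "norm z" 1 2] by (auto simp: indicator_def)
    qed
    then have "ball_mean_deriv x \<rho> \<ge> 0" using \<rho> by (simp add: ball_mean_deriv_def)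
    then show "\<exists>y. (ball_mean x has_real_derivative y) (at \<rho>) \<and> 0 \<le> y"
      using ball_mean_has_derivative[OF sub \<rho>] by blast
  qed (rule ball_mean_continuous[OF sub])
  then show ?thesis using R by (simp add: ball_mean_eq[OF sub R] ball_mean_0[OF R])
qed

text \<open>A negative Laplacian at \<open>x\<close> stays below half its value,
  \<open>- \<eta>\<close>, on a small ball by continuity. There the ball mean decreases strictly
  with the radius, against the sub-mean inequality.\<close>

lemma laplacian_nonneg_of_submean:
  assumes S: "open S" and x: "x \<in> S" and R0: "R0 > 0"
    and sm: "\<And>\<rho>. 0 < \<rho> \<Longrightarrow> \<rho> \<le> R0 \<Longrightarrow> measure lborel (cball x \<rho>) * u x \<le> (\<integral>y. indicator (cball x \<rho>) y * u y \<partial>lborel)"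
  shows "(\<Sum>b\<in>Basis. h b x) \<ge> 0"
proof (rule ccontr)
  assume neg: "\<not> ?thesis"
  define \<eta> where "\<eta> = - (\<Sum>b\<in>Basis. h b x) / 2"
  have \<eta>: "\<eta> > 0" using neg by (simp add: \<eta>_def)
  have cL: "continuous_on S (\<lambda>y. \<Sum>b\<in>Basis. h b y)" by (intro continuous_intros ch)
  then have "isCont (\<lambda>y. \<Sum>b\<in>Basis. h b y) x" using S x continuous_on_eq_continuous_at by blast
  then have "eventually (\<lambda>y. (\<Sum>b\<in>Basis. h b y) < - \<eta>) (at x)"
    unfolding isCont_def by (rule order_tendstoD) (use neg in \<open>simp add: \<eta>_def\<close>)
  then obtain d where d: "d > 0" and d': "\<And>y. y \<noteq> x \<Longrightarrow> dist y x < d \<Longrightarrow> (\<Sum>b\<in>Basis. h b y) < - \<eta>"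
    by (auto simp: eventually_at)
  have d2: "(\<Sum>b\<in>Basis. h b y) < - \<eta>" if "dist y x < d" for y
    using d'[of y] that neg by (cases "y = x") (auto simp: \<eta>_def)
  obtain e where e: "e > 0" "cball x e \<subseteq> S" using S x open_contains_cball by blast
  define R where "R = min (min e (d / 2)) R0"
  have R: "R > 0" "R < d" "R \<le> R0" using d e R0 by (auto simp: R_def)
  have sub: "cball x R \<subseteq> S" using e by (auto simp: R_def)
  have "ball_mean x R < ball_mean x 0"
  proof (rule DERIV_neg_imp_decreasing_open[OF R(1)])
    fix \<rho> assume \<rho>: "0 < \<rho>" "\<rho> < R"
    let ?W = "\<lambda>z::'a. indicator (cball 0 1) z * ((1 - (norm z)\<^sup>2) / 2 * \<eta>)"
    have iW: "integrable lborel ?W" by (intro integrable_indicator_compact continuous_intros) auto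
    have Wnn: "?W z \<ge> 0" for z using power_mono[of "norm z" 1 2] \<eta> by (auto simp: indicator_def)
    \<comment> \<open>Strictness rests on this integral: \<open>?W\<close> is positive on the open
      unit ball, which is not a null set.\<close>
    have "(\<integral>z. ?W z \<partial>lborel) > 0"
    proof (rule ccontr)
      assume "\<not> ?thesis"
      moreover have "(\<integral>z. ?W z \<partial>lborel) \<ge> 0" by (intro Bochner_Integration.integral_nonneg Wnn)
      ultimately have "(\<integral>z. ?W z \<partial>lborel) = 0" by simp
      then have "AE z in lborel. ?W z = 0" using integral_nonneg_eq_0_iff_AE[OF iW] Wnn by auto
      then have "AE z in lborel. z \<notin> ball (0::'a) 1"
      proof eventually_elim
        case (elim z)
        then show ?case using \<eta> power_strict_mono[of "norm z" 1 2] by (auto simp: indicator_def split: if_splits)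
      qed
      then have "emeasure lborel (ball (0::'a) 1) = 0"
        by (subst (asm) AE_iff_measurable[where N="ball 0 1"]) auto
      then show False using content_ball_pos[of 1 "0::'a"] by (simp add: measure_def)
    qed
    have cs: "continuous_on (cball 0 1) (\<lambda>z. \<Sum>b\<in>Basis. h b (x + \<rho> *\<^sub>R z))"
      using \<rho> by (intro continuous_on_scaled[OF cL sub]) auto
    have "(\<integral>z. indicator (cball 0 1) z * ((1 - (norm z)\<^sup>2) / 2 * (\<Sum>b\<in>Basis. h b (x + \<rho> *\<^sub>R z))) \<partial>lborel)
      \<le> (\<integral>z. - ?W z \<partial>lborel)"
    proof (rule Bochner_Integration.integral_mono)
      show "integrable lborel (\<lambda>z. indicator (cball 0 1) z * ((1 - (norm z)\<^sup>2) / 2 * (\<Sum>b\<in>Basis. h b (x + \<rho> *\<^sub>R z))))"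
        by (intro integrable_indicator_compact continuous_on_mult continuous_on_divide continuous_on_diff
            continuous_on_power continuous_on_norm continuous_on_const continuous_on_id cs) auto
      show "integrable lborel (\<lambda>z. - ?W z)" using iW by (rule Bochner_Integration.integrable_minus)
    next
      fix z :: 'a
      show "indicator (cball 0 1) z * ((1 - (norm z)\<^sup>2) / 2 * (\<Sum>b\<in>Basis. h b (x + \<rho> *\<^sub>R z))) \<le> - ?W z"
      proof (cases "norm z \<le> 1")
        case True
        have "dist (x + \<rho> *\<^sub>R z) x < d"
          using scaled_in(2)[OF sub _ True, of \<rho>] \<rho> R by (auto simp: dist_norm)
        then have "(\<Sum>b\<in>Basis. h b (x + \<rho> *\<^sub>R z)) \<le> - \<eta>" using d2 by force
        from mult_left_mono[OF this, of "(1 - (norm z)\<^sup>2) / 2"]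
        show ?thesis using True power_mono[of "norm z" 1 2] by simp
      qed (simp add: indicator_def)
    qed
    also have "\<dots> < 0" using \<open>(\<integral>z. ?W z \<partial>lborel) > 0\<close> by simp
    finally have "ball_mean_deriv x \<rho> < 0" using \<rho> by (simp add: ball_mean_deriv_def mult_pos_neg)
    then show "\<exists>y. (ball_mean x has_real_derivative y) (at \<rho>) \<and> y < 0"
      using ball_mean_has_derivative[OF sub \<rho>] by blast
  qed (rule ball_mean_continuous[OF sub])
  moreover have "ball_mean x 0 \<le> ball_mean x R"
    using sm[OF R(1,3)] R by (simp add: ball_mean_eq[OF sub R(1)] ball_mean_0[OF R(1)])
  ultimately show False by simp
qed

end

section \<open>Convolution with compactly supported functions\<close>

lemma lborel_integral_reflect:
  fixes f :: "'a::euclidean_space \<Rightarrow> real"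
  assumes "f \<in> borel_measurable borel"
  shows "(\<integral>x. f (c - x) \<partial>lborel) = (\<integral>x. f x \<partial>lborel)"
proof -
  have "(\<integral>x. f x \<partial>lborel) = (\<integral>x. f x \<partial>density (distr lborel borel (\<lambda>z. c + (- 1) *\<^sub>R z)) (\<lambda>_. ennreal (\<bar>- 1\<bar> ^ DIM('a))))"
    by (subst lborel_affine[of "-1" c]) auto
  also have "\<dots> = (\<integral>x. f (c - x) \<partial>lborel)"
    using assms by (subst integral_density) (auto simp: integral_distr)
  finally show ?thesis ..
qed

lemma integrable_indicator_bounded:
  fixes k \<phi> :: "'a::euclidean_space \<Rightarrow> real"
  assumes "compact S" "continuous_on S k" "\<phi> \<in> borel_measurable borel" "\<And>x. \<bar>\<phi> x\<bar> \<le> C"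
  shows "integrable lborel (\<lambda>x. indicator S x * k x * \<phi> x)"
proof (rule Bochner_Integration.integrable_bound)
  have i: "integrable lborel (\<lambda>x. indicator S x * k x)" by (rule integrable_indicator_compact[OF assms(1,2)])
  then show "integrable lborel (\<lambda>x. C * \<bar>indicator S x * k x\<bar>)" by (intro integrable_mult_right integrable_abs)
  show "(\<lambda>x. indicator S x * k x * \<phi> x) \<in> borel_measurable lborel"
    using borel_measurable_times[OF borel_measurable_integrable[OF i], of \<phi>] assms(3) by simp
  show "AE x in lborel. norm (indicator S x * k x * \<phi> x) \<le> norm (C * \<bar>indicator S x * k x\<bar>)"
  proof (rule AE_I2)
    fix x
    have "\<bar>indicator S x * k x\<bar> * \<bar>\<phi> x\<bar> \<le> \<bar>indicator S x * k x\<bar> * \<bar>C\<bar>"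
      using assms(4)[of x] by (intro mult_left_mono) auto
    then show "norm (indicator S x * k x * \<phi> x) \<le> norm (C * \<bar>indicator S x * k x\<bar>)"
      by (simp add: abs_mult mult_ac)
  qed
qed

lemma integrable_indicator_product:
  fixes \<phi> :: "'a::euclidean_space \<times> 'c::euclidean_space \<Rightarrow> real"
  assumes "compact S" "compact T" "continuous_on S p" "continuous_on T k"
    and \<phi>: "\<phi> \<in> borel_measurable borel" "\<And>w. \<bar>\<phi> w\<bar> \<le> C"
  shows "integrable (lborel \<Otimes>\<^sub>M lborel) (\<lambda>(x, z). (indicator S x * p x) * (indicator T z * k z) * \<phi> (x, z))"
proof -
  have "integrable lborel (\<lambda>w. indicator (S \<times> T) w * (p (fst w) * k (snd w)) * \<phi> w)"
    by (intro integrable_indicator_bounded[OF _ _ \<phi>] compact_Times assms continuous_intros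
        continuous_on_compose2[OF assms(3)] continuous_on_compose2[OF assms(4)]) auto
  moreover have "(\<lambda>w. indicator (S \<times> T) w * (p (fst w) * k (snd w)) * \<phi> w)
    = (\<lambda>(x, z). (indicator S x * p x) * (indicator T z * k z) * \<phi> (x, z))"
    by (auto simp: fun_eq_iff indicator_times)
  ultimately show ?thesis by (simp add: lborel_prod)
qed

lemma indicator_integral_swap:
  fixes \<phi> :: "'a::euclidean_space \<times> 'c::euclidean_space \<Rightarrow> real"
  assumes "compact S" "compact T" "continuous_on S p" "continuous_on T k"
    and \<phi>: "\<phi> \<in> borel_measurable borel" "\<And>w. \<bar>\<phi> w\<bar> \<le> C"
  shows "(\<integral>x. indicator S x * p x * (\<integral>z. indicator T z * k z * \<phi> (x, z) \<partial>lborel) \<partial>lborel)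
    = (\<integral>z. indicator T z * k z * (\<integral>x. indicator S x * p x * \<phi> (x, z) \<partial>lborel) \<partial>lborel)"
proof -
  from lborel_pair.Fubini_integral[OF integrable_indicator_product[OF assms]]
  have "(\<integral>z. \<integral>x. (indicator S x * p x) * (indicator T z * k z) * \<phi> (x, z) \<partial>lborel \<partial>lborel)
    = (\<integral>x. \<integral>z. (indicator S x * p x) * (indicator T z * k z) * \<phi> (x, z) \<partial>lborel \<partial>lborel)" .
  moreover have "(\<integral>x. (indicator S x * p x) * (indicator T z * k z) * \<phi> (x, z) \<partial>lborel)
     = indicator T z * k z * (\<integral>x. indicator S x * p x * \<phi> (x, z) \<partial>lborel)" for z
    by (subst integral_mult_right_zero[symmetric]) (simp add: mult_ac)
  moreover have "(\<integral>z. (indicator S x * p x) * (indicator T z * k z) * \<phi> (x, z) \<partial>lborel)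
     = indicator S x * p x * (\<integral>z. indicator T z * k z * \<phi> (x, z) \<partial>lborel)" for x
    by (subst integral_mult_right_zero[symmetric]) (simp add: mult_ac)
  ultimately show ?thesis by simp
qed

text \<open>Only the kink at 0 needs work: an exponent of at least 2 leaves a positive power of
  \<open>h\<close> in the difference quotient. The exponents 3 and 2 provide the two derivatives of
  the bump profile.\<close>

lemma DERIV_max0_power:
  "((\<lambda>u. max 0 u ^ Suc (Suc n)) has_real_derivative real (Suc (Suc n)) * max 0 u ^ Suc n) (at u)"
proof -
  consider "u < 0" | "u > 0" | "u = 0" by linarith
  then show ?thesis
  proof cases
    case 1
    have "((\<lambda>u. max 0 u ^ Suc (Suc n)) has_real_derivative 0) (at u)"
      by (rule has_field_derivative_transform_within_open[OF DERIV_const[of 0], where S="{..<0}"]) (use 1 in auto)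
    then show ?thesis using 1 by simp
  next
    case 2
    have "((\<lambda>u. u ^ Suc (Suc n)) has_real_derivative real (Suc (Suc n)) * u ^ Suc n) (at u)"
      using DERIV_pow[where n="Suc (Suc n)" and x=u] by simp
    then have "((\<lambda>u. max 0 u ^ Suc (Suc n)) has_real_derivative real (Suc (Suc n)) * u ^ Suc n) (at u)"
      by (rule has_field_derivative_transform_within_open[where S="{0<..}"]) (use 2 in auto)
    then show ?thesis using 2 by simp
  next
    case 3
    have "((\<lambda>h::real. max 0 h ^ Suc (Suc n) / h) \<longlongrightarrow> 0) (at 0)"
    proof (rule Lim_null_comparison)
      have "norm (max 0 h ^ Suc (Suc n) / h) \<le> \<bar>h\<bar> ^ Suc n" for h :: real
        by (cases "h > 0") (auto simp: max_def intro!: mult_nonpos_nonneg)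
      then show "\<forall>\<^sub>F h in at 0. norm (max 0 h ^ Suc (Suc n) / h) \<le> \<bar>h\<bar> ^ Suc n" by simp
      show "((\<lambda>h::real. \<bar>h\<bar> ^ Suc n) \<longlongrightarrow> 0) (at 0)" by (auto intro!: tendsto_eq_intros)
    qed
    then show ?thesis using 3 by (simp add: has_field_derivative_iff)
  qed
qed

section \<open>Compositions and products of twice differentiable functions\<close>

lemma C2_deriv_at_0:
  assumes "C2 f d1 d2"
  shows "((\<lambda>s. f (w + s *\<^sub>R v)) has_real_derivative d1 w v) (at 0)"
    and "((\<lambda>s. d1 (w + s *\<^sub>R u) v) has_real_derivative d2 w v u) (at 0)"
  using C2D(1)[OF assms, where s=0] C2D(2)[OF assms, where s=0] by simp_all

lemma C2_compose:
  assumes h: "C2 h d1 d2" and q: "\<And>u. (q has_real_derivative q' u) (at u)" "\<And>u. (q' has_real_derivative q'' u) (at u)"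
    "continuous_on UNIV q''"
  shows "C2 (\<lambda>w. q (h w)) (\<lambda>w v. q' (h w) * d1 w v)
    (\<lambda>w v u. q'' (h w) * d1 w u * d1 w v + q' (h w) * d2 w v u)"
proof -
  have cq: "continuous_on UNIV q" "continuous_on UNIV q'"
    using q(1,2) by (meson DERIV_continuous_on has_field_derivative_at_within)+
  note cc = continuous_on_compose2[OF _ C2D(3)[OF h]]
  have d: "((\<lambda>s. h (w + s *\<^sub>R v)) has_real_derivative d1 w v) (at 0)"
    "((\<lambda>s. d1 (w + s *\<^sub>R u) v) has_real_derivative d2 w v u) (at 0)" for w v u
    using C2_deriv_at_0[OF h] by simp_all
  have qh: "((\<lambda>s. q (h (w + s *\<^sub>R v))) has_real_derivative q' (h w) * d1 w v) (at 0)"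
    "((\<lambda>s. q' (h (w + s *\<^sub>R v))) has_real_derivative q'' (h w) * d1 w v) (at 0)" for w v
    using DERIV_chain2[OF _ d(1)[of w v], of q] DERIV_chain2[OF _ d(1)[of w v], of q'] q by simp_all
  show ?thesis
    unfolding C2_def
  proof (intro conjI allI)
    fix w v u
    show "((\<lambda>s. q (h (w + s *\<^sub>R v))) has_real_derivative q' (h w) * d1 w v) (at 0)" by (rule qh)
    show "((\<lambda>s. q' (h (w + s *\<^sub>R u)) * d1 (w + s *\<^sub>R u) v) has_real_derivative
        q'' (h w) * d1 w u * d1 w v + q' (h w) * d2 w v u) (at 0)"
      by (rule DERIV_cong[OF DERIV_mult[OF qh(2) d(2)]]) simp
    show "q'' (h w) * d1 w u * d1 w v + q' (h w) * d2 w v u = q'' (h w) * d1 w v * d1 w u + q' (h w) * d2 w u v"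
      by (simp add: C2D(9)[OF h, of w u v])
  next
    show "linear (\<lambda>v. q' (h w) * d1 w v)" for w
      using C2D(6)[OF h, of w] by (auto simp: linear_iff algebra_simps)
    show "linear (\<lambda>v. q'' (h w) * d1 w u * d1 w v + q' (h w) * d2 w v u)" for w u
      using C2D(6)[OF h, of w] C2D(7)[OF h, of w u] by (auto simp: linear_iff algebra_simps)
  qed (auto intro!: continuous_intros cc[OF cq(1)] cc[OF cq(2)] cc[OF q(3)] C2D(4,5)[OF h])
qed

lemma C2_mult:
  assumes h: "C2 h d1 d2" and k: "C2 k e1 e2"
  shows "C2 (\<lambda>w. h w * k w) (\<lambda>w v. d1 w v * k w + h w * e1 w v)
    (\<lambda>w v u. d2 w v u * k w + d1 w v * e1 w u + (d1 w u * e1 w v + h w * e2 w v u))"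
proof -
  have dh: "((\<lambda>s. h (w + s *\<^sub>R v)) has_real_derivative d1 w v) (at 0)"
    "((\<lambda>s. d1 (w + s *\<^sub>R u) v) has_real_derivative d2 w v u) (at 0)"
    "((\<lambda>s. k (w + s *\<^sub>R v)) has_real_derivative e1 w v) (at 0)"
    "((\<lambda>s. e1 (w + s *\<^sub>R u) v) has_real_derivative e2 w v u) (at 0)" for w v u
    using C2_deriv_at_0[OF h] C2_deriv_at_0[OF k] by simp_all
  show ?thesis
    unfolding C2_def
  proof (intro conjI allI)
    fix w v u
    show "((\<lambda>s. h (w + s *\<^sub>R v) * k (w + s *\<^sub>R v)) has_real_derivative d1 w v * k w + h w * e1 w v) (at 0)"
      by (rule DERIV_cong[OF DERIV_mult[OF dh(1,3)]]) simp
    show "((\<lambda>s. d1 (w + s *\<^sub>R u) v * k (w + s *\<^sub>R u) + h (w + s *\<^sub>R u) * e1 (w + s *\<^sub>R u) v) has_real_derivative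
        d2 w v u * k w + d1 w v * e1 w u + (d1 w u * e1 w v + h w * e2 w v u)) (at 0)"
      by (rule DERIV_cong[OF DERIV_add[OF DERIV_mult[OF dh(2,3)] DERIV_mult[OF dh(1,4)]]]) simp
    show "d2 w v u * k w + d1 w v * e1 w u + (d1 w u * e1 w v + h w * e2 w v u) =
       d2 w u v * k w + d1 w u * e1 w v + (d1 w v * e1 w u + h w * e2 w u v)"
      by (simp add: C2D(9)[OF h, of w u v] C2D(9)[OF k, of w u v])
  next
    show "linear (\<lambda>v. d1 w v * k w + h w * e1 w v)" for w
      using C2D(6)[OF h, of w] C2D(6)[OF k, of w] by (auto simp: linear_iff algebra_simps)
    show "linear (\<lambda>v. d2 w v u * k w + d1 w v * e1 w u + (d1 w u * e1 w v + h w * e2 w v u))" for w u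
      using C2D(6)[OF h, of w] C2D(7)[OF h, of w u] C2D(6)[OF k, of w] C2D(7)[OF k, of w u]
      by (auto simp: linear_iff algebra_simps)
  qed (auto intro!: continuous_intros C2D(3-5)[OF h] C2D(3-5)[OF k])
qed

lemma C2_quadratic:
  fixes L :: "'a::euclidean_space \<Rightarrow> 'b::euclidean_space"
  assumes L: "bounded_linear L"
  shows "C2 (\<lambda>w. c - (norm (L w))\<^sup>2) (\<lambda>w v. - 2 * (L w \<bullet> L v)) (\<lambda>w v u. - 2 * (L u \<bullet> L v))"
proof -
  note lin = bounded_linear.linear[OF L]
  note simps = linear_add[OF lin] linear_scale[OF lin] power2_norm_eq_inner
  note [continuous_intros] = bounded_linear.continuous_on[OF L]
  have Lc: "continuous_on UNIV L" by (rule linear_continuous_on[OF L])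
  show ?thesis unfolding C2_def
  proof (intro conjI allI)
    fix w v u
    show "((\<lambda>s. c - (norm (L (w + s *\<^sub>R v)))\<^sup>2) has_real_derivative - 2 * (L w \<bullet> L v)) (at 0)"
      unfolding simps inner_add_left inner_add_right inner_scaleR_left inner_scaleR_right
      by (rule derivative_eq_intros refl | simp add: inner_commute)+
    show "((\<lambda>s. - 2 * (L (w + s *\<^sub>R u) \<bullet> L v)) has_real_derivative - 2 * (L u \<bullet> L v)) (at 0)"
      unfolding simps inner_add_left inner_add_right inner_scaleR_left inner_scaleR_right
      by (rule derivative_eq_intros refl | simp)+
  next
    show "linear (\<lambda>v. - 2 * (L w \<bullet> L v))" for w
      by (auto simp: linear_iff simps inner_add_right algebra_simps)
    show "linear (\<lambda>v. - 2 * (L u \<bullet> L v))" for u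
      by (auto simp: linear_iff simps inner_add_right algebra_simps)
  qed (auto intro!: continuous_intros Lc simp: inner_commute)
qed

text \<open>Directional derivatives keep the support in the same ball. Applied twice, this makes
  both derivatives of a kernel compactly supported and so bounded.\<close>

lemma deriv_zero_outside_cball:
  fixes k :: "'a::real_normed_vector \<Rightarrow> real"
  assumes "\<And>w. norm w > r \<Longrightarrow> k w = 0" "((\<lambda>s. k (w + s *\<^sub>R v)) has_real_derivative D) (at 0)" "norm w > r"
  shows "D = 0"
proof -
  have "open {s. norm (w + s *\<^sub>R v) > r}" by (intro open_Collect_less continuous_intros)
  then have "((\<lambda>s. k (w + s *\<^sub>R v)) has_real_derivative 0) (at 0)"
    by (rule has_field_derivative_transform_within_open[OF DERIV_const[of 0]]) (use assms in auto)
  then show ?thesis using assms(2) DERIV_unique by blast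
qed

lemma continuous_compact_support_bounded:
  fixes k :: "'a::euclidean_space \<Rightarrow> real"
  assumes "continuous_on UNIV k" "\<And>w. norm w > r \<Longrightarrow> k w = 0"
  obtains C where "\<And>w. \<bar>k w\<bar> \<le> C"
proof -
  obtain C where C: "C \<ge> 0" "\<And>x. x \<in> cball 0 r \<Longrightarrow> \<bar>k x\<bar> \<le> C"
    using compact_abs_bound[OF compact_cball[of "0::'a" r] continuous_on_subset[OF assms(1)]] by auto
  have "\<bar>k w\<bar> \<le> C" for w using C assms(2)[of w] by (cases "norm w \<le> r") auto
  then show ?thesis using that by blast
qed

section \<open>Convolution of an integrable function with a compactly supported kernel\<close>

context
  fixes \<Psi> :: "'a::euclidean_space \<Rightarrow> real"
  assumes \<Psi>: "integrable lborel \<Psi>"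
begin

lemma convolution_integrable:
  assumes "continuous_on UNIV g" "\<And>w. \<bar>g w\<bar> \<le> C"
  shows "integrable lborel (\<lambda>z. \<Psi> z * g (w - z))"
proof (rule Bochner_Integration.integrable_bound)
  show "integrable lborel (\<lambda>z. C * \<bar>\<Psi> z\<bar>)" using \<Psi> by simp
  have "(\<lambda>z. g (w - z)) \<in> borel_measurable borel"
    by (intro borel_measurable_continuous_onI continuous_on_compose2[OF assms(1)] continuous_intros) auto
  then show "(\<lambda>z. \<Psi> z * g (w - z)) \<in> borel_measurable lborel"
    using borel_measurable_times[OF borel_measurable_integrable[OF \<Psi>]] by simp
  show "AE z in lborel. norm (\<Psi> z * g (w - z)) \<le> norm (C * \<bar>\<Psi> z\<bar>)"
  proof (rule AE_I2)
    fix z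
    have "\<bar>\<Psi> z\<bar> * \<bar>g (w - z)\<bar> \<le> \<bar>\<Psi> z\<bar> * \<bar>C\<bar>" using assms(2)[of "w - z"] by (intro mult_left_mono) auto
    then show "norm (\<Psi> z * g (w - z)) \<le> norm (C * \<bar>\<Psi> z\<bar>)" by (simp add: abs_mult mult_ac)
  qed
qed

lemma convolution_continuous:
  assumes g: "continuous_on UNIV g" "\<And>w. \<bar>g w\<bar> \<le> C"
  shows "continuous_on UNIV (\<lambda>w. \<integral>z. \<Psi> z * g (w - z) \<partial>lborel)"
  unfolding continuous_on_sequentially o_def
proof (intro allI ballI impI)
  fix X :: "nat \<Rightarrow> 'a" and w assume "w \<in> UNIV" and X: "(\<forall>n. X n \<in> UNIV) \<and> X \<longlonglongrightarrow> w"
  show "(\<lambda>n. \<integral>z. \<Psi> z * g (X n - z) \<partial>lborel) \<longlonglongrightarrow> (\<integral>z. \<Psi> z * g (w - z) \<partial>lborel)"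
  proof (rule integral_dominated_convergence[where w="\<lambda>z. C * \<bar>\<Psi> z\<bar>"])
    show "integrable lborel (\<lambda>z. C * \<bar>\<Psi> z\<bar>)" using \<Psi> by simp
    show "AE z in lborel. (\<lambda>n. \<Psi> z * g (X n - z)) \<longlonglongrightarrow> \<Psi> z * g (w - z)"
    proof (rule AE_I2, rule tendsto_mult_left)
      fix z
      have "isCont g (w - z)" using g(1) by (simp add: continuous_on_eq_continuous_at)
      then show "(\<lambda>n. g (X n - z)) \<longlonglongrightarrow> g (w - z)"
        by (rule isCont_tendsto_compose) (use X in \<open>auto intro!: tendsto_intros\<close>)
    qed
    show "AE z in lborel. norm (\<Psi> z * g (X n - z)) \<le> C * \<bar>\<Psi> z\<bar>" for n
    proof (rule AE_I2)
      fix z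
      have "\<bar>\<Psi> z\<bar> * \<bar>g (X n - z)\<bar> \<le> \<bar>\<Psi> z\<bar> * C" using g(2)[of "X n - z"] by (intro mult_left_mono) auto
      then show "norm (\<Psi> z * g (X n - z)) \<le> C * \<bar>\<Psi> z\<bar>" by (simp add: abs_mult mult_ac)
    qed
  qed (use convolution_integrable[OF g] in auto)
qed

lemma convolution_deriv:
  assumes g: "continuous_on UNIV g" "\<And>w. \<bar>g w\<bar> \<le> C" and g': "continuous_on UNIV g'" "\<And>w. \<bar>g' w\<bar> \<le> C'"
    and d: "\<And>w. ((\<lambda>s. g (w + s *\<^sub>R u)) has_real_derivative g' w) (at 0)"
  shows "((\<lambda>s. \<integral>z. \<Psi> z * g (w + s *\<^sub>R u - z) \<partial>lborel) has_real_derivative (\<integral>z. \<Psi> z * g' (w - z) \<partial>lborel)) (at 0)"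
proof (rule has_real_derivative_integral_dominated[where \<delta>=1 and w="\<lambda>z. \<bar>\<Psi> z\<bar> * C'"])
  have dl: "((\<lambda>s. g (w + s *\<^sub>R u - z)) has_real_derivative g' (w + s *\<^sub>R u - z)) (at s)" for s z
    using has_real_derivative_along_shift[OF d, of "w - z" s] by (simp add: algebra_simps)
  show "integrable lborel (\<lambda>z. \<Psi> z * g (w + s *\<^sub>R u - z))" for s by (rule convolution_integrable[OF g])
  show "(\<lambda>z. \<Psi> z * g' (w - z)) \<in> borel_measurable lborel" using convolution_integrable[OF g', of w] by auto
  show "AE z in lborel. ((\<lambda>s. \<Psi> z * g (w + s *\<^sub>R u - z)) has_real_derivative \<Psi> z * g' (w - z)) (at 0)"
    using DERIV_cmult[OF dl[of _ 0]] by simp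
  show "integrable lborel (\<lambda>z. \<bar>\<Psi> z\<bar> * C')" using \<Psi> by simp
  show "\<bar>\<Psi> z * g (w + s *\<^sub>R u - z) - \<Psi> z * g (w + 0 *\<^sub>R u - z)\<bar> \<le> \<bar>\<Psi> z\<bar> * C' * \<bar>s - 0\<bar>" for s z
  proof -
    have "\<bar>g (w + s *\<^sub>R u - z) - g (w + 0 *\<^sub>R u - z)\<bar> \<le> C' * \<bar>s - 0\<bar>"
      by (rule abs_diff_le_of_deriv_bound[OF dl g'(2)])
    from mult_left_mono[OF this abs_ge_zero[of "\<Psi> z"]] show ?thesis
      by (simp add: abs_mult right_diff_distrib[symmetric] mult.assoc)
  qed
qed auto

text \<open>All derivatives fall on the kernel, hence integrability of \<open>\<Psi>\<close> is
  enough. The derivatives of \<open>k\<close> vanish off the same ball and are continuous, so they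
  are bounded, and a multiple of the absolute value of \<open>\<Psi>\<close> dominates.\<close>

lemma C2_convolution:
  assumes k: "C2 k d1 d2" and supp: "\<And>w. norm w > r \<Longrightarrow> k w = 0"
  shows "C2 (\<lambda>w. \<integral>z. \<Psi> z * k (w - z) \<partial>lborel) (\<lambda>w v. \<integral>z. \<Psi> z * d1 (w - z) v \<partial>lborel)
    (\<lambda>w v u. \<integral>z. \<Psi> z * d2 (w - z) v u \<partial>lborel)"
proof -
  have d: "((\<lambda>s. k (w + s *\<^sub>R v)) has_real_derivative d1 w v) (at 0)"
    "((\<lambda>s. d1 (w + s *\<^sub>R u) v) has_real_derivative d2 w v u) (at 0)" for w v u
    using C2_deriv_at_0[OF k] by simp_all
  have s1: "d1 w v = 0" if "norm w > r" for w v using deriv_zero_outside_cball[OF supp d(1) that] .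
  have s2: "d2 w v u = 0" if "norm w > r" for w v u using deriv_zero_outside_cball[OF s1 d(2) that] .
  note c = C2D(3-5)[OF k]
  have b0: "\<exists>C. \<forall>w. \<bar>k w\<bar> \<le> C" using continuous_compact_support_bounded[OF c(1) supp] by blast
  have b1: "\<exists>C. \<forall>w. \<bar>d1 w v\<bar> \<le> C" for v
    using continuous_compact_support_bounded[of "\<lambda>w. d1 w v" r, OF c(2) s1] by blast
  have b2: "\<exists>C. \<forall>w. \<bar>d2 w v u\<bar> \<le> C" for v u
    using continuous_compact_support_bounded[of "\<lambda>w. d2 w v u" r, OF c(3) s2] by blast
  have i1: "integrable lborel (\<lambda>z. \<Psi> z * d1 (w - z) v)" for w v
    using b1[of v] convolution_integrable[of "\<lambda>w. d1 w v", OF c(2)] by blast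
  have i2: "integrable lborel (\<lambda>z. \<Psi> z * d2 (w - z) v u)" for w v u
    using b2[of v u] convolution_integrable[of "\<lambda>w. d2 w v u", OF c(3)] by blast
  show ?thesis
    unfolding C2_def
  proof (intro conjI allI)
    show "((\<lambda>s. \<integral>z. \<Psi> z * k (w + s *\<^sub>R v - z) \<partial>lborel) has_real_derivative (\<integral>z. \<Psi> z * d1 (w - z) v \<partial>lborel)) (at 0)" for w v
      using b0 b1[of v] convolution_deriv[of k _ "\<lambda>w. d1 w v", OF c(1) _ c(2) _ d(1)] by blast
    show "((\<lambda>s. \<integral>z. \<Psi> z * d1 (w + s *\<^sub>R u - z) v \<partial>lborel) has_real_derivative (\<integral>z. \<Psi> z * d2 (w - z) v u \<partial>lborel)) (at 0)" for w v u
      using b1[of v] b2[of v u] convolution_deriv[of "\<lambda>w. d1 w v" _ "\<lambda>w. d2 w v u", OF c(2) _ c(3) _ d(2)] by blast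
    show "continuous_on UNIV (\<lambda>w. \<integral>z. \<Psi> z * k (w - z) \<partial>lborel)"
      using b0 convolution_continuous[OF c(1)] by blast
    show "continuous_on UNIV (\<lambda>w. \<integral>z. \<Psi> z * d1 (w - z) v \<partial>lborel)" for v
      using b1[of v] convolution_continuous[of "\<lambda>w. d1 w v", OF c(2)] by blast
    show "continuous_on UNIV (\<lambda>w. \<integral>z. \<Psi> z * d2 (w - z) v u \<partial>lborel)" for v u
      using b2[of v u] convolution_continuous[of "\<lambda>w. d2 w v u", OF c(3)] by blast
    show "linear (\<lambda>v. \<integral>z. \<Psi> z * d1 (w - z) v \<partial>lborel)" for w
      by (rule linearI) (simp_all add: linear_add[OF C2D(6)[OF k]] linear_scale[OF C2D(6)[OF k]]
          distrib_left i1 mult.left_commute)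
    show "linear (\<lambda>v. \<integral>z. \<Psi> z * d2 (w - z) v u \<partial>lborel)" for w u
      by (rule linearI) (simp_all add: linear_add[OF C2D(7)[OF k]] linear_scale[OF C2D(7)[OF k]]
          distrib_left i2 mult.left_commute)
    show "(\<integral>z. \<Psi> z * d2 (w - z) v u \<partial>lborel) = (\<integral>z. \<Psi> z * d2 (w - z) u v \<partial>lborel)" for w v u
      by (simp add: C2D(9)[OF k, of _ v u])
  qed
qed

end

lemma C2_scale:
  assumes "C2 f d1 d2"
  shows "C2 (\<lambda>w. c * f w) (\<lambda>w v. c * d1 w v) (\<lambda>w v u. c * d2 w v u)"
  using C2_compose[OF assms, of "\<lambda>u. c * u" "\<lambda>_. c" "\<lambda>_. 0"]
  by (auto intro!: derivative_eq_intros)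

section \<open>Mollification\<close>

text \<open>The third power makes the profile twice continuously differentiable across the sphere of
  radius \<open>\<epsilon>\<close>, and a polynomial profile has an explicit decomposition into
  balls. The total mass is divided out only in \<open>mollified\<close>.\<close>

definition bump :: "real \<Rightarrow> 'a::euclidean_space \<Rightarrow> real"
  where "bump \<epsilon> x = max 0 (\<epsilon>\<^sup>2 - (norm x)\<^sup>2) ^ 3"

text \<open>A product rather than a radial kernel: averaging separates into one over the first
  component, where sub-mean values apply, and one over the second, where convexity applies.\<close>

definition product_bump :: "real \<Rightarrow> 'a::euclidean_space \<times> 'b::euclidean_space \<Rightarrow> real"
  where "product_bump \<epsilon> w = bump \<epsilon> (fst w) * bump \<epsilon> (snd w)"

definition bump_mass :: "real \<Rightarrow> 'a::euclidean_space itself \<Rightarrow> real"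
  where "bump_mass \<epsilon> _ = (\<integral>x. bump \<epsilon> (x::'a) \<partial>lborel)"

lemma bump_nonneg: "bump \<epsilon> x \<ge> 0"
  by (simp add: bump_def)

lemma bump_eq_0: "\<epsilon> > 0 \<Longrightarrow> norm x \<ge> \<epsilon> \<Longrightarrow> bump \<epsilon> x = 0"
  using power_mono[of \<epsilon> "norm x" 2] by (simp add: bump_def)

lemma bump_pos: "norm x < \<epsilon> \<Longrightarrow> bump \<epsilon> x > 0"
  using power_strict_mono[of "norm x" \<epsilon> 2] by (simp add: bump_def)

lemma bump_indicator: "\<epsilon> > 0 \<Longrightarrow> bump \<epsilon> x = indicator (cball 0 \<epsilon>) x * bump \<epsilon> x"
  using bump_eq_0[of \<epsilon> x] by (auto simp: indicator_def)

lemma bump_minus: "bump \<epsilon> (- x) = bump \<epsilon> x"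
  by (simp add: bump_def)

lemma continuous_on_bump: "continuous_on S (bump \<epsilon>)"
  unfolding bump_def by (intro continuous_intros)

lemma integrable_bump_times:
  fixes \<phi> :: "'a::euclidean_space \<Rightarrow> real"
  assumes "\<epsilon> > 0" "\<phi> \<in> borel_measurable borel" "\<And>x. \<bar>\<phi> x\<bar> \<le> C"
  shows "integrable lborel (\<lambda>x. bump \<epsilon> x * \<phi> x)"
  by (subst bump_indicator[OF assms(1)])
     (intro integrable_indicator_bounded[OF compact_cball continuous_on_bump assms(2,3)])

lemma integrable_bump:
  assumes "\<epsilon> > 0" shows "integrable lborel (bump \<epsilon> :: 'a::euclidean_space \<Rightarrow> real)"
  using integrable_bump_times[OF assms, of "\<lambda>_. 1" 1] by simp

lemma bump_mass_pos:
  assumes "\<epsilon> > 0" shows "bump_mass \<epsilon> TYPE('a::euclidean_space) > 0"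
proof (rule ccontr)
  assume "\<not> ?thesis"
  moreover have "bump_mass \<epsilon> TYPE('a) \<ge> 0"
    unfolding bump_mass_def by (intro Bochner_Integration.integral_nonneg bump_nonneg)
  ultimately have "AE x in lborel. bump \<epsilon> (x::'a) = 0"
    unfolding bump_mass_def using integral_nonneg_eq_0_iff_AE[OF integrable_bump[OF assms]] bump_nonneg by auto
  then have "AE x in lborel. x \<notin> ball (0::'a) \<epsilon>"
  proof eventually_elim
    case (elim x)
    then show ?case using bump_pos[of x \<epsilon>] by auto
  qed
  then have "emeasure lborel (ball (0::'a) \<epsilon>) = 0"
    by (subst (asm) AE_iff_measurable[where N="ball 0 \<epsilon>"]) auto
  then show False using content_ball_pos[of \<epsilon> "0::'a"] assms by (simp add: measure_def)
qed

text \<open>The bump is a mixture of indicator functions of balls, because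
  \<open>(\<epsilon>\<^sup>2 - r\<^sup>2)\<^sup>3\<close> is the integral of \<open>6 \<rho> (\<epsilon>\<^sup>2 - \<rho>\<^sup>2)\<^sup>2\<close> over \<open>r \<le> \<rho> \<le> \<epsilon>\<close>.\<close>

lemma bump_layers:
  assumes "\<epsilon> > 0"
  shows "bump \<epsilon> x = (\<integral>\<rho>. indicator {0..\<epsilon>} \<rho> * (6 * \<rho> * (\<epsilon>\<^sup>2 - \<rho>\<^sup>2)\<^sup>2) * indicator (cball 0 \<rho>) x \<partial>lborel)"
proof (cases "norm x \<le> \<epsilon>")
  case True
  have "(\<integral>\<rho>. (6 * \<rho> * (\<epsilon>\<^sup>2 - \<rho>\<^sup>2)\<^sup>2) * indicator {norm x..\<epsilon>} \<rho> \<partial>lborel)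
     = - ((\<epsilon>\<^sup>2 - \<epsilon>\<^sup>2) ^ 3) - - ((\<epsilon>\<^sup>2 - (norm x)\<^sup>2) ^ 3)"
  proof (rule integral_FTC_Icc_real[OF True])
    fix \<rho> :: real
    show "((\<lambda>\<rho>. - ((\<epsilon>\<^sup>2 - \<rho>\<^sup>2) ^ 3)) has_real_derivative 6 * \<rho> * (\<epsilon>\<^sup>2 - \<rho>\<^sup>2)\<^sup>2) (at \<rho>)"
      by (auto intro!: derivative_eq_intros simp: power2_eq_square)
  qed (auto intro!: continuous_intros)
  also have "\<dots> = bump \<epsilon> x" using True power_mono[of "norm x" \<epsilon> 2] by (simp add: bump_def)
  also have "(\<lambda>\<rho>. (6 * \<rho> * (\<epsilon>\<^sup>2 - \<rho>\<^sup>2)\<^sup>2) * indicator {norm x..\<epsilon>} \<rho>)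
    = (\<lambda>\<rho>. indicator {0..\<epsilon>} \<rho> * (6 * \<rho> * (\<epsilon>\<^sup>2 - \<rho>\<^sup>2)\<^sup>2) * indicator (cball 0 \<rho>) x)"
    using norm_ge_zero[of x] by (auto simp: fun_eq_iff indicator_def simp del: norm_ge_zero)
  finally show ?thesis ..
next
  case False
  then have "(\<lambda>\<rho>. indicator {0..\<epsilon>} \<rho> * (6 * \<rho> * (\<epsilon>\<^sup>2 - \<rho>\<^sup>2)\<^sup>2) * indicator (cball 0 \<rho>) x) = (\<lambda>_. 0 :: real)"
    by (auto simp: fun_eq_iff indicator_def)
  then show ?thesis using False bump_eq_0[OF assms, of x] by simp
qed

text \<open>By \<open>bump_layers\<close> the bump average is a mixture of ball integrals with
  nonnegative weights, so the inequality for balls is inherited. The mixture formula is used for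
  \<open>f\<close> and for the constant \<open>c\<close>.\<close>

lemma bump_submean:
  fixes f :: "'a::euclidean_space \<Rightarrow> real"
  assumes \<epsilon>: "\<epsilon> > 0" and f: "f \<in> borel_measurable borel" "\<And>x. \<bar>f x\<bar> \<le> C"
    and sm: "\<And>\<rho>. 0 < \<rho> \<Longrightarrow> \<rho> \<le> \<epsilon> \<Longrightarrow> measure lborel (cball (0::'a) \<rho>) * c \<le> (\<integral>x. indicator (cball 0 \<rho>) x * f x \<partial>lborel)"
  shows "bump_mass \<epsilon> TYPE('a) * c \<le> (\<integral>x. bump \<epsilon> x * f x \<partial>lborel)"
proof -
  define p where "p \<rho> = 6 * \<rho> * (\<epsilon>\<^sup>2 - \<rho>\<^sup>2)\<^sup>2" for \<rho> :: real
  have cp: "continuous_on {0..\<epsilon>} p" unfolding p_def by (intro continuous_intros)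
  have mix: "(\<integral>x. bump \<epsilon> x * g x \<partial>lborel)
     = (\<integral>\<rho>. indicator {0..\<epsilon>} \<rho> * p \<rho> * (\<integral>x. indicator (cball 0 \<rho>) x * g x \<partial>lborel) \<partial>lborel)"
    and mint: "integrable lborel (\<lambda>\<rho>. indicator {0..\<epsilon>} \<rho> * p \<rho> * (\<integral>x. indicator (cball 0 \<rho>) x * g x \<partial>lborel))"
    if g: "g \<in> borel_measurable borel" "\<And>x. \<bar>g x\<bar> \<le> C" for g :: "'a \<Rightarrow> real" and C
  proof -
    \<comment> \<open>The cutoff to the ball of variable radius \<open>\<rho>\<close> is the
      indicator of a closed cone in the pair of variables; this gives the joint measurability needed
      to exchange the integrals.\<close>
    define \<phi> where "\<phi> w = indicator {w. norm (snd w) \<le> fst w} w * g (snd w)" for w :: "real \<times> 'a"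
    have cl: "closed {w :: real \<times> 'a. norm (snd w) \<le> fst w}" by (intro closed_Collect_le continuous_intros)
    have [measurable]: "(\<lambda>w. g (snd w)) \<in> borel_measurable (borel :: (real \<times> 'a) measure)"
      using measurable_compose[OF _ g(1), of snd "borel :: (real \<times> 'a) measure"]
      by (simp add: borel_measurable_continuous_onI continuous_on_snd)
    have m: "\<phi> \<in> borel_measurable borel"
      unfolding \<phi>_def using cl by (intro borel_measurable_times borel_measurable_indicator borel_closed) auto
    have b: "\<bar>\<phi> w\<bar> \<le> max C 0" for w using g(2)[of "snd w"] by (auto simp: \<phi>_def indicator_def)
    have \<phi>: "\<phi> (\<rho>, x) = indicator (cball 0 \<rho>) x * g x" for \<rho> x by (auto simp: \<phi>_def indicator_def)
    have e: "(\<integral>x. indicator (cball 0 \<epsilon>) x * 1 * \<phi> (\<rho>, x) \<partial>lborel) = (\<integral>x. indicator (cball 0 \<rho>) x * g x \<partial>lborel)"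
      if "\<rho> \<in> {0..\<epsilon>}" for \<rho>
      using that by (intro Bochner_Integration.integral_cong) (auto simp: \<phi> indicator_def)
    have e': "indicator {0..\<epsilon>} \<rho> * p \<rho> * (\<integral>x. indicator (cball 0 \<epsilon>) x * 1 * \<phi> (\<rho>, x) \<partial>lborel)
      = indicator {0..\<epsilon>} \<rho> * p \<rho> * (\<integral>x. indicator (cball 0 \<rho>) x * g x \<partial>lborel)" for \<rho>
      using e[of \<rho>] by (cases "\<rho> \<in> {0..\<epsilon>}") auto
    have cont1: "continuous_on (cball 0 \<epsilon>) (\<lambda>_::'a. 1::real)" by (rule continuous_on_const)
    note sw = indicator_integral_swap[OF compact_Icc compact_cball cp cont1 m b]
    have "(\<integral>x. indicator (cball 0 \<epsilon>) x * 1 * (\<integral>\<rho>. indicator {0..\<epsilon>} \<rho> * p \<rho> * \<phi> (\<rho>, x) \<partial>lborel) \<partial>lborel)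
       = (\<integral>x. bump \<epsilon> x * g x \<partial>lborel)"
    proof (intro Bochner_Integration.integral_cong refl)
      fix x :: 'a
      have "(\<integral>\<rho>. indicator {0..\<epsilon>} \<rho> * p \<rho> * \<phi> (\<rho>, x) \<partial>lborel) = bump \<epsilon> x * g x"
        unfolding bump_layers[OF \<epsilon>] \<phi> p_def
        by (subst integral_mult_left_zero[symmetric]) (simp add: mult_ac)
      then show "indicator (cball 0 \<epsilon>) x * 1 * (\<integral>\<rho>. indicator {0..\<epsilon>} \<rho> * p \<rho> * \<phi> (\<rho>, x) \<partial>lborel) = bump \<epsilon> x * g x"
        using bump_indicator[OF \<epsilon>, of x] by (metis mult.assoc mult_1_right)
    qed
    then show "(\<integral>x. bump \<epsilon> x * g x \<partial>lborel)
     = (\<integral>\<rho>. indicator {0..\<epsilon>} \<rho> * p \<rho> * (\<integral>x. indicator (cball 0 \<rho>) x * g x \<partial>lborel) \<partial>lborel)"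
      using sw by (simp only: e')
    from lborel_pair.integrable_fst[OF integrable_indicator_product[OF compact_Icc compact_cball cp cont1 m b]]
    have "integrable lborel (\<lambda>\<rho>. \<integral>x. (indicator {0..\<epsilon>} \<rho> * p \<rho>) * (indicator (cball 0 \<epsilon>) x * 1) * \<phi> (\<rho>, x) \<partial>lborel)" .
    moreover have "(\<integral>x. (indicator {0..\<epsilon>} \<rho> * p \<rho>) * (indicator (cball 0 \<epsilon>) x * 1) * \<phi> (\<rho>, x) \<partial>lborel)
      = indicator {0..\<epsilon>} \<rho> * p \<rho> * (\<integral>x. indicator (cball 0 \<rho>) x * g x \<partial>lborel)" for \<rho>
      unfolding e'[symmetric] by (subst integral_mult_right_zero[symmetric]) (simp add: mult_ac)
    ultimately show "integrable lborel (\<lambda>\<rho>. indicator {0..\<epsilon>} \<rho> * p \<rho> * (\<integral>x. indicator (cball 0 \<rho>) x * g x \<partial>lborel))" by simp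
  qed
  have "bump_mass \<epsilon> TYPE('a) * c = (\<integral>x. bump \<epsilon> (x::'a) * c \<partial>lborel)" by (simp add: bump_mass_def)
  also have "\<dots> = (\<integral>\<rho>. indicator {0..\<epsilon>} \<rho> * p \<rho> * (\<integral>x. indicator (cball (0::'a) \<rho>) x * c \<partial>lborel) \<partial>lborel)"
    by (rule mix[of _ "\<bar>c\<bar>"]) auto
  also have "\<dots> \<le> (\<integral>\<rho>. indicator {0..\<epsilon>} \<rho> * p \<rho> * (\<integral>x. indicator (cball 0 \<rho>) x * f x \<partial>lborel) \<partial>lborel)"
  proof (rule Bochner_Integration.integral_mono)
    show "integrable lborel (\<lambda>\<rho>. indicator {0..\<epsilon>} \<rho> * p \<rho> * (\<integral>x. indicator (cball (0::'a) \<rho>) x * c \<partial>lborel))"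
      by (rule mint[of _ "\<bar>c\<bar>"]) auto
    show "integrable lborel (\<lambda>\<rho>. indicator {0..\<epsilon>} \<rho> * p \<rho> * (\<integral>x. indicator (cball 0 \<rho>) x * f x \<partial>lborel))"
      by (rule mint[OF f])
    fix \<rho> :: real
    show "indicator {0..\<epsilon>} \<rho> * p \<rho> * (\<integral>x. indicator (cball (0::'a) \<rho>) x * c \<partial>lborel)
      \<le> indicator {0..\<epsilon>} \<rho> * p \<rho> * (\<integral>x. indicator (cball 0 \<rho>) x * f x \<partial>lborel)"
    proof (cases "0 < \<rho> \<and> \<rho> \<le> \<epsilon>")
      case True
      then have "p \<rho> \<ge> 0" by (simp add: p_def)
      then show ?thesis using sm[of \<rho>] True by (intro mult_left_mono) auto
    next
      case False
      \<comment> \<open>The radius 0, which \<open>sm\<close> does not cover, is harmless because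
        \<open>p\<close> vanishes there.\<close>
      then have "indicator {0..\<epsilon>} \<rho> * p \<rho> = 0" by (auto simp: indicator_def p_def)
      then show ?thesis by (simp only: mult_zero_left order_refl)
    qed
  qed
  also have "\<dots> = (\<integral>x. bump \<epsilon> x * f x \<partial>lborel)" by (rule mix[OF f, symmetric])
  finally show ?thesis .
qed

lemma C2_product_bump:
  obtains d1 d2 where "C2 (product_bump \<epsilon> :: 'a::euclidean_space \<times> 'b::euclidean_space \<Rightarrow> real) d1 d2"
proof -
  have q: "((\<lambda>u. max 0 u ^ 3) has_real_derivative 3 * max 0 u ^ 2) (at u)"
    "((\<lambda>u. 3 * max 0 u ^ 2) has_real_derivative 6 * max 0 u) (at u)" for u :: real
    using DERIV_max0_power[of 1 u] DERIV_cmult[OF DERIV_max0_power[of 0 u], of 3] by (simp_all add: numeral_eq_Suc)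
  have c: "continuous_on UNIV (\<lambda>u::real. 6 * max 0 u)" by (intro continuous_intros)
  note comp = C2_compose[OF C2_quadratic q c]
  from C2_mult[OF comp[OF bounded_linear_fst] comp[OF bounded_linear_snd], of "\<epsilon>\<^sup>2" "\<epsilon>\<^sup>2"]
  show ?thesis using that unfolding product_bump_def[abs_def] bump_def by blast
qed

lemma product_bump_eq_0:
  assumes "\<epsilon> > 0" "norm w > 2 * \<epsilon>" shows "product_bump \<epsilon> w = 0"
proof -
  have "norm w \<le> norm (fst w) + norm (snd w)"
    using norm_Pair_le[of "fst w" "snd w"] by simp
  then have "norm (fst w) \<ge> \<epsilon> \<or> norm (snd w) \<ge> \<epsilon>" using assms by linarith
  then show ?thesis using assms by (auto simp: product_bump_def bump_eq_0)
qed

text \<open>\<open>submean\<close> and \<open>midconvex\<close> are the subharmonicity along affine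
  graphs and the convexity in \<open>y\<close>, for a function already truncated. They are local,
  over \<open>S\<close> and for second components of norm at most \<open>\<rho>\<close>; outside,
  \<open>\<Psi>\<close> may be cut off to zero, which is how it becomes integrable.\<close>

locale affine_submean =
  fixes \<Psi> :: "'a::euclidean_space \<times> 'b::euclidean_space \<Rightarrow> real" and S :: "'a set" and \<rho> C :: real
  assumes meas [measurable]: "\<Psi> \<in> borel_measurable borel"
    and bound: "\<And>w. \<bar>\<Psi> w\<bar> \<le> C"
    and int: "integrable lborel \<Psi>"
    and submean: "\<And>x r y A. r > 0 \<Longrightarrow> linear A \<Longrightarrow> cball x r \<subseteq> S \<Longrightarrow>
        (\<And>x'. x' \<in> cball x r \<Longrightarrow> norm (y + A (x' - x)) \<le> \<rho>) \<Longrightarrow>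
        measure lborel (cball x r) * \<Psi> (x, y) \<le> (\<integral>x'. indicator (cball x r) x' * \<Psi> (x', y + A (x' - x)) \<partial>lborel)"
    and midconvex: "\<And>x y t. x \<in> S \<Longrightarrow> norm y + norm t \<le> \<rho> \<Longrightarrow> 2 * \<Psi> (x, y) \<le> \<Psi> (x, y - t) + \<Psi> (x, y + t)"
begin

definition mollified :: "real \<Rightarrow> 'a \<times> 'b \<Rightarrow> real"
  where "mollified \<epsilon> w = 1 / (bump_mass \<epsilon> TYPE('a) * bump_mass \<epsilon> TYPE('b)) * (\<integral>z. \<Psi> z * product_bump \<epsilon> (w - z) \<partial>lborel)"

lemma meas_comp [measurable]:
  "f \<in> borel_measurable M \<Longrightarrow> g \<in> borel_measurable M \<Longrightarrow> (\<lambda>x. \<Psi> (f x, g x)) \<in> borel_measurable M"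
  using measurable_compose[OF _ meas, of "\<lambda>x. (f x, g x)" M] by (simp add: borel_measurable_Pair)

lemma product_bump_indicator:
  "\<epsilon> > 0 \<Longrightarrow> product_bump \<epsilon> (s, t) = (indicator (cball 0 \<epsilon>) s * bump \<epsilon> s) * (indicator (cball 0 \<epsilon>) t * bump \<epsilon> t)"
  by (metis product_bump_def bump_indicator fst_conv snd_conv)

lemma product_bump_integrable:
  assumes "\<epsilon> > 0" and \<phi>: "\<phi> \<in> borel_measurable borel" "\<And>w. \<bar>\<phi> w\<bar> \<le> C'"
  shows "integrable lborel (\<lambda>z :: 'a \<times> 'b. product_bump \<epsilon> z * \<phi> z)"
    and "(\<integral>z. product_bump \<epsilon> z * \<phi> z \<partial>lborel) = (\<integral>s. bump \<epsilon> s * (\<integral>t. bump \<epsilon> t * \<phi> (s, t) \<partial>lborel) \<partial>lborel)"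
    and "integrable lborel (\<lambda>s. bump \<epsilon> s * (\<integral>t. bump \<epsilon> t * \<phi> (s, t) \<partial>lborel))"
proof -
  have e: "(\<lambda>z. product_bump \<epsilon> z * \<phi> z) = (\<lambda>(s, t). (indicator (cball 0 \<epsilon>) s * bump \<epsilon> s) * (indicator (cball 0 \<epsilon>) t * bump \<epsilon> t) * \<phi> (s, t))"
    using product_bump_indicator[OF assms(1)] by (auto simp: fun_eq_iff)
  have i: "integrable (lborel \<Otimes>\<^sub>M lborel) (\<lambda>z. product_bump \<epsilon> z * \<phi> z)"
    unfolding e by (rule integrable_indicator_product[OF compact_cball compact_cball continuous_on_bump continuous_on_bump \<phi>])
  then show "integrable lborel (\<lambda>z. product_bump \<epsilon> z * \<phi> z)" by (simp add: lborel_prod)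
  have in': "(\<integral>t. product_bump \<epsilon> (s, t) * \<phi> (s, t) \<partial>lborel) = bump \<epsilon> s * (\<integral>t. bump \<epsilon> t * \<phi> (s, t) \<partial>lborel)" for s
    by (subst integral_mult_right_zero[symmetric]) (simp add: mult_ac product_bump_def)
  have "(\<integral>z. product_bump \<epsilon> z * \<phi> z \<partial>(lborel \<Otimes>\<^sub>M lborel)) = (\<integral>s. \<integral>t. product_bump \<epsilon> (s, t) * \<phi> (s, t) \<partial>lborel \<partial>lborel)"
    by (rule lborel_pair.integral_fst'[OF i, symmetric])
  then show "(\<integral>z. product_bump \<epsilon> z * \<phi> z \<partial>lborel) = (\<integral>s. bump \<epsilon> s * (\<integral>t. bump \<epsilon> t * \<phi> (s, t) \<partial>lborel) \<partial>lborel)"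
    by (simp add: lborel_prod in')
  show "integrable lborel (\<lambda>s. bump \<epsilon> s * (\<integral>t. bump \<epsilon> t * \<phi> (s, t) \<partial>lborel))"
    using lborel_pair.integrable_fst'[OF i] by (simp add: in')
qed

lemma product_bump_mass:
  assumes "\<epsilon> > 0"
  shows "(\<integral>z. product_bump \<epsilon> (z :: 'a \<times> 'b) \<partial>lborel) = bump_mass \<epsilon> TYPE('a) * bump_mass \<epsilon> TYPE('b)"
  using product_bump_integrable(2)[OF assms, of "\<lambda>_. 1" 1] by (simp add: bump_mass_def)

text \<open>Differentiation wants the variable \<open>w\<close> in the kernel, averaging wants it in
  \<open>\<Psi>\<close>; reflecting the integration variable passes from one form to the
  other.\<close>

lemma mollified_reflect:
  assumes "\<epsilon> > 0"
  shows "mollified \<epsilon> w = 1 / (bump_mass \<epsilon> TYPE('a) * bump_mass \<epsilon> TYPE('b)) * (\<integral>z. product_bump \<epsilon> z * \<Psi> (w - z) \<partial>lborel)"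
proof -
  obtain d1 d2 where c: "C2 (product_bump \<epsilon> :: 'a \<times> 'b \<Rightarrow> real) d1 d2" using C2_product_bump by blast
  have [measurable]: "product_bump \<epsilon> \<in> borel_measurable (borel :: ('a \<times> 'b) measure)"
    by (rule borel_measurable_continuous_onI[OF C2D(3)[OF c]])
  have "(\<integral>z. \<Psi> z * product_bump \<epsilon> (w - z) \<partial>lborel) = (\<integral>z. product_bump \<epsilon> z * \<Psi> (w - z) \<partial>lborel)"
    by (subst lborel_integral_reflect[where c=w, symmetric]) (auto simp: mult.commute)
  then show ?thesis by (simp add: mollified_def)
qed

lemma mollified_times_mass:
  assumes "\<epsilon> > 0"
  shows "bump_mass \<epsilon> TYPE('a) * bump_mass \<epsilon> TYPE('b) * mollified \<epsilon> w = (\<integral>z. product_bump \<epsilon> z * \<Psi> (w - z) \<partial>lborel)"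
  unfolding mollified_reflect[OF assms]
  using bump_mass_pos[OF assms, where 'a='a] bump_mass_pos[OF assms, where 'a='b] by simp

lemma mollified_le:
  assumes "\<epsilon> > 0" and le: "\<And>z. norm z \<le> 2 * \<epsilon> \<Longrightarrow> \<Psi> (w - z) \<le> c"
  shows "mollified \<epsilon> w \<le> c"
proof -
  let ?K = "bump_mass \<epsilon> TYPE('a) * bump_mass \<epsilon> TYPE('b)"
  have K: "?K > 0" by (intro mult_pos_pos bump_mass_pos assms(1))
  have "(\<integral>z. product_bump \<epsilon> z * \<Psi> (w - z) \<partial>lborel) \<le> (\<integral>z. product_bump \<epsilon> (z :: 'a \<times> 'b) * c \<partial>lborel)"
  proof (rule Bochner_Integration.integral_mono)
    show "integrable lborel (\<lambda>z. product_bump \<epsilon> z * \<Psi> (w - z))"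
      by (rule product_bump_integrable(1)[OF assms(1) _ bound]) measurable
    show "integrable lborel (\<lambda>z::'a \<times> 'b. product_bump \<epsilon> z * c)"
      by (rule product_bump_integrable(1)[OF assms(1)]) auto
    fix z :: "'a \<times> 'b"
    show "product_bump \<epsilon> z * \<Psi> (w - z) \<le> product_bump \<epsilon> z * c"
    proof (cases "norm z \<le> 2 * \<epsilon>")
      case True
      then show ?thesis using le[OF True] by (intro mult_left_mono) (auto simp: product_bump_def bump_nonneg)
    next
      case False
      then show ?thesis using product_bump_eq_0[OF assms(1), of z] by simp
    qed
  qed
  also have "\<dots> = ?K * c" by (simp add: product_bump_mass[OF assms(1)])
  finally show ?thesis unfolding mollified_reflect[OF assms(1)] using K by (simp add: field_simps)
qed

text \<open>Midpoint convexity bounds \<open>\<Psi>\<close> by its bump average in the second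
  variable, and \<open>bump_submean\<close> bounds it by its bump average in the first. For the
  product kernel the two averages compose to the mollification.\<close>

lemma mollified_ge:
  assumes \<epsilon>: "\<epsilon> > 0" and x: "cball x \<epsilon> \<subseteq> S" and y: "norm y + \<epsilon> \<le> \<rho>"
  shows "\<Psi> (x, y) \<le> mollified \<epsilon> (x, y)"
proof -
  let ?K = "bump_mass \<epsilon> TYPE('a) * bump_mass \<epsilon> TYPE('b)"
  have Kb: "bump_mass \<epsilon> TYPE('b) > 0" and K: "?K > 0" by (intro mult_pos_pos bump_mass_pos \<epsilon>)+
  have inner: "bump_mass \<epsilon> TYPE('b) * \<Psi> (x', y) \<le> (\<integral>t. bump \<epsilon> t * \<Psi> (x', y - t) \<partial>lborel)" if x': "x' \<in> S" for x'
  proof -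
    have i1: "integrable lborel (\<lambda>t. bump \<epsilon> t * \<Psi> (x', y - t))"
      by (rule integrable_bump_times[OF \<epsilon>]) (use bound in auto)
    have i2: "integrable lborel (\<lambda>t. bump \<epsilon> t * \<Psi> (x', y + t))"
      by (rule integrable_bump_times[OF \<epsilon>]) (use bound in auto)
    \<comment> \<open>The bump is even, so the averages of \<open>\<Psi>\<close> at
      \<open>y + t\<close> and at \<open>y - t\<close> coincide, and averaging the midpoint
      inequality gives twice the bound wanted.\<close>
    have "(\<integral>t. bump \<epsilon> t * \<Psi> (x', y + t) \<partial>lborel) = (\<integral>t. bump \<epsilon> t * \<Psi> (x', y - t) \<partial>lborel)"
      using lborel_integral_reflect[OF borel_measurable_integrable[OF i1, simplified], of 0]
      by (simp add: bump_minus)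
    moreover have "(\<integral>t. bump \<epsilon> (t::'b) * (2 * \<Psi> (x', y)) \<partial>lborel)
       \<le> (\<integral>t. bump \<epsilon> t * \<Psi> (x', y - t) + bump \<epsilon> t * \<Psi> (x', y + t) \<partial>lborel)"
    proof (rule Bochner_Integration.integral_mono)
      show "integrable lborel (\<lambda>t::'b. bump \<epsilon> t * (2 * \<Psi> (x', y)))"
        using integrable_bump[OF \<epsilon>] by (rule integrable_mult_left)
      show "integrable lborel (\<lambda>t. bump \<epsilon> t * \<Psi> (x', y - t) + bump \<epsilon> t * \<Psi> (x', y + t))"
        using i1 i2 by (rule Bochner_Integration.integrable_add)
      fix t :: 'b
      show "bump \<epsilon> t * (2 * \<Psi> (x', y)) \<le> bump \<epsilon> t * \<Psi> (x', y - t) + bump \<epsilon> t * \<Psi> (x', y + t)"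
      proof (cases "norm t < \<epsilon>")
        case True
        then have "2 * \<Psi> (x', y) \<le> \<Psi> (x', y - t) + \<Psi> (x', y + t)"
          using y by (intro midconvex[OF x']) auto
        from mult_left_mono[OF this bump_nonneg[of \<epsilon> t]] show ?thesis by (simp add: distrib_left)
      next
        case False
        then show ?thesis using bump_eq_0[OF \<epsilon>, of t] by simp
      qed
    qed
    moreover have "(\<integral>t. bump \<epsilon> t * \<Psi> (x', y - t) + bump \<epsilon> t * \<Psi> (x', y + t) \<partial>lborel)
       = (\<integral>t. bump \<epsilon> t * \<Psi> (x', y - t) \<partial>lborel) + (\<integral>t. bump \<epsilon> t * \<Psi> (x', y + t) \<partial>lborel)"
      by (rule Bochner_Integration.integral_add[OF i1 i2])
    ultimately show ?thesis by (simp add: bump_mass_def)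
  qed
  have m: "(\<lambda>z. \<Psi> ((x, y) - z)) \<in> borel_measurable borel" by measurable
  have "?K * \<Psi> (x, y) = bump_mass \<epsilon> TYPE('a) * (bump_mass \<epsilon> TYPE('b) * \<Psi> (x, y))" by simp
  also have "\<dots> \<le> (\<integral>s. bump \<epsilon> s * (bump_mass \<epsilon> TYPE('b) * \<Psi> (x - s, y)) \<partial>lborel)"
  proof (rule bump_submean[OF \<epsilon>])
    show "(\<lambda>s. bump_mass \<epsilon> TYPE('b) * \<Psi> (x - s, y)) \<in> borel_measurable borel" by measurable
    show "\<bar>bump_mass \<epsilon> TYPE('b) * \<Psi> (x - s, y)\<bar> \<le> bump_mass \<epsilon> TYPE('b) * C" for s
      using bound Kb by (simp add: abs_mult mult_left_mono)
    fix r assume r: "0 < r" "r \<le> \<epsilon>"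
    \<comment> \<open>The horizontal graph, \<open>A = 0\<close>, gives sub-mean values in the first
      variable with \<open>y\<close> fixed.\<close>
    have "measure lborel (cball x r) * \<Psi> (x, y) \<le> (\<integral>x'. indicator (cball x r) x' * \<Psi> (x', y + 0) \<partial>lborel)"
      using x r y \<epsilon> submean[of r "\<lambda>_. 0" x y] subset_cball[OF r(2), of x] by (auto simp: linear_iff subset_trans)
    also have "(\<integral>x'. indicator (cball x r) x' * \<Psi> (x', y + 0) \<partial>lborel)
       = (\<integral>s. indicator (cball x r) (x - s) * \<Psi> (x - s, y + 0) \<partial>lborel)"
      by (rule lborel_integral_reflect[symmetric]) (auto intro!: borel_measurable_times borel_measurable_indicator borel_closed)
    also have "(\<lambda>s. indicator (cball x r) (x - s) * \<Psi> (x - s, y + 0)) = (\<lambda>s. indicator (cball 0 r) s * \<Psi> (x - s, y))"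
      by (auto simp: indicator_def dist_norm)
    finally have "bump_mass \<epsilon> TYPE('b) * (measure lborel (cball (0::'a) r) * \<Psi> (x, y))
      \<le> bump_mass \<epsilon> TYPE('b) * (\<integral>s. indicator (cball 0 r) s * \<Psi> (x - s, y) \<partial>lborel)"
      using r Kb by (intro mult_left_mono) (auto simp: content_cball)
    then show "measure lborel (cball (0::'a) r) * (bump_mass \<epsilon> TYPE('b) * \<Psi> (x, y))
      \<le> (\<integral>s. indicator (cball 0 r) s * (bump_mass \<epsilon> TYPE('b) * \<Psi> (x - s, y)) \<partial>lborel)"
      by (subst (asm) integral_mult_right_zero[symmetric]) (simp add: mult_ac)
  qed
  also have "\<dots> \<le> (\<integral>s. bump \<epsilon> s * (\<integral>t. bump \<epsilon> t * \<Psi> ((x, y) - (s, t)) \<partial>lborel) \<partial>lborel)"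
  proof (rule Bochner_Integration.integral_mono)
    show "integrable lborel (\<lambda>s. bump \<epsilon> s * (bump_mass \<epsilon> TYPE('b) * \<Psi> (x - s, y)))"
      by (rule integrable_bump_times[OF \<epsilon>, of _ "bump_mass \<epsilon> TYPE('b) * C"])
         (use bound Kb in \<open>auto simp: abs_mult mult_left_mono\<close>)
    show "integrable lborel (\<lambda>s. bump \<epsilon> s * (\<integral>t. bump \<epsilon> t * \<Psi> ((x, y) - (s, t)) \<partial>lborel))"
      by (rule product_bump_integrable(3)[OF \<epsilon> m bound])
    fix s :: 'a
    show "bump \<epsilon> s * (bump_mass \<epsilon> TYPE('b) * \<Psi> (x - s, y))
      \<le> bump \<epsilon> s * (\<integral>t. bump \<epsilon> t * \<Psi> ((x, y) - (s, t)) \<partial>lborel)"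
    proof (cases "norm s < \<epsilon>")
      case True
      then have "x - s \<in> S" using x by (auto simp: dist_norm subset_iff)
      then show ?thesis using inner[of "x - s"] by (intro mult_left_mono bump_nonneg) auto
    next
      case False
      then show ?thesis using bump_eq_0[OF \<epsilon>, of s] by simp
    qed
  qed
  also have "\<dots> = (\<integral>z. product_bump \<epsilon> z * \<Psi> ((x, y) - z) \<partial>lborel)"
    by (rule product_bump_integrable(2)[OF \<epsilon> m bound, symmetric])
  finally show ?thesis unfolding mollified_reflect[OF \<epsilon>] using K by (simp add: field_simps)
qed

lemma mollified_abs_le:
  assumes \<epsilon>: "\<epsilon> > 0"
  shows "\<bar>mollified \<epsilon> w\<bar> \<le> C"
proof -
  let ?K = "bump_mass \<epsilon> TYPE('a) * bump_mass \<epsilon> TYPE('b)"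
  have K: "?K > 0" by (intro mult_pos_pos bump_mass_pos \<epsilon>)
  have m: "(\<lambda>z. \<Psi> (w - z)) \<in> borel_measurable borel" by measurable
  have "\<bar>\<integral>z. product_bump \<epsilon> z * \<Psi> (w - z) \<partial>lborel\<bar> \<le> (\<integral>z. \<bar>product_bump \<epsilon> z * \<Psi> (w - z)\<bar> \<partial>lborel)"
    by (rule integral_abs_bound)
  also have "\<dots> \<le> (\<integral>z. product_bump \<epsilon> (z :: 'a \<times> 'b) * C \<partial>lborel)"
  proof (rule Bochner_Integration.integral_mono)
    show "integrable lborel (\<lambda>z. \<bar>product_bump \<epsilon> z * \<Psi> (w - z)\<bar>)"
      by (intro integrable_abs product_bump_integrable(1)[OF \<epsilon> m bound])
    show "integrable lborel (\<lambda>z::'a \<times> 'b. product_bump \<epsilon> z * C)"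
      by (rule product_bump_integrable(1)[OF \<epsilon>]) auto
    show "\<bar>product_bump \<epsilon> z * \<Psi> (w - z)\<bar> \<le> product_bump \<epsilon> z * C" for z
      using bound[of "w - z"] by (auto simp: abs_mult product_bump_def bump_nonneg intro!: mult_left_mono)
  qed
  also have "\<dots> = ?K * C" by (simp add: product_bump_mass[OF \<epsilon>])
  finally have le: "\<bar>\<integral>z. product_bump \<epsilon> z * \<Psi> (w - z) \<partial>lborel\<bar> \<le> ?K * C" .
  have "\<bar>1 / k * X\<bar> \<le> C" if "k > 0" "\<bar>X\<bar> \<le> k * C" for k X :: real
    using that by (simp add: abs_mult field_simps)
  from this[OF K le] show ?thesis unfolding mollified_reflect[OF \<epsilon>] .
qed

text \<open>Squeezed between \<open>mollified_ge\<close> from below and upper semicontinuity from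
  above. The kernel lives on the ball of radius \<open>2 * \<epsilon>\<close>, hence the halved
  \<open>d2\<close>.\<close>

lemma mollified_tendsto:
  assumes w: "w = (x, y)" and x: "x \<in> interior S" and y: "norm y < \<rho>"
    and usc: "\<And>\<eta>. \<eta> > 0 \<Longrightarrow> eventually (\<lambda>w'. \<Psi> w' < \<Psi> w + \<eta>) (nhds w)"
    and e: "\<epsilon> \<longlonglongrightarrow> 0" "\<And>n::nat. \<epsilon> n > 0"
  shows "(\<lambda>n. mollified (\<epsilon> n) w) \<longlonglongrightarrow> \<Psi> w"
proof (rule tendstoI)
  fix \<eta> :: real assume \<eta>: "\<eta> > 0"
  obtain d1 where d1: "d1 > 0" "cball x d1 \<subseteq> S" using x mem_interior_cball by blast
  from usc[of "\<eta> / 2"] \<eta> obtain d2 where d2: "d2 > 0" "\<And>w'. dist w' w < d2 \<Longrightarrow> \<Psi> w' < \<Psi> w + \<eta> / 2"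
    by (auto simp: eventually_nhds_metric)
  have "eventually (\<lambda>n. \<epsilon> n < min (min d1 (d2 / 2)) (\<rho> - norm y)) sequentially"
    using d1 d2 y by (intro order_tendstoD(2)[OF e(1)]) auto
  then show "eventually (\<lambda>n. dist (mollified (\<epsilon> n) w) (\<Psi> w) < \<eta>) sequentially"
  proof eventually_elim
    case (elim n)
    have "\<Psi> w \<le> mollified (\<epsilon> n) w"
      unfolding w using elim d1(2) by (intro mollified_ge e(2)) auto
    moreover have "mollified (\<epsilon> n) w \<le> \<Psi> w + \<eta> / 2"
      using elim by (intro mollified_le e(2) less_imp_le d2(2)) (auto simp: dist_norm)
    ultimately show ?case using \<eta> by (auto simp: dist_real_def)
  qed
qed

text \<open>A mollification is an average of translates. Translation by \<open>z\<close> carries the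
  graph through \<open>(x, y)\<close> to one of the same slope \<open>A\<close> through
  \<open>(x, y) - z\<close>, where \<open>submean\<close> applies; \<open>sub\<close> and
  \<open>small\<close> leave room for all shifts in the support of the kernel. Exchanging the
  integrals finishes the argument.\<close>

lemma mollified_submean:
  assumes \<epsilon>: "\<epsilon> > 0" and A: "linear A" and r: "r > 0" and sub: "cball x (\<epsilon> + r) \<subseteq> S"
    and small: "\<And>v. norm v \<le> r \<Longrightarrow> norm y + \<epsilon> + norm (A v) \<le> \<rho>"
  shows "measure lborel (cball x r) * mollified \<epsilon> (x, y)
    \<le> (\<integral>x'. indicator (cball x r) x' * mollified \<epsilon> (x', y + A (x' - x)) \<partial>lborel)"
proof -
  let ?K = "bump_mass \<epsilon> TYPE('a) * bump_mass \<epsilon> TYPE('b)"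
  have K: "?K > 0" by (intro mult_pos_pos bump_mass_pos \<epsilon>)
  have m: "(\<lambda>z. \<Psi> ((x, y) - z)) \<in> borel_measurable borel" by measurable
  have cA: "continuous_on UNIV A" using A by (simp add: linear_continuous_on linear_conv_bounded_linear)
  define \<phi> where "\<phi> p = \<Psi> ((fst p, y + A (fst p - x)) - snd p)" for p :: "'a \<times> ('a \<times> 'b)"
  have "(\<lambda>p. (fst p, y + A (fst p - x)) - snd p) \<in> borel_measurable (borel :: ('a \<times> ('a \<times> 'b)) measure)"
    by (intro borel_measurable_continuous_onI continuous_intros continuous_on_compose2[OF cA]) auto
  then have m\<phi>: "\<phi> \<in> borel_measurable borel" unfolding \<phi>_def by measurable
  have b\<phi>: "\<bar>\<phi> p\<bar> \<le> C" for p unfolding \<phi>_def by (rule bound)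
  obtain e1 e2 where c: "C2 (product_bump \<epsilon> :: 'a \<times> 'b \<Rightarrow> real) e1 e2" using C2_product_bump by blast
  note cb = continuous_on_subset[OF C2D(3)[OF c] subset_UNIV]
  have pind: "product_bump \<epsilon> z = indicator (cball 0 (2 * \<epsilon>)) z * product_bump \<epsilon> z" for z :: "'a \<times> 'b"
    using product_bump_eq_0[OF \<epsilon>, of z] by (auto simp: indicator_def)
  have c1: "continuous_on (cball x r) (\<lambda>_. 1::real)" by (rule continuous_on_const)
  have meas_in: "(\<lambda>x'. \<Psi> (x' - fst z, y - snd z + A (x' - x))) \<in> borel_measurable borel" for z
    by (intro meas_comp borel_measurable_continuous_onI continuous_intros continuous_on_compose2[OF cA]) auto
  have "measure lborel (cball x r) * (\<integral>z. product_bump \<epsilon> z * \<Psi> ((x, y) - z) \<partial>lborel)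
    = (\<integral>z. product_bump \<epsilon> z * (measure lborel (cball x r) * \<Psi> ((x, y) - z)) \<partial>lborel)"
    by (subst integral_mult_right_zero[symmetric]) (simp add: mult_ac)
  also have "\<dots> \<le> (\<integral>z. product_bump \<epsilon> z * (\<integral>x'. indicator (cball x r) x' * 1 * \<phi> (x', z) \<partial>lborel) \<partial>lborel)"
  proof (rule Bochner_Integration.integral_mono)
    show "integrable lborel (\<lambda>z. product_bump \<epsilon> z * (measure lborel (cball x r) * \<Psi> ((x, y) - z)))"
      using integrable_mult_right[OF product_bump_integrable(1)[OF \<epsilon> m bound], of "measure lborel (cball x r)"]
      by (simp add: mult_ac)
    have "integrable lborel (\<lambda>z. \<integral>x'. (indicator (cball x r) x' * 1) * (indicator (cball 0 (2 * \<epsilon>)) z * product_bump \<epsilon> z) * \<phi> (x', z) \<partial>lborel)"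
      by (rule lborel_pair.integrable_snd)
         (rule integrable_indicator_product[OF compact_cball compact_cball c1 cb m\<phi> b\<phi>])
    moreover have "(\<integral>x'. (indicator (cball x r) x' * 1) * (indicator (cball 0 (2 * \<epsilon>)) z * product_bump \<epsilon> z) * \<phi> (x', z) \<partial>lborel)
      = product_bump \<epsilon> z * (\<integral>x'. indicator (cball x r) x' * 1 * \<phi> (x', z) \<partial>lborel)" for z
      unfolding pind[symmetric] by (subst integral_mult_right_zero[symmetric]) (simp add: mult_ac)
    ultimately show "integrable lborel (\<lambda>z. product_bump \<epsilon> z * (\<integral>x'. indicator (cball x r) x' * 1 * \<phi> (x', z) \<partial>lborel))"
      by simp
    fix z :: "'a \<times> 'b"
    show "product_bump \<epsilon> z * (measure lborel (cball x r) * \<Psi> ((x, y) - z))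
       \<le> product_bump \<epsilon> z * (\<integral>x'. indicator (cball x r) x' * 1 * \<phi> (x', z) \<partial>lborel)"
    proof (cases "norm (fst z) \<le> \<epsilon> \<and> norm (snd z) \<le> \<epsilon>")
      case True
      have in_ball: "x' + fst z \<in> cball x r" if "x' \<in> cball (x - fst z) r" for x'
        using that by (simp add: dist_norm algebra_simps)
      have "measure lborel (cball (x - fst z) r) * \<Psi> (x - fst z, y - snd z)
        \<le> (\<integral>x'. indicator (cball (x - fst z) r) x' * \<Psi> (x', y - snd z + A (x' - (x - fst z))) \<partial>lborel)"
      proof (rule submean[OF r A])
        show "cball (x - fst z) r \<subseteq> S"
        proof
          fix x' assume "x' \<in> cball (x - fst z) r"
          then have "norm (x - (x' + fst z)) \<le> r" using in_ball[of x'] by (simp add: dist_norm)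
          then have "norm (x - x') \<le> \<epsilon> + r"
            using True norm_triangle_ineq[of "x - (x' + fst z)" "fst z"] by (simp add: algebra_simps)
          then show "x' \<in> S" using sub by (auto simp: dist_norm)
        qed
      next
        fix x' assume "x' \<in> cball (x - fst z) r"
        then have "norm (x' - (x - fst z)) \<le> r" by (simp add: dist_norm norm_minus_commute)
        then have "norm y + \<epsilon> + norm (A (x' - (x - fst z))) \<le> \<rho>" by (rule small)
        then show "norm (y - snd z + A (x' - (x - fst z))) \<le> \<rho>"
          using True norm_triangle_ineq[of "y - snd z" "A (x' - (x - fst z))"] norm_triangle_ineq4[of y "snd z"] by linarith
      qed
      \<comment> \<open>The ball around \<open>x - fst z\<close> is moved back to the fixed ball
        around \<open>x\<close>, so that the domain no longer depends on \<open>z\<close> when the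
        integrals are exchanged.\<close>
      also have "\<dots> = (\<integral>x'. indicator (cball (x - fst z) r) (x' + - fst z) *
            \<Psi> (x' + - fst z, y - snd z + A (x' + - fst z - (x - fst z))) \<partial>lborel)"
      proof (rule lborel_integral_translation[symmetric])
        have "(\<lambda>x'. \<Psi> (x', y - snd z + A (x' - (x - fst z)))) \<in> borel_measurable borel"
          by (intro meas_comp borel_measurable_continuous_onI continuous_intros continuous_on_compose2[OF cA]) auto
        then show "(\<lambda>x'. indicator (cball (x - fst z) r) x' * \<Psi> (x', y - snd z + A (x' - (x - fst z)))) \<in> borel_measurable borel"
          by (intro borel_measurable_times borel_measurable_indicator borel_closed) auto
      qed
      also have "\<dots> = (\<integral>x'. indicator (cball x r) x' * 1 * \<phi> (x', z) \<partial>lborel)"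
        by (intro Bochner_Integration.integral_cong refl arg_cong2[where f="(*)"])
           (auto simp: \<phi>_def indicator_def dist_norm algebra_simps minus_prod_def)
      finally have "measure lborel (cball x r) * \<Psi> ((x, y) - z) \<le> (\<integral>x'. indicator (cball x r) x' * 1 * \<phi> (x', z) \<partial>lborel)"
        using r by (simp add: content_cball minus_prod_def)
      then show ?thesis by (intro mult_left_mono) (auto simp: product_bump_def bump_nonneg)
    next
      case False
      then have "product_bump \<epsilon> z = 0" using \<epsilon> by (auto simp: product_bump_def bump_eq_0)
      then show ?thesis by simp
    qed
  qed
  also have "\<dots> = (\<integral>z. indicator (cball 0 (2 * \<epsilon>)) z * product_bump \<epsilon> z * (\<integral>x'. indicator (cball x r) x' * 1 * \<phi> (x', z) \<partial>lborel) \<partial>lborel)"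
    by (simp only: pind[symmetric])
  also have "\<dots> = (\<integral>x'. indicator (cball x r) x' * 1 * (\<integral>z. indicator (cball 0 (2 * \<epsilon>)) z * product_bump \<epsilon> z * \<phi> (x', z) \<partial>lborel) \<partial>lborel)"
    by (rule indicator_integral_swap[OF compact_cball compact_cball c1 cb m\<phi> b\<phi>, symmetric])
  also have "\<dots> = (\<integral>x'. indicator (cball x r) x' * (?K * mollified \<epsilon> (x', y + A (x' - x))) \<partial>lborel)"
    unfolding pind[symmetric] mollified_times_mass[OF \<epsilon>] by (simp add: \<phi>_def)
  also have "\<dots> = ?K * (\<integral>x'. indicator (cball x r) x' * mollified \<epsilon> (x', y + A (x' - x)) \<partial>lborel)"
    by (subst integral_mult_right_zero[symmetric]) (simp add: mult_ac)
  finally show ?thesis unfolding mollified_reflect[OF \<epsilon>, of "(x, y)"] using K by (simp add: field_simps)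
qed

text \<open>Smoothness comes from the kernel, positivity from \<open>mollified_submean\<close> on
  small balls: \<open>laplacian_nonneg_of_submean\<close> turns sub-mean values on a graph into a
  nonnegative sum of second derivatives along it.\<close>

lemma mollified_C2:
  assumes \<epsilon>: "\<epsilon> > 0"
  obtains d1 d2 where "C2 (mollified \<epsilon>) d1 d2"
    "\<And>x y r. r > 0 \<Longrightarrow> cball x (\<epsilon> + r) \<subseteq> S \<Longrightarrow> norm y + \<epsilon> < \<rho> \<Longrightarrow> affine_subharmonic_at d2 x y"
proof -
  obtain e1 e2 where c: "C2 (product_bump \<epsilon> :: 'a \<times> 'b \<Rightarrow> real) e1 e2" using C2_product_bump by blast
  define d1 d2 where "d1 = (\<lambda>w v. 1 / (bump_mass \<epsilon> TYPE('a) * bump_mass \<epsilon> TYPE('b)) * (\<integral>z. \<Psi> z * e1 (w - z) v \<partial>lborel))"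
    and "d2 = (\<lambda>w v u. 1 / (bump_mass \<epsilon> TYPE('a) * bump_mass \<epsilon> TYPE('b)) * (\<integral>z. \<Psi> z * e2 (w - z) v u \<partial>lborel))"
  have C2: "C2 (mollified \<epsilon>) d1 d2"
    unfolding mollified_def[abs_def] d1_def d2_def
    by (rule C2_scale[OF C2_convolution[OF int c product_bump_eq_0[OF \<epsilon>]]])
  have "affine_subharmonic_at d2 x y" if r: "r > 0" "cball x (\<epsilon> + r) \<subseteq> S" and y: "norm y + \<epsilon> < \<rho>" for x y r
    unfolding affine_subharmonic_at_def
  proof (intro allI impI)
    fix A :: "'a \<Rightarrow> 'b" assume A: "linear A"
    have cA: "continuous_on UNIV A" using A by (simp add: linear_continuous_on linear_conv_bounded_linear)
    define \<Gamma> where "\<Gamma> x' = (x', y + A (x' - x))" for x'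
    have \<Gamma>: "\<Gamma> (x' + s *\<^sub>R v) = \<Gamma> x' + s *\<^sub>R (v, A v)" for x' s v
      by (simp add: \<Gamma>_def linear_add[OF A] linear_scale[OF A] linear_diff[OF A] algebra_simps)
    have c\<Gamma>: "continuous_on UNIV \<Gamma>" unfolding \<Gamma>_def
      by (intro continuous_intros continuous_on_compose2[OF cA]) auto
    have basis: "(v, A v) = (\<Sum>b\<in>Basis. (v \<bullet> b) *\<^sub>R (b, A b))" for v
    proof -
      have "A v = A (\<Sum>b\<in>Basis. (v \<bullet> b) *\<^sub>R b)" by (simp add: euclidean_representation)
      then have "A v = (\<Sum>b\<in>Basis. (v \<bullet> b) *\<^sub>R A b)" by (simp add: linear_sum[OF A] linear_scale[OF A])
      then show ?thesis by (simp add: prod_eq_iff fst_sum snd_sum euclidean_representation)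
    qed
    \<comment> \<open>The mollification restricted to the graph of slope \<open>A\<close> through
      \<open>(x, y)\<close>. Its pure second partials are the values of \<open>d2\<close> in the
      directions \<open>(b, A b)\<close>.\<close>
    interpret P: pure_second_partials UNIV "\<lambda>x'. mollified \<epsilon> (\<Gamma> x')" "\<lambda>b x'. d1 (\<Gamma> x') (b, A b)" "\<lambda>b x'. d2 (\<Gamma> x') (b, A b) (b, A b)"
    proof
      fix x' v :: 'a
      have "d1 w (v, A v) = (\<Sum>b\<in>Basis. (v \<bullet> b) * d1 w (b, A b))" for w
        by (subst basis) (simp add: linear_sum[OF C2D(6)[OF C2]] linear_scale[OF C2D(6)[OF C2]] del: scaleR_Pair)
      then show "((\<lambda>s. mollified \<epsilon> (\<Gamma> (x' + s *\<^sub>R v))) has_real_derivative (\<Sum>b\<in>Basis. (v \<bullet> b) * d1 (\<Gamma> x') (b, A b))) (at 0)"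
        using C2_deriv_at_0(1)[OF C2, of "\<Gamma> x'" "(v, A v)"] by (simp add: \<Gamma>)
    next
      fix x' b :: 'a
      show "((\<lambda>s. d1 (\<Gamma> (x' + s *\<^sub>R b)) (b, A b)) has_real_derivative d2 (\<Gamma> x') (b, A b) (b, A b)) (at 0)"
        using C2_deriv_at_0(2)[OF C2, of "\<Gamma> x'" "(b, A b)" "(b, A b)"] by (simp add: \<Gamma>)
    qed (auto intro!: continuous_on_compose2[OF _ c\<Gamma>] C2D(3-5)[OF C2] intro: continuous_on_compose2[OF _ c\<Gamma>])
    obtain B where B: "B > 0" "\<And>v. norm (A v) \<le> B * norm v" using linear_bounded_pos[OF A] by blast
    \<comment> \<open>Over a ball of radius \<open>R0\<close> the slope \<open>A\<close> displaces
      the graph by at most \<open>\<rho> - \<epsilon> - norm y\<close>, so it stays where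
      \<open>\<Psi>\<close> is under control.\<close>
    define R0 where "R0 = min r ((\<rho> - \<epsilon> - norm y) / B)"
    have R0: "R0 > 0" "R0 \<le> r" "B * R0 \<le> \<rho> - \<epsilon> - norm y"
      using r y B(1) by (auto simp: R0_def min_def field_simps)
    have "(\<Sum>b\<in>Basis. d2 (\<Gamma> x) (b, A b) (b, A b)) \<ge> 0"
    proof (rule P.laplacian_nonneg_of_submean[of _ R0])
      fix s assume s: "0 < s" "s \<le> R0"
      show "measure lborel (cball x s) * mollified \<epsilon> (\<Gamma> x) \<le> (\<integral>x'. indicator (cball x s) x' * mollified \<epsilon> (\<Gamma> x') \<partial>lborel)"
        unfolding \<Gamma>_def using linear_0[OF A]
      proof (simp, intro mollified_submean[OF \<epsilon> A s(1)])
        show "cball x (\<epsilon> + s) \<subseteq> S" using r(2) s R0 by auto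
        fix v :: 'a assume "norm v \<le> s"
        then have "B * norm v \<le> B * R0" using s B(1) by (intro mult_left_mono) auto
        then show "norm y + \<epsilon> + norm (A v) \<le> \<rho>" using B(2)[of v] R0(3) by linarith
      qed
    qed (use R0 in auto)
    then show "(\<Sum>e\<in>Basis. d2 (x, y) (e, A e) (e, A e)) \<ge> 0" by (simp add: \<Gamma>_def linear_0[OF A])
  qed
  with C2 show ?thesis using that by blast
qed

end

section \<open>Sub-mean value property of box integrals\<close>

lemma compact_cube: "compact (cube R)"
  by (simp add: cube_eq_cbox compact_cbox)

lemma norm_cube_le:
  assumes "(y::'a::euclidean_space) \<in> cube R" shows "norm y \<le> R * DIM('a)"
proof -
  have "norm y \<le> (\<Sum>b\<in>Basis. \<bar>y \<bullet> b\<bar>)" by (rule norm_le_l1)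
  also have "\<dots> \<le> (\<Sum>b\<in>(Basis :: 'a set). R)" using assms by (intro sum_mono) (auto simp: cube_def)
  finally show ?thesis by (simp add: mult.commute)
qed

lemma measure_cube_pos:
  assumes "R > 0" shows "measure lborel (cube R :: 'a::euclidean_space set) > 0"
  unfolding cube_eq_cbox using assms by (intro content_pos_lt) (simp add: inner_sum_left_Basis)

context affine_submean
begin

definition neg_log_cube :: "real \<Rightarrow> 'a \<Rightarrow> real"
  where "neg_log_cube R x = - ln (\<integral>y. indicator (cube R) y * exp (- \<Psi> (x, y)) \<partial>lborel)"

lemma exp_cube_integral_bounds:
  fixes f :: "'b \<Rightarrow> real"
  assumes "R > 0" "f \<in> borel_measurable borel" "\<And>y. \<bar>f y\<bar> \<le> C"
  shows "integrable lborel (\<lambda>y. indicator (cube R) y * exp (- f y))"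
    and "measure lborel (cube R :: 'b set) * exp (- C) \<le> (\<integral>y. indicator (cube R) y * exp (- f y) \<partial>lborel)"
    and "(\<integral>y. indicator (cube R) y * exp (- f y) \<partial>lborel) \<le> measure lborel (cube R :: 'b set) * exp C"
proof -
  have b: "\<bar>exp (- f y)\<bar> \<le> exp C" "exp (- C) \<le> exp (- f y)" for y using assms(3)[of y] by auto
  have ec: "integrable lborel (\<lambda>y::'b. indicator (cube R) y * c)" for c :: real
    by (rule integrable_indicator_compact[OF compact_cube continuous_on_const])
  have eq: "(\<integral>y. indicator (cube R) (y::'b) * c \<partial>lborel) = measure lborel (cube R :: 'b set) * c" for c :: real
    by simp
  have "(\<lambda>y. exp (- f y)) \<in> borel_measurable borel" using assms(2) by measurable
  from integrable_indicator_bounded[OF compact_cube continuous_on_const[of _ 1] this b(1)]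
  show i: "integrable lborel (\<lambda>y. indicator (cube R) y * exp (- f y))" by simp
  show "measure lborel (cube R :: 'b set) * exp (- C) \<le> (\<integral>y. indicator (cube R) y * exp (- f y) \<partial>lborel)"
    unfolding eq[symmetric] by (rule Bochner_Integration.integral_mono[OF ec i]) (use b in \<open>auto intro!: mult_left_mono\<close>)
  show "(\<integral>y. indicator (cube R) y * exp (- f y) \<partial>lborel) \<le> measure lborel (cube R :: 'b set) * exp C"
    unfolding eq[symmetric] by (rule Bochner_Integration.integral_mono[OF i ec]) (use b in \<open>auto intro!: mult_left_mono\<close>)
qed

text \<open>The bound depends on \<open>f\<close> through \<open>C\<close> only. It is therefore
  common to all mollifications and serves as a dominating constant.\<close>

lemma abs_neg_log_cube_le:
  fixes f :: "'b \<Rightarrow> real"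
  assumes "R > 0" "f \<in> borel_measurable borel" "\<And>y. \<bar>f y\<bar> \<le> C"
  shows "\<bar>- ln (\<integral>y. indicator (cube R) y * exp (- f y) \<partial>lborel)\<bar> \<le> C + \<bar>ln (measure lborel (cube R :: 'b set))\<bar>"
    and "(\<integral>y. indicator (cube R) y * exp (- f y) \<partial>lborel) > 0"
proof -
  note b = exp_cube_integral_bounds[OF assms]
  let ?V = "measure lborel (cube R :: 'b set)" and ?I = "\<integral>y. indicator (cube R) y * exp (- f y) \<partial>lborel"
  have V: "?V > 0" by (rule measure_cube_pos[OF assms(1)])
  have "0 < ?V * exp (- C)" using V by simp
  with b(2) show I: "?I > 0" by linarith
  have "ln (?V * exp (- C)) \<le> ln ?I" using b(2) V I by (subst ln_le_cancel_iff) auto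
  moreover have "ln ?I \<le> ln (?V * exp C)" using b(3) V I by (subst ln_le_cancel_iff) auto
  moreover have "ln (?V * exp c) = ln ?V + c" for c using V by (simp add: ln_mult)
  ultimately show "\<bar>- ln ?I\<bar> \<le> C + \<bar>ln ?V\<bar>" by simp
qed

lemma continuous_on_mollified:
  assumes "\<epsilon> > 0" shows "continuous_on UNIV (mollified \<epsilon>)"
  by (rule mollified_C2[OF assms]) (rule C2D(3))

lemma mollified_log_box:
  fixes \<epsilon> R :: real
  assumes \<epsilon>: "\<epsilon> > 0" and R: "R > 0" and bs: "distinct bs" "set bs = (Basis :: 'b set)"
  shows "log_box_integral R (map (Pair 0) bs) (mollified \<epsilon>) (x, 0)
    = - ln (\<integral>y. indicator (cube R) y * exp (- mollified \<epsilon> (x, y)) \<partial>lborel)"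
    and "(\<lambda>y. mollified \<epsilon> (x, y)) \<in> borel_measurable borel"
proof -
  note c = continuous_on_mollified[OF \<epsilon>]
  show m: "(\<lambda>y. mollified \<epsilon> (x, y)) \<in> borel_measurable borel"
    by (rule borel_measurable_continuous_onI, rule continuous_on_compose2[OF c])
       (auto intro!: continuous_intros)
  note bnd = exp_cube_integral_bounds[OF R m mollified_abs_le[OF \<epsilon>]] and pos = abs_neg_log_cube_le(2)[OF R m mollified_abs_le[OF \<epsilon>]]
  have "ennreal (exp (- log_box_integral R (map (Pair 0) bs) (mollified \<epsilon>) (x, 0)))
    = (\<integral>\<^sup>+y. ennreal (indicator (cube R) y * exp (- mollified \<epsilon> (x, y))) \<partial>lborel)"
    unfolding exp_log_box_integral_eq_cube[OF c R bs]
    by (intro nn_integral_cong) (simp add: indicator_def)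
  also have "\<dots> = ennreal (\<integral>y. indicator (cube R) y * exp (- mollified \<epsilon> (x, y)) \<partial>lborel)"
    by (rule nn_integral_eq_integral[OF bnd(1)]) auto
  finally have "exp (- log_box_integral R (map (Pair 0) bs) (mollified \<epsilon>) (x, 0))
    = (\<integral>y. indicator (cube R) y * exp (- mollified \<epsilon> (x, y)) \<partial>lborel)"
    using pos by simp
  then show "log_box_integral R (map (Pair 0) bs) (mollified \<epsilon>) (x, 0)
    = - ln (\<integral>y. indicator (cube R) y * exp (- mollified \<epsilon> (x, y)) \<partial>lborel)"
    by (metis ln_exp minus_minus)
qed

text \<open>Starting from second component 0, the box integral sees \<open>y\<close> of norm at most
  \<open>R * DIM('b)\<close>, where the mollification is subharmonic along graphs by the choice of
  \<open>\<rho>\<close>. So the Laplacian of the box integral in the first variable is nonnegative,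
  and sub-mean values follow. The margin \<open>e\<close> leaves room for the balls used in
  \<open>mollified_C2\<close>.\<close>

lemma mollified_log_box_submean:
  fixes \<epsilon> R r e :: real
  assumes \<epsilon>: "\<epsilon> > 0" and R: "R > 0" and bs: "distinct bs" "set bs = (Basis :: 'b set)"
    and r: "r > 0" and e: "e > 0" "cball x (r + \<epsilon> + e) \<subseteq> S" and \<rho>: "R * DIM('b) + \<epsilon> < \<rho>"
  shows "measure lborel (cball x r) * log_box_integral R (map (Pair 0) bs) (mollified \<epsilon>) (x, 0)
    \<le> (\<integral>x'. indicator (cball x r) x' * log_box_integral R (map (Pair 0) bs) (mollified \<epsilon>) (x', 0) \<partial>lborel)"
proof -
  define F where "F = log_box_integral R (map (Pair 0) bs) (mollified \<epsilon>)"
  obtain d1 d2 where C: "C2 (mollified \<epsilon>) d1 d2"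
    "\<And>x y r. r > 0 \<Longrightarrow> cball x (\<epsilon> + r) \<subseteq> S \<Longrightarrow> norm y + \<epsilon> < \<rho> \<Longrightarrow> affine_subharmonic_at d2 x y"
    by (rule mollified_C2[OF \<epsilon>], rule that)
  have n1: "norm b = 1" if "b \<in> set bs" for b using that bs(2) by simp
  obtain D1 D2 where D': "C2 (log_box_integral R (map (Pair 0) bs) (mollified \<epsilon>)) D1 D2"
    "\<And>x y \<rho>. (\<And>y'. norm y' \<le> \<rho> + R * length bs \<Longrightarrow> affine_subharmonic_at d2 x y') \<Longrightarrow> norm y \<le> \<rho> \<Longrightarrow> affine_subharmonic_at D2 x y"
  proof (rule log_box_integral_C2[OF R C(1) n1])
    fix D1 D2 assume "C2 (log_box_integral R (map (Pair 0) bs) (mollified \<epsilon>)) D1 D2"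
    "\<And>x y \<rho>. (\<And>y'. norm y' \<le> \<rho> + R * length bs \<Longrightarrow> affine_subharmonic_at d2 x y') \<Longrightarrow> norm y \<le> \<rho> \<Longrightarrow> affine_subharmonic_at D2 x y"
    then show thesis by (rule that)
  qed
  note D = D'[folded F_def]
  have len: "length bs = DIM('b)" using distinct_card[OF bs(1)] bs(2) by simp
  have basis: "(v, 0::'b) = (\<Sum>b\<in>Basis. (v \<bullet> b) *\<^sub>R (b, 0))" for v :: 'a
    by (simp add: prod_eq_iff fst_sum snd_sum euclidean_representation)
  interpret P: pure_second_partials UNIV "\<lambda>x'. F (x', 0)" "\<lambda>b x'. D1 (x', 0) (b, 0)" "\<lambda>b x'. D2 (x', 0) (b, 0) (b, 0)"
  proof
    fix x' v :: 'a
    have "D1 w (v, 0) = (\<Sum>b\<in>Basis. (v \<bullet> b) * D1 w (b, 0))" for w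
      by (subst basis) (simp add: linear_sum[OF C2D(6)[OF D(1)]] linear_scale[OF C2D(6)[OF D(1)]] del: scaleR_Pair)
    then show "((\<lambda>s. F (x' + s *\<^sub>R v, 0)) has_real_derivative (\<Sum>b\<in>Basis. (v \<bullet> b) * D1 (x', 0) (b, 0))) (at 0)"
      using C2_deriv_at_0(1)[OF D(1), of "(x', 0)" "(v, 0)"] by simp
  next
    fix x' b :: 'a
    show "((\<lambda>s. D1 (x' + s *\<^sub>R b, 0) (b, 0)) has_real_derivative D2 (x', 0) (b, 0) (b, 0)) (at 0)"
      using C2_deriv_at_0(2)[OF D(1), of "(x', 0)" "(b, 0)" "(b, 0)"] by simp
  next
    have cp: "continuous_on UNIV (\<lambda>x'::'a. (x', 0::'b))" by (intro continuous_intros)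
    show "continuous_on UNIV (\<lambda>x'. F (x', 0))" by (rule continuous_on_compose2[OF C2D(3)[OF D(1)] cp]) auto
    show "continuous_on UNIV (\<lambda>x'. D1 (x', 0) (b, 0))" for b
      by (rule continuous_on_compose2[OF C2D(4)[OF D(1)] cp]) auto
    show "continuous_on UNIV (\<lambda>x'. D2 (x', 0) (b, 0) (b, 0))" for b
      by (rule continuous_on_compose2[OF C2D(5)[OF D(1)] cp]) auto
  qed
  have "measure lborel (cball x r) * F (x, 0) \<le> (\<integral>x'. indicator (cball x r) x' * F (x', 0) \<partial>lborel)"
  proof (rule P.submean_of_laplacian_nonneg[OF subset_UNIV r])
    fix x' assume x': "x' \<in> cball x r"
    have "cball x' (\<epsilon> + e) \<subseteq> S"
    proof
      fix z assume "z \<in> cball x' (\<epsilon> + e)"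
      then have "dist x z \<le> r + \<epsilon> + e" using x' dist_triangle[of x z x'] by simp
      then show "z \<in> S" using e(2) by auto
    qed
    then have "affine_subharmonic_at d2 x' y" if "norm y \<le> 0 + R * length bs" for y
      using that \<rho> by (intro C(2)[OF e(1)]) (auto simp: len)
    then have "affine_subharmonic_at D2 x' 0" by (rule D(2)[where \<rho>=0]) auto
    then have "\<forall>A. linear A \<longrightarrow> (\<Sum>b\<in>Basis. D2 (x', 0) (b, A b) (b, A b)) \<ge> 0" by (simp add: affine_subharmonic_at_def)
    \<comment> \<open>After all coordinates have been integrated out only the slope 0 is of
      interest; the other slopes carried the induction.\<close>
    from this[rule_format, of "\<lambda>_. 0"] show "(\<Sum>b\<in>Basis. D2 (x', 0) (b, 0) (b, 0)) \<ge> 0" by (simp add: linear_iff)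
  qed
  then show ?thesis by (simp add: F_def)
qed

text \<open>Mollification at radii tending to 0. Dominated convergence is used twice, over the cube
  inside the logarithm with bound \<open>exp C\<close>, and then over the ball with the constant
  \<open>K\<close>.\<close>

lemma neg_log_cube_submean:
  fixes R r e :: real
  assumes R: "R > 0" and r: "r > 0" and e: "e > 0" "cball x (r + e) \<subseteq> S" and \<rho>: "R * DIM('b) < \<rho>"
    and usc: "\<And>x y \<eta>. x \<in> interior S \<Longrightarrow> norm y < \<rho> \<Longrightarrow> \<eta> > 0 \<Longrightarrow> eventually (\<lambda>w. \<Psi> w < \<Psi> (x, y) + \<eta>) (nhds (x, y))"
  shows "integrable lborel (\<lambda>x'. indicator (cball x r) x' * neg_log_cube R x')"
    and "measure lborel (cball x r) * neg_log_cube R x \<le> (\<integral>x'. indicator (cball x r) x' * neg_log_cube R x' \<partial>lborel)"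
proof -
  obtain bs where bs: "distinct bs" "set bs = (Basis :: 'b set)" using finite_distinct_list[OF finite_Basis] by blast
  \<comment> \<open>Half of the margin \<open>e\<close> goes to the kernel in the first variable,
    the other half to the open condition of \<open>mollified_log_box_submean\<close>; the second
    entry keeps \<open>R * DIM('b)\<close> plus the kernel radius below
    \<open>\<rho>\<close>.\<close>
  define \<epsilon>0 where "\<epsilon>0 = min (e / 2) ((\<rho> - R * DIM('b)) / 2)"
  have \<epsilon>0: "\<epsilon>0 > 0" "\<epsilon>0 \<le> e / 2" "\<epsilon>0 \<le> (\<rho> - R * DIM('b)) / 2" 
    unfolding \<epsilon>0_def using e \<rho> by (simp, intro min.cobounded1, intro min.cobounded2)
  define \<epsilon> where "\<epsilon> n = \<epsilon>0 / real (Suc n)" for n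
  have \<epsilon>: "\<epsilon> n > 0" "\<epsilon> n \<le> \<epsilon>0" for n using \<epsilon>0 by (auto simp: \<epsilon>_def field_simps)
  have \<epsilon>lim: "\<epsilon> \<longlonglongrightarrow> 0" unfolding \<epsilon>_def using LIMSEQ_Suc[OF lim_const_over_n[of \<epsilon>0]] by simp
  define F where "F n x' = log_box_integral R (map (Pair 0) bs) (mollified (\<epsilon> n)) (x', 0)" for n x'
  define K where "K = C + \<bar>ln (measure lborel (cube R :: 'b set))\<bar>"
  have Feq: "F n x' = - ln (\<integral>y. indicator (cube R) y * exp (- mollified (\<epsilon> n) (x', y)) \<partial>lborel)" for n x'
    unfolding F_def by (rule mollified_log_box[OF \<epsilon>(1) R bs])
  note mm = mollified_log_box(2)[OF \<epsilon>(1) R bs]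
  have Fb: "\<bar>F n x'\<bar> \<le> K" for n x'
    unfolding Feq K_def by (rule abs_neg_log_cube_le(1)[OF R mm mollified_abs_le[OF \<epsilon>(1)]])
  have sub: "measure lborel (cball x r) * F n x \<le> (\<integral>x'. indicator (cball x r) x' * F n x' \<partial>lborel)" for n
    unfolding F_def
  proof (rule mollified_log_box_submean[OF \<epsilon>(1) R bs r])
    show "e / 2 > 0" using e by simp
    have "r + \<epsilon> n + e / 2 \<le> r + e" using \<epsilon>(2)[of n] \<epsilon>0 by simp
    then show "cball x (r + \<epsilon> n + e / 2) \<subseteq> S" using e(2) subset_cball by blast
    show "R * DIM('b) + \<epsilon> n < \<rho>" using \<epsilon>(2)[of n] \<epsilon>0(3) \<rho> by (simp add: field_simps)
  qed
  have Fm: "(\<lambda>x'. indicator (cball x r) x' * F n x') \<in> borel_measurable borel" for n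
  proof -
    from nn_integral_log_box_integral(2)[OF continuous_on_mollified[OF \<epsilon>(1)] R bs(1)] bs(2)
    have c: "continuous_on UNIV (log_box_integral R (map (Pair 0) bs) (mollified (\<epsilon> n)))" by simp
    have "continuous_on (cball x r) (F n)"
      unfolding F_def by (rule continuous_on_compose2[OF c]) (auto intro!: continuous_intros)
    then show ?thesis by (intro measurable_indicator_compact) auto
  qed
  have sec: "(\<lambda>y. \<Psi> (x', y)) \<in> borel_measurable borel" for x' by measurable
  have lim: "(\<lambda>n. F n x') \<longlonglongrightarrow> neg_log_cube R x'" if x': "x' \<in> cball x r" for x'
  proof -
    have "cball x' e \<subseteq> S"
    proof
      fix z assume "z \<in> cball x' e"
      then have "dist x z \<le> r + e" using x' dist_triangle[of x z x'] by simp
      then show "z \<in> S" using e(2) by auto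
    qed
    then have xi: "x' \<in> interior S" using e(1) mem_interior_cball by blast
    have "(\<lambda>n. \<integral>y. indicator (cube R) y * exp (- mollified (\<epsilon> n) (x', y)) \<partial>lborel)
       \<longlonglongrightarrow> (\<integral>y. indicator (cube R) y * exp (- \<Psi> (x', y)) \<partial>lborel)"
    proof (rule integral_dominated_convergence[where w="\<lambda>y. indicator (cube R) y * exp C"])
      show "(\<lambda>y. indicator (cube R) y * exp (- \<Psi> (x', y))) \<in> borel_measurable lborel"
        using exp_cube_integral_bounds(1)[OF R sec bound] by (rule borel_measurable_integrable)
      show "(\<lambda>y. indicator (cube R) y * exp (- mollified (\<epsilon> n) (x', y))) \<in> borel_measurable lborel" for n
        using exp_cube_integral_bounds(1)[OF R mm mollified_abs_le[OF \<epsilon>(1)]] by (rule borel_measurable_integrable)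
      show "integrable lborel (\<lambda>y::'b. indicator (cube R) y * exp C)"
        by (rule integrable_indicator_compact[OF compact_cube continuous_on_const])
      show "AE y in lborel. norm (indicator (cube R) y * exp (- mollified (\<epsilon> n) (x', y))) \<le> indicator (cube R) y * exp C" for n
        using mollified_abs_le[OF \<epsilon>(1), of n] by (intro AE_I2) (auto simp: indicator_def abs_le_iff minus_le_iff)
      show "AE y in lborel. (\<lambda>n. indicator (cube R) y * exp (- mollified (\<epsilon> n) (x', y))) \<longlonglongrightarrow> indicator (cube R) y * exp (- \<Psi> (x', y))"
      proof (intro AE_I2)
        fix y :: 'b
        show "(\<lambda>n. indicator (cube R) y * exp (- mollified (\<epsilon> n) (x', y))) \<longlonglongrightarrow> indicator (cube R) y * exp (- \<Psi> (x', y))"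
        proof (cases "y \<in> cube R")
          case True
          then have "norm y < \<rho>" using norm_cube_le[OF True] \<rho> by simp
          then have "(\<lambda>n. mollified (\<epsilon> n) (x', y)) \<longlonglongrightarrow> \<Psi> (x', y)"
            by (intro mollified_tendsto[OF refl xi _ usc[OF xi] \<epsilon>lim \<epsilon>(1)])
          then show ?thesis by (intro tendsto_intros)
        qed simp
      qed
    qed
    then show ?thesis unfolding Feq neg_log_cube_def
      by (intro tendsto_minus tendsto_ln) (use abs_neg_log_cube_le(2)[OF R sec bound, of x'] in auto)
  qed
  have lim': "(\<lambda>n. indicator (cball x r) x' * F n x') \<longlonglongrightarrow> indicator (cball x r) x' * neg_log_cube R x'" for x'
    using lim[of x'] by (cases "x' \<in> cball x r") auto
  have m: "(\<lambda>x'. indicator (cball x r) x' * neg_log_cube R x') \<in> borel_measurable borel"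
    by (rule borel_measurable_LIMSEQ_real[OF lim' Fm])
  have iK: "integrable lborel (\<lambda>x'::'a. indicator (cball x r) x' * K)"
    by (rule integrable_indicator_compact[OF compact_cball continuous_on_const])
  have dom: "AE x' in lborel. norm (indicator (cball x r) x' * F n x') \<le> indicator (cball x r) x' * K" for n
    using Fb[of n] by (intro AE_I2) (auto simp: indicator_def)
  have m': "(\<lambda>x'. indicator (cball x r) x' * neg_log_cube R x') \<in> borel_measurable lborel"
    "\<And>n. (\<lambda>x'. indicator (cball x r) x' * F n x') \<in> borel_measurable lborel" using m Fm by simp_all
  have ae: "AE x' in lborel. (\<lambda>n. indicator (cball x r) x' * F n x') \<longlonglongrightarrow> indicator (cball x r) x' * neg_log_cube R x'"
    using lim' by simp
  show "integrable lborel (\<lambda>x'. indicator (cball x r) x' * neg_log_cube R x')"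
    by (rule integrable_dominated_convergence[OF m' iK ae dom])
  have L: "(\<lambda>n. \<integral>x'. indicator (cball x r) x' * F n x' \<partial>lborel) \<longlonglongrightarrow> (\<integral>x'. indicator (cball x r) x' * neg_log_cube R x' \<partial>lborel)"
    by (rule integral_dominated_convergence[OF m' iK ae dom])
  have "(\<lambda>n. measure lborel (cball x r) * F n x) \<longlonglongrightarrow> measure lborel (cball x r) * neg_log_cube R x"
    using lim[of x] r by (intro tendsto_mult_left) auto
  from this L show "measure lborel (cball x r) * neg_log_cube R x \<le> (\<integral>x'. indicator (cball x r) x' * neg_log_cube R x' \<partial>lborel)"
    by (rule LIMSEQ_le) (use sub in auto)
qed

end

section \<open>The logarithmic integral is subharmonic\<close>

lemma ereal_le_uminus_iff:
  fixes a b :: ereal shows "a \<le> - b \<longleftrightarrow> b \<le> - a"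
  using ereal_minus_le_minus[of "- b" a] by simp

lemma ereal_exp_le_iff: "ereal_exp a \<le> ereal_exp b \<longleftrightarrow> a \<le> b"
  by (cases a; cases b) (auto simp: ereal_exp_def top_unique not_le)

lemma ereal_exp_ennreal_ln: "ereal_exp (ennreal_ln z) = z"
  by (cases z) (auto simp: ereal_exp_def ennreal_ln_def ennreal_eq_0_iff not_le)

text \<open>Together with the next lemma this is a Galois connection in both directions. Suprema,
  measurability and comparisons can then be handled without separating the infinite values.\<close>

lemma ennreal_ln_le_iff: "ennreal_ln z \<le> d \<longleftrightarrow> z \<le> ereal_exp d"
  using ereal_exp_le_iff[of "ennreal_ln z" d] by (simp add: ereal_exp_ennreal_ln)

lemma le_ennreal_ln_iff: "d \<le> ennreal_ln z \<longleftrightarrow> ereal_exp d \<le> z"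
  using ereal_exp_le_iff[of d "ennreal_ln z"] by (simp add: ereal_exp_ennreal_ln)

lemma ennreal_ln_mono: "z \<le> z' \<Longrightarrow> ennreal_ln z \<le> ennreal_ln z'"
  by (simp add: ennreal_ln_le_iff ereal_exp_ennreal_ln)

lemma ennreal_ln_SUP: "ennreal_ln (SUP n\<in>A. f n) = (SUP n\<in>A. ennreal_ln (f n))"
proof (rule antisym)
  have "f n \<le> ereal_exp (SUP n\<in>A. ennreal_ln (f n))" if "n \<in> A" for n
    unfolding ennreal_ln_le_iff[symmetric] using that by (rule SUP_upper)
  then show "ennreal_ln (SUP n\<in>A. f n) \<le> (SUP n\<in>A. ennreal_ln (f n))"
    unfolding ennreal_ln_le_iff by (rule SUP_least)
qed (auto intro!: SUP_least ennreal_ln_mono SUP_upper)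

lemma measurable_ereal_exp [measurable]: "ereal_exp \<in> borel_measurable borel"
proof (rule borel_measurableI_less)
  fix z
  have "{x \<in> space borel. ereal_exp x < z} = {..<ennreal_ln z}"
    by (auto simp: ennreal_ln_le_iff not_le[symmetric])
  then show "{x \<in> space borel. ereal_exp x < z} \<in> sets borel" by simp
qed

lemma ennreal_ln_ennreal: "a > 0 \<Longrightarrow> ennreal_ln (ennreal a) = ereal (ln a)"
  by (simp add: ennreal_ln_def)

section \<open>Upper semicontinuous functions\<close>

lemma open_usc_sublevel:
  assumes "open \<Omega>" "usc_on \<Omega> f" shows "open {x\<in>\<Omega>. f x < c}"
  using assms by (simp add: usc_on_def openin_open_eq)

text \<open>If a sublevel set is not a neighbourhood of \<open>x\<close>, there are points closer to
  \<open>x\<close> than \<open>1 / Suc n\<close> with values at least \<open>c\<close>. The minimum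
  with \<open>d\<close> keeps these points inside \<open>\<Omega>\<close>.\<close>

lemma usc_onI_sequentially:
  fixes f :: "'a::metric_space \<Rightarrow> ereal"
  assumes \<Omega>: "open \<Omega>"
    and seq: "\<And>X x c. (\<And>n. X n \<in> \<Omega>) \<Longrightarrow> x \<in> \<Omega> \<Longrightarrow> X \<longlonglongrightarrow> x \<Longrightarrow> (\<And>n::nat. c \<le> f (X n)) \<Longrightarrow> c \<le> f x"
  shows "usc_on \<Omega> f"
  unfolding usc_on_def openin_open_eq[OF \<Omega>]
proof (intro allI conjI)
  fix c
  show "open {x\<in>\<Omega>. f x < c}"
    unfolding open_contains_ball
  proof (rule ballI, rule ccontr)
    fix x assume x: "x \<in> {x\<in>\<Omega>. f x < c}" and no: "\<not> (\<exists>e>0. ball x e \<subseteq> {x\<in>\<Omega>. f x < c})"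
    obtain d where d: "d > 0" "ball x d \<subseteq> \<Omega>" using \<Omega> x open_contains_ball by blast
    have "\<exists>y. dist x y < min d (1 / real (Suc n)) \<and> y \<in> \<Omega> \<and> c \<le> f y" for n
    proof -
      have "min d (1 / real (Suc n)) > 0" using d by simp
      with no have "\<not> ball x (min d (1 / real (Suc n))) \<subseteq> {x\<in>\<Omega>. f x < c}" by blast
      then obtain y where y: "y \<in> ball x (min d (1 / real (Suc n)))" "y \<notin> {x\<in>\<Omega>. f x < c}" by blast
      then have "y \<in> \<Omega>" using d(2) by auto
      with y show ?thesis by (auto simp: not_less)
    qed
    then obtain X where X: "\<And>n. dist x (X n) < min d (1 / real (Suc n)) \<and> X n \<in> \<Omega> \<and> c \<le> f (X n)" by metis
    have "X \<longlonglongrightarrow> x"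
    proof (rule tendstoI)
      fix e :: real assume "e > 0"
      then obtain N where N: "1 / real (Suc N) < e" using nat_approx_posE by blast
      have "dist (X n) x < e" if "n \<ge> N" for n
      proof -
        have "1 / real (Suc n) \<le> 1 / real (Suc N)" using that by (simp add: frac_le)
        then show ?thesis using X[of n] N by (simp add: dist_commute)
      qed
      then show "\<forall>\<^sub>F n in sequentially. dist (X n) x < e" by (auto simp: eventually_sequentially)
    qed
    then have "c \<le> f x" by (rule seq[rotated 2]) (use X x in blast)+
    then show False using x leD by blast
  qed
qed auto

lemma usc_measurable:
  fixes f :: "'a::euclidean_space \<Rightarrow> ereal"
  assumes "open \<Omega>" "usc_on \<Omega> f" "B \<in> sets borel" "B \<subseteq> \<Omega>"
  shows "f \<in> borel_measurable (restrict_space lborel B)"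
proof (rule borel_measurableI_less)
  fix c
  have "{x \<in> space (restrict_space lborel B). f x < c} = {x\<in>\<Omega>. f x < c} \<inter> B"
    using assms(4) by (auto simp: space_restrict_space)
  moreover have "{x\<in>\<Omega>. f x < c} \<in> sets borel" by (intro borel_open open_usc_sublevel assms)
  ultimately show "{x \<in> space (restrict_space lborel B). f x < c} \<in> sets (restrict_space lborel B)"
    using assms(3) by (auto simp: sets_restrict_space)
qed

lemma usc_bounded_above:
  fixes f :: "'a::metric_space \<Rightarrow> ereal"
  assumes "open \<Omega>" "usc_on \<Omega> f" "compact K" "K \<subseteq> \<Omega>" "\<And>x. x \<in> K \<Longrightarrow> f x \<noteq> \<infinity>"
  obtains C :: real where "C > 0" "\<And>x. x \<in> K \<Longrightarrow> f x < ereal C"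
proof -
  have "K \<subseteq> (\<Union>n\<in>(UNIV::nat set). {x\<in>\<Omega>. f x < ereal (real n)})"
  proof
    fix x assume x: "x \<in> K"
    then have "f x < \<infinity>" using assms(5)[of x] by simp
    then obtain n where "f x < ereal (real n)" using less_PInf_Ex_of_nat[of "f x"] by auto
    then show "x \<in> (\<Union>n\<in>(UNIV::nat set). {x\<in>\<Omega>. f x < ereal (real n)})" using x assms(4) by auto
  qed
  then obtain D where D: "D \<subseteq> (UNIV::nat set)" "finite D" "K \<subseteq> (\<Union>n\<in>D. {x\<in>\<Omega>. f x < ereal (real n)})"
    using compactE_image[OF assms(3), of UNIV "\<lambda>n. {x\<in>\<Omega>. f x < ereal (real n)}"] open_usc_sublevel[OF assms(1,2)] by blast
  have "f x < ereal (real (Suc (Max D)))" if x: "x \<in> K" for x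
  proof -
    obtain n where n: "n \<in> D" "f x < ereal (real n)" using D(3) x by blast
    then have "ereal (real n) \<le> ereal (real (Suc (Max D)))" using Max_ge[OF D(2) n(1)] by simp
    with n(2) show ?thesis by (rule less_le_trans)
  qed
  then show ?thesis using that[of "real (Suc (Max D))"] by simp
qed

section \<open>Monotonicity and limits of the extended-valued integral\<close>

lemma ereal_integral_mono:
  assumes "\<And>x. x \<in> space M \<Longrightarrow> f x \<le> g x"
  shows "ereal_integral M f \<le> ereal_integral M g"
  unfolding ereal_integral_def
  by (intro ereal_minus_mono; unfold less_eq_ennreal.rep_eq[symmetric]; intro nn_integral_mono e2ennreal_mono)
     (use assms in auto)

lemma ereal_integral_real:
  assumes "integrable M g" "\<And>x. x \<in> space M \<Longrightarrow> f x = ereal (g x)"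
  shows "ereal_integral M f = ereal (integral\<^sup>L M g)"
proof -
  have "(\<integral>\<^sup>+x. e2ennreal (f x) \<partial>M) = (\<integral>\<^sup>+x. ennreal (g x) \<partial>M)"
    "(\<integral>\<^sup>+x. e2ennreal (- f x) \<partial>M) = (\<integral>\<^sup>+x. ennreal (- g x) \<partial>M)"
    by (intro nn_integral_cong; simp add: assms(2))+
  moreover obtain a b where "(\<integral>\<^sup>+x. ennreal (g x) \<partial>M) = ennreal a" "a \<ge> 0" "(\<integral>\<^sup>+x. ennreal (- g x) \<partial>M) = ennreal b" "b \<ge> 0"
    using assms(1) unfolding real_integrable_def by (metis ennreal_cases infinity_ennreal_def)
  ultimately show ?thesis
    using real_lebesgue_integral_def[OF assms(1)] by (simp add: ereal_integral_def enn2ereal_ennreal)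
qed

lemma ereal_integral_real_restrict:
  fixes g :: "'a::euclidean_space \<Rightarrow> real"
  assumes "B \<in> sets borel" "integrable lborel (\<lambda>x. indicator B x * g x)" "\<And>x. x \<in> B \<Longrightarrow> f x = ereal (g x)"
  shows "ereal_integral (restrict_space lborel B) f = ereal (\<integral>x. indicator B x * g x \<partial>lborel)"
proof -
  have "integrable (restrict_space lborel B) g" using assms by (subst integrable_restrict_space) auto
  then have "ereal_integral (restrict_space lborel B) f = ereal (integral\<^sup>L (restrict_space lborel B) g)"
    by (rule ereal_integral_real) (use assms(3) in \<open>simp add: space_restrict_space\<close>)
  then show ?thesis using assms(1) by (simp add: integral_restrict_space)
qed

text \<open>The positive parts are dominated by \<open>C\<close> on a finite measure space; the
  negative parts increase, possibly to an infinite integral. As the limit of the positive parts is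
  finite, the difference never has the form \<infinity> - \<infinity>.\<close>

lemma ereal_integral_decseq:
  assumes m: "\<And>n. F n \<in> borel_measurable M" "f \<in> borel_measurable M"
    and dec: "\<And>x n. x \<in> space M \<Longrightarrow> F (Suc n) x \<le> F n x"
    and lim: "\<And>x. x \<in> space M \<Longrightarrow> (\<lambda>n. F n x) \<longlonglongrightarrow> f x"
    and C: "\<And>x. x \<in> space M \<Longrightarrow> F 0 x \<le> ereal C" and fin: "finite_measure M"
  shows "(\<lambda>n. ereal_integral M (F n)) \<longlonglongrightarrow> ereal_integral M f"
proof -
  interpret finite_measure M by (rule fin)
  have le0: "F n x \<le> ereal C" if "x \<in> space M" for n x
    using C[OF that] dec[OF that] by (induction n) (auto intro: order_trans)
  have Cfin: "(\<integral>\<^sup>+x. ennreal C \<partial>M) < \<infinity>"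
  proof -
    have "emeasure M (space M) < top" by (simp add: less_top[symmetric])
    then show ?thesis by (simp add: ennreal_mult_less_top)
  qed
  have pos: "(\<lambda>n. \<integral>\<^sup>+x. e2ennreal (F n x) \<partial>M) \<longlonglongrightarrow> (\<integral>\<^sup>+x. e2ennreal (f x) \<partial>M)"
  proof (rule nn_integral_dominated_convergence[where w="\<lambda>_. ennreal C"])
    show "AE x in M. e2ennreal (F n x) \<le> ennreal C" for n
      using le0 by (intro AE_I2) (metis e2ennreal_ereal e2ennreal_mono)
    show "AE x in M. (\<lambda>n. e2ennreal (F n x)) \<longlonglongrightarrow> e2ennreal (f x)"
      using lim by (intro AE_I2 tendsto_e2ennrealI)
  qed (use m Cfin in auto)
  have pfin: "(\<integral>\<^sup>+x. e2ennreal (f x) \<partial>M) < \<infinity>"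
  proof -
    have "f x \<le> ereal C" if "x \<in> space M" for x
      using lim[OF that] by (rule LIMSEQ_le_const2) (use le0[OF that] in auto)
    then have "(\<integral>\<^sup>+x. e2ennreal (f x) \<partial>M) \<le> (\<integral>\<^sup>+x. ennreal C \<partial>M)"
      by (intro nn_integral_mono) (metis e2ennreal_ereal e2ennreal_mono)
    then show ?thesis using Cfin by (rule le_less_trans)
  qed
  have neg_inc: "e2ennreal (- F n x) \<le> e2ennreal (- F (Suc n) x)" if "x \<in> space M" for n x
    using dec[OF that, of n] by (intro e2ennreal_mono) simp
  have "(\<integral>\<^sup>+x. e2ennreal (- f x) \<partial>M) = (\<integral>\<^sup>+x. (SUP n. e2ennreal (- F n x)) \<partial>M)"
  proof (rule nn_integral_cong)
    fix x assume x: "x \<in> space M"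
    have "incseq (\<lambda>n. e2ennreal (- F n x))" using neg_inc[OF x] by (rule incseq_SucI)
    then have "(\<lambda>n. e2ennreal (- F n x)) \<longlonglongrightarrow> (SUP n. e2ennreal (- F n x))" by (rule LIMSEQ_SUP)
    moreover have "(\<lambda>n. e2ennreal (- F n x)) \<longlonglongrightarrow> e2ennreal (- f x)"
      using lim[OF x] by (intro tendsto_e2ennrealI tendsto_uminus_ereal)
    ultimately show "e2ennreal (- f x) = (SUP n. e2ennreal (- F n x))" using LIMSEQ_unique by blast
  qed
  also have "\<dots> = (SUP n. \<integral>\<^sup>+x. e2ennreal (- F n x) \<partial>M)"
    by (rule nn_integral_monotone_convergence_SUP_AE) (use m neg_inc in auto)
  finally have neg: "(\<lambda>n. \<integral>\<^sup>+x. e2ennreal (- F n x) \<partial>M) \<longlonglongrightarrow> (\<integral>\<^sup>+x. e2ennreal (- f x) \<partial>M)"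
    by (simp only:) (intro LIMSEQ_SUP incseq_SucI nn_integral_mono neg_inc)
  show ?thesis unfolding ereal_integral_def
  proof (intro tendsto_diff_ereal_general tendsto_enn2erealI pos neg)
    have "enn2ereal (\<integral>\<^sup>+x. e2ennreal (f x) \<partial>M) \<noteq> \<infinity>" "enn2ereal (\<integral>\<^sup>+x. e2ennreal (f x) \<partial>M) \<noteq> - \<infinity>"
      using pfin by (cases "\<integral>\<^sup>+x. e2ennreal (f x) \<partial>M"; simp add: enn2ereal_ennreal)+
    then show "\<not> (enn2ereal (\<integral>\<^sup>+x. e2ennreal (f x) \<partial>M) = \<infinity> \<and> enn2ereal (\<integral>\<^sup>+x. e2ennreal (- f x) \<partial>M) = \<infinity> \<or>
       enn2ereal (\<integral>\<^sup>+x. e2ennreal (f x) \<partial>M) = - \<infinity> \<and> enn2ereal (\<integral>\<^sup>+x. e2ennreal (- f x) \<partial>M) = - \<infinity>)" by blast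
  qed
qed

lemma max_eq_ereal_real:
  fixes a :: ereal assumes "a \<noteq> \<infinity>" shows "max a (ereal c) = ereal (real_of_ereal (max a (ereal c)))"
  using assms by (cases a) (auto simp: max_def)

text \<open>The average of the maximum is at least the average of \<open>f\<close> and at least
  \<open>c\<close>, while the value at the centre is \<open>f x\<close> or \<open>c\<close>.\<close>

lemma subharmonic_truncate_submean:
  fixes f :: "'a::euclidean_space \<Rightarrow> ereal"
  assumes f: "subharmonic_on \<Omega> f" and r: "r > 0" "cball x r \<subseteq> \<Omega>"
    and g: "integrable lborel (\<lambda>x'. indicator (cball x r) x' * g x')" "\<And>x'. x' \<in> cball x r \<Longrightarrow> ereal (g x') = max (f x') (ereal c)"
  shows "measure lborel (cball x r) * g x \<le> (\<integral>x'. indicator (cball x r) x' * g x' \<partial>lborel)"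
proof -
  let ?B = "cball x r" and ?V = "measure lborel (cball x r)" and ?I = "\<integral>x'. indicator (cball x r) x' * g x' \<partial>lborel"
  have V: "?V > 0" using content_cball_pos[OF r(1)] by simp
  have "f x \<le> ereal (1 / ?V) * ereal_integral (restrict_space lborel ?B) f" using f r by (auto simp: subharmonic_on_def)
  also have "ereal_integral (restrict_space lborel ?B) f \<le> ereal_integral (restrict_space lborel ?B) (\<lambda>x'. ereal (g x'))"
    by (intro ereal_integral_mono) (simp add: g(2) space_restrict_space)
  also have "\<dots> = ereal ?I" by (rule ereal_integral_real_restrict[OF _ g(1)]) auto
  finally have 1: "f x \<le> ereal (1 / ?V) * ereal ?I" using V by (simp add: ereal_mult_left_mono)
  have gc: "c \<le> g x'" if "x' \<in> ?B" for x'
  proof -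
    have "ereal c \<le> ereal (g x')" unfolding g(2)[OF that] by simp
    then show ?thesis by simp
  qed
  have "?V * c = (\<integral>x'. indicator ?B x' * c \<partial>lborel)" by simp
  also have "\<dots> \<le> ?I"
  proof (rule Bochner_Integration.integral_mono[OF _ g(1)])
    show "integrable lborel (\<lambda>x'. indicator ?B x' * c)" by (rule integrable_indicator_compact[OF compact_cball continuous_on_const])
  qed (use gc in \<open>auto simp: indicator_def\<close>)
  finally have 2: "ereal c \<le> ereal (1 / ?V) * ereal ?I" using V by (simp add: field_simps)
  have "ereal (g x) \<le> ereal (1 / ?V * ?I)" using 1 2 r by (subst g(2)) auto
  then show ?thesis using V by (simp add: field_simps)
qed

text \<open>At a fixed level everything is finite: the truncated function is at least
  \<open>- N\<close>, and upper semicontinuity bounds it above on a compact set. Cut off to zero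
  outside that set it meets \<open>affine_submean\<close>, and \<open>neg_log_cube_submean\<close>
  applies on the cube of size \<open>N\<close>.\<close>

lemma submean_level:
  fixes \<psi> :: "'a::euclidean_space \<Rightarrow> 'b::euclidean_space \<Rightarrow> ereal"
  assumes \<Omega>: "open \<Omega>" and ninf: "\<And>x y. x \<in> \<Omega> \<Longrightarrow> \<psi> x y \<noteq> \<infinity>"
    and usc: "usc_on (\<Omega> \<times> UNIV) (\<lambda>(x, y). \<psi> x y)" and conv: "\<And>x. x \<in> \<Omega> \<Longrightarrow> ereal_convex (\<psi> x)"
    and sub: "\<And>A b. linear A \<Longrightarrow> subharmonic_on \<Omega> (\<lambda>x. \<psi> x (A x + b))"
    and r: "r > 0" "cball x r \<subseteq> \<Omega>" and N: "N > 0"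
  obtains F K where "\<And>x'. x' \<in> cball x r \<Longrightarrow>
      ereal (F x') = - ennreal_ln (\<integral>\<^sup>+y. ereal_exp (- max (\<psi> x' y) (ereal (- N))) * indicator (cube N) y \<partial>lborel)"
    "\<And>x'. x' \<in> cball x r \<Longrightarrow> \<bar>F x'\<bar> \<le> K" "integrable lborel (\<lambda>x'. indicator (cball x r) x' * F x')"
    "measure lborel (cball x r) * F x \<le> (\<integral>x'. indicator (cball x r) x' * F x' \<partial>lborel)"
proof -
  \<comment> \<open>Mollification needs room beyond the ball. Compactness yields an
    \<open>e\<close>-neighbourhood inside \<open>\<Omega>\<close>, and a point of the enlarged ball
    outside the original one is within \<open>e\<close> of its radial projection \<open>z\<close> to
    the sphere of radius \<open>r\<close>.\<close>
  obtain e where e: "e > 0" "cball x (r + e) \<subseteq> \<Omega>"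
  proof -
    obtain e where e: "e > 0" "(\<Union>z\<in>cball x r. cball z e) \<subseteq> \<Omega>"
      using compact_subset_open_imp_cball_epsilon_subset[OF compact_cball \<Omega> r(2)] by blast
    have "cball x (r + e) \<subseteq> (\<Union>z\<in>cball x r. cball z e)"
    proof
      fix w assume w: "w \<in> cball x (r + e)"
      show "w \<in> (\<Union>z\<in>cball x r. cball z e)"
      proof (cases "norm (w - x) \<le> r")
        case True
        then have "w \<in> cball x r" by (simp add: dist_norm norm_minus_commute)
        then show ?thesis using e(1) by force
      next
        case False
        define z where "z = x + (r / norm (w - x)) *\<^sub>R (w - x)"
        have n: "norm (w - x) > 0" using False r(1) by linarith
        have zr: "z \<in> cball x r" using r(1) n by (simp add: z_def dist_norm)
        have "w - z = (1 - r / norm (w - x)) *\<^sub>R (w - x)" by (simp add: z_def algebra_simps)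
        then have "norm (w - z) = \<bar>1 - r / norm (w - x)\<bar> * norm (w - x)" by simp
        moreover have "1 - r / norm (w - x) \<ge> 0" using n False by (simp add: field_simps)
        ultimately have "norm (w - z) = norm (w - x) - r" using n by (simp add: left_diff_distrib)
        then have "w \<in> cball z e" using w by (simp add: dist_norm norm_minus_commute)
        with zr show ?thesis by blast
      qed
    qed
    then have "cball x (r + e) \<subseteq> \<Omega>" using e(2) by (rule subset_trans)
    with e(1) show thesis by (rule that)
  qed
  define S where "S = cball x (r + e)"
  \<comment> \<open>By \<open>norm_cube_le\<close> the cube lies in the ball of radius
    \<open>N * DIM('b)\<close>; the extra 1 gives the kernel room in the second variable.\<close>
  define \<rho> where "\<rho> = N * DIM('b) + 1"
  have S\<Omega>: "S \<subseteq> \<Omega>" using e by (simp add: S_def)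
  let ?K = "S \<times> cball 0 \<rho> :: ('a \<times> 'b) set"
  have open': "open (\<Omega> \<times> (UNIV :: 'b set))" using \<Omega> by (simp add: open_Times)
  have K: "compact ?K" "?K \<subseteq> \<Omega> \<times> UNIV" using S\<Omega> by (auto simp: S_def compact_Times)
  obtain C0 where C0: "C0 > 0" "\<And>w. w \<in> ?K \<Longrightarrow> (\<lambda>(x, y). \<psi> x y) w < ereal C0"
  proof (rule usc_bounded_above[OF open' usc K])
    show "(\<lambda>(x, y). \<psi> x y) w \<noteq> \<infinity>" if "w \<in> ?K" for w using that ninf S\<Omega> by auto
  qed (rule that)
  define C where "C = max C0 N"
  \<comment> \<open>The value 0 off the compact set makes \<open>\<Psi>\<close> bounded with compact
    support. All properties are asked for where the first alternative holds.\<close>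
  define \<Psi> where "\<Psi> w = (if w \<in> ?K then real_of_ereal (max (\<psi> (fst w) (snd w)) (ereal (- N))) else 0)" for w
  have \<Psi>e: "ereal (\<Psi> (x', y)) = max (\<psi> x' y) (ereal (- N))" if "x' \<in> S" "norm y \<le> \<rho>" for x' y
    using that S\<Omega> max_eq_ereal_real[OF ninf, of x' y "- N"] by (auto simp: \<Psi>_def)
  have bound: "\<bar>\<Psi> w\<bar> \<le> C" for w
  proof (cases "w \<in> ?K")
    case True
    obtain x' y where w: "w = (x', y)" by (cases w)
    have "ereal C0 \<le> ereal C" by (simp add: C_def)
    from less_le_trans[OF C0(2)[OF True] this] have "\<psi> x' y \<le> ereal C" by (simp add: w less_imp_le)
    moreover have "- N \<le> C" using N by (simp add: C_def le_max_iff_disj)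
    then have "ereal (- N) \<le> ereal C" by simp
    ultimately have "ereal (- N) \<le> ereal (\<Psi> w)" "ereal (\<Psi> w) \<le> ereal C"
      using True unfolding w by (simp_all add: \<Psi>e)
    then have "- N \<le> \<Psi> w" "\<Psi> w \<le> C" by simp_all
    moreover have "N \<le> C" by (simp add: C_def)
    ultimately show ?thesis by linarith
  next
    case False
    then show ?thesis using N by (simp add: \<Psi>_def C_def)
  qed
  have meas: "\<Psi> \<in> borel_measurable borel"
  proof (rule borel_measurableI_less)
    fix a :: real
    have lt: "\<Psi> (x', y) < a \<longleftrightarrow> \<psi> x' y < ereal a \<and> - N < a" if "(x', y) \<in> ?K" for x' y
    proof -
      have "\<Psi> (x', y) < a \<longleftrightarrow> ereal (\<Psi> (x', y)) < ereal a" by simp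
      also have "\<dots> \<longleftrightarrow> \<psi> x' y < ereal a \<and> - N < a" using that by (subst \<Psi>e) auto
      finally show ?thesis .
    qed
    \<comment> \<open>On the compact set this is a sublevel set of \<open>\<psi>\<close>, or empty
      if \<open>a\<close> does not exceed the truncation level; off it only the sign of
      \<open>a\<close> counts.\<close>
    have "{w \<in> space borel. \<Psi> w < a} = (?K \<inter> (if - N < a then {w \<in> \<Omega> \<times> UNIV. (\<lambda>(x, y). \<psi> x y) w < ereal a} else {}))
       \<union> (if 0 < a then - ?K else {})" (is "_ = ?R")
    proof (intro set_eqI)
      fix w
      show "w \<in> {w \<in> space borel. \<Psi> w < a} \<longleftrightarrow> w \<in> ?R"
      proof (cases "w \<in> ?K")
        case True
        then show ?thesis using S\<Omega> by (cases w) (auto simp: lt)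
      next
        case False
        then have "\<Psi> w = 0" by (simp add: \<Psi>_def)
        then show ?thesis using False by auto
      qed
    qed
    moreover have "?K \<in> sets borel" using K(1) compact_imp_closed borel_closed by blast
    moreover have "{w \<in> \<Omega> \<times> UNIV. (\<lambda>(x, y). \<psi> x y) w < ereal a} \<in> sets borel"
      by (intro borel_open open_usc_sublevel[OF open' usc])
    ultimately show "{w \<in> space borel. \<Psi> w < a} \<in> sets borel" by (auto split: if_splits)
  qed
  have "integrable lborel (\<lambda>w. indicator ?K w * 1 * \<Psi> w)"
    by (rule integrable_indicator_bounded[OF K(1) continuous_on_const meas bound])
  moreover have "(\<lambda>w. indicator ?K w * 1 * \<Psi> w) = \<Psi>" by (auto simp: \<Psi>_def indicator_def)
  ultimately have int: "integrable lborel \<Psi>" by simp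
  interpret affine_submean \<Psi> S \<rho> C
  proof
    fix x' s y and A :: "'a \<Rightarrow> 'b"
    assume s: "s > 0" and A: "linear A" and cs: "cball x' s \<subseteq> S"
      and small: "\<And>z. z \<in> cball x' s \<Longrightarrow> norm (y + A (z - x')) \<le> \<rho>"
    have cA: "continuous_on UNIV A" using A by (simp add: linear_continuous_on linear_conv_bounded_linear)
    have "continuous_on UNIV (\<lambda>z. (z, y + A (z - x')))"
      by (intro continuous_intros continuous_on_compose2[OF cA]) auto
    then have "(\<lambda>z. \<Psi> (z, y + A (z - x'))) \<in> borel_measurable borel"
      using measurable_compose[OF borel_measurable_continuous_onI meas] by blast
    from integrable_indicator_bounded[OF compact_cball continuous_on_const[of _ 1] this bound]
    have i: "integrable lborel (\<lambda>z. indicator (cball x' s) z * \<Psi> (z, y + A (z - x')))" by simp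
    have "measure lborel (cball x' s) * \<Psi> (x', y + A (x' - x')) \<le> (\<integral>z. indicator (cball x' s) z * \<Psi> (z, y + A (z - x')) \<partial>lborel)"
    \<comment> \<open>The graph of slope \<open>A\<close> through \<open>(x', y)\<close> has the
      constant term \<open>y - A x'\<close>.\<close>
    proof (rule subharmonic_truncate_submean[OF sub[OF A, of "y - A x'"] s _ i])
      fix z assume z: "z \<in> cball x' s"
      have eq: "A z + (y - A x') = y + A (z - x')" by (simp add: linear_diff[OF A])
      have "z \<in> S" using z cs by blast
      then show "ereal (\<Psi> (z, y + A (z - x'))) = max (\<psi> z (A z + (y - A x'))) (ereal (- N))"
        unfolding eq using small[OF z] by (rule \<Psi>e)
    qed (use cs S\<Omega> in auto)
    then show "measure lborel (cball x' s) * \<Psi> (x', y) \<le> (\<integral>z. indicator (cball x' s) z * \<Psi> (z, y + A (z - x')) \<partial>lborel)"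
      by (simp add: linear_0[OF A])
  next
    fix x' :: 'a and y t :: 'b assume x': "x' \<in> S" and t: "norm y + norm t \<le> \<rho>"
    have n: "norm y \<le> \<rho>" "norm (y - t) \<le> \<rho>" "norm (y + t) \<le> \<rho>"
      using t norm_triangle_ineq4[of y t] norm_triangle_ineq[of y t] norm_ge_zero[of t] by linarith+
    let ?P = "\<Psi> (x', y - t)" and ?Q = "\<Psi> (x', y + t)"
    have "(1 - 1/2) *\<^sub>R (y - t) + (1/2) *\<^sub>R (y + t) = (1/2 + 1/2) *\<^sub>R y"
      by (simp only: scaleR_diff_right scaleR_add_right scaleR_add_left) simp
    moreover have half: "(1/2::real) \<in> {0..1}" by simp
    moreover have "\<psi> x' ((1 - 1/2) *\<^sub>R (y - t) + (1/2) *\<^sub>R (y + t)) \<le> ereal (1 - 1/2) * \<psi> x' (y - t) + ereal (1/2) * \<psi> x' (y + t)"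
      using conv[of x', unfolded ereal_convex_def, rule_format, OF _ half] x' S\<Omega> by blast
    ultimately have "\<psi> x' y \<le> ereal (1/2) * \<psi> x' (y - t) + ereal (1/2) * \<psi> x' (y + t)" by simp
    also have "\<dots> \<le> ereal (1/2) * ereal ?P + ereal (1/2) * ereal ?Q"
      using x' n by (intro add_mono ereal_mult_left_mono) (auto simp: \<Psi>e)
    finally have 1: "\<psi> x' y \<le> ereal ((?P + ?Q) / 2)" by (simp add: field_simps)
    \<comment> \<open>The average has to dominate both entries of the maximum that defines
      \<open>\<Psi> (x', y)\<close>. Convexity took care of \<open>\<psi> x' y\<close>; the level
      \<open>- N\<close> lies below each of the averaged values.\<close>
    have "ereal (- N) \<le> ereal ?P" "ereal (- N) \<le> ereal ?Q" using x' n by (simp_all add: \<Psi>e)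
    then have 2: "ereal (- N) \<le> ereal ((?P + ?Q) / 2)" by simp
    have "ereal (\<Psi> (x', y)) \<le> ereal ((?P + ?Q) / 2)" using 1 2 x' n by (subst \<Psi>e) auto
    then show "2 * \<Psi> (x', y) \<le> ?P + ?Q" by simp
  qed (use meas bound int in auto)
  have usc': "eventually (\<lambda>w. \<Psi> w < \<Psi> (x', y) + \<eta>) (nhds (x', y))"
    if x': "x' \<in> interior S" and y: "norm y < \<rho>" and \<eta>: "\<eta> > 0" for x' y \<eta>
  proof -
    let ?U = "{w \<in> \<Omega> \<times> UNIV. (\<lambda>(x, y). \<psi> x y) w < ereal (\<Psi> (x', y) + \<eta>)} \<inter> (interior S \<times> ball 0 \<rho>)"
    have xS: "x' \<in> S" using x' interior_subset by blast
    have m: "max (\<psi> x' y) (ereal (- N)) < ereal (\<Psi> (x', y) + \<eta>)"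
    proof -
      have "max (\<psi> x' y) (ereal (- N)) = ereal (\<Psi> (x', y))" using \<Psi>e[OF xS, of y] y by simp
      also have "\<dots> < ereal (\<Psi> (x', y) + \<eta>)" using \<eta> by simp
      finally show ?thesis .
    qed
    have "open ?U" by (intro open_Int open_usc_sublevel[OF open' usc] open_Times) auto
    moreover have "(x', y) \<in> ?U" using x' y m xS S\<Omega> by auto
    moreover have "\<Psi> w < \<Psi> (x', y) + \<eta>" if "w \<in> ?U" for w
    proof -
      obtain x'' y'' where w: "w = (x'', y'')" by (cases w)
      have "x'' \<in> S" "norm y'' \<le> \<rho>" using that interior_subset by (auto simp: w)
      then have "ereal (\<Psi> w) < ereal (\<Psi> (x', y) + \<eta>)" using that m by (auto simp: w \<Psi>e)
      then show ?thesis by simp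
    qed
    ultimately show ?thesis unfolding eventually_nhds by blast
  qed
  have \<rho>': "N * DIM('b) < \<rho>" by (simp add: \<rho>_def)
  have eS: "cball x (r + e) \<subseteq> S" by (simp add: S_def)
  note main = neg_log_cube_submean[OF N r(1) e(1) eS \<rho>' usc']
  have sec: "(\<lambda>y. \<Psi> (x', y)) \<in> borel_measurable borel" for x' by measurable
  show thesis
  proof (rule that[of "neg_log_cube N" "C + \<bar>ln (measure lborel (cube N :: 'b set))\<bar>"])
    fix x' assume x': "x' \<in> cball x r"
    then have xS: "x' \<in> S" using e(1) by (simp add: S_def)
    note b = exp_cube_integral_bounds[OF N sec bound, of x'] and p = abs_neg_log_cube_le[OF N sec bound, of x']
    have "(\<integral>\<^sup>+y. ereal_exp (- max (\<psi> x' y) (ereal (- N))) * indicator (cube N) y \<partial>lborel)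
      = (\<integral>\<^sup>+y. ennreal (indicator (cube N) y * exp (- \<Psi> (x', y))) \<partial>lborel)"
    proof (rule nn_integral_cong)
      fix y :: 'b
      show "ereal_exp (- max (\<psi> x' y) (ereal (- N))) * indicator (cube N) y = ennreal (indicator (cube N) y * exp (- \<Psi> (x', y)))"
      proof (cases "y \<in> cube N")
        case True
        then have "norm y \<le> \<rho>" using norm_cube_le[OF True] by (simp add: \<rho>_def)
        then have "max (\<psi> x' y) (ereal (- N)) = ereal (\<Psi> (x', y))" by (simp add: \<Psi>e[OF xS])
        then show ?thesis using True by (simp add: ereal_exp_def)
      qed simp
    qed
    also have "\<dots> = ennreal (\<integral>y. indicator (cube N) y * exp (- \<Psi> (x', y)) \<partial>lborel)"
      by (rule nn_integral_eq_integral[OF b(1)]) auto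
    finally show "ereal (neg_log_cube N x') = - ennreal_ln (\<integral>\<^sup>+y. ereal_exp (- max (\<psi> x' y) (ereal (- N))) * indicator (cube N) y \<partial>lborel)"
      using p(2) by (simp add: ennreal_ln_ennreal neg_log_cube_def)
    show "\<bar>neg_log_cube N x'\<bar> \<le> C + \<bar>ln (measure lborel (cube N :: 'b set))\<bar>"
      unfolding neg_log_cube_def by (rule p(1))
  qed (rule main; assumption)+
qed

lemma lower_section_measurable:
  fixes \<psi> :: "'a::metric_space \<Rightarrow> 'b::euclidean_space \<Rightarrow> ereal"
  assumes "open \<Omega>" "usc_on (\<Omega> \<times> UNIV) (\<lambda>(x, y). \<psi> x y)" "x \<in> \<Omega>"
  shows "\<psi> x \<in> borel_measurable borel"
proof (rule borel_measurableI_less)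
  fix c
  have "open (\<Omega> \<times> (UNIV :: 'b set))" using assms(1) by (simp add: open_Times)
  from open_usc_sublevel[OF this assms(2), of c]
  have "open (Pair x -` {w \<in> \<Omega> \<times> UNIV. (\<lambda>(x, y). \<psi> x y) w < c})"
    by (intro open_vimage continuous_intros) auto
  moreover have "Pair x -` {w \<in> \<Omega> \<times> UNIV. (\<lambda>(x, y). \<psi> x y) w < c} = {y. \<psi> x y < c}" using assms(3) by auto
  ultimately show "{y \<in> space borel. \<psi> x y < c} \<in> sets borel" by simp
qed

text \<open>Fatou's lemma: upper semicontinuity of \<open>\<psi>\<close> puts
  \<open>exp (- \<psi>)\<close> at the limit point below the lower limit along the sequence, and the
  logarithm with the minus sign reverses the resulting inequality between integrals.\<close>

lemma usc_neg_log_integral: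
  fixes \<psi> :: "'a::metric_space \<Rightarrow> 'b::euclidean_space \<Rightarrow> ereal"
  assumes \<Omega>: "open \<Omega>" and usc: "usc_on (\<Omega> \<times> UNIV) (\<lambda>(x, y). \<psi> x y)"
  shows "usc_on \<Omega> (\<lambda>x. - ennreal_ln (\<integral>\<^sup>+ y. ereal_exp (- \<psi> x y) \<partial>lborel))"
proof (rule usc_onI_sequentially[OF \<Omega>])
  fix X x c assume X: "\<And>n::nat. X n \<in> \<Omega>" and x: "x \<in> \<Omega>" and lim: "X \<longlonglongrightarrow> x"
    and ge: "\<And>n. c \<le> - ennreal_ln (\<integral>\<^sup>+ y. ereal_exp (- \<psi> (X n) y) \<partial>lborel)"
  have open': "open (\<Omega> \<times> (UNIV :: 'b set))" using \<Omega> by (simp add: open_Times)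
  have ge': "(\<integral>\<^sup>+ y. ereal_exp (- \<psi> (X n) y) \<partial>lborel) \<le> ereal_exp (- c)" for n
    using iffD1[OF ereal_le_uminus_iff ge[of n]] unfolding ennreal_ln_le_iff .
  have "(\<integral>\<^sup>+ y. ereal_exp (- \<psi> x y) \<partial>lborel) \<le> (\<integral>\<^sup>+ y. liminf (\<lambda>n. ereal_exp (- \<psi> (X n) y)) \<partial>lborel)"
  proof (rule nn_integral_mono, rule ccontr)
    fix y
    let ?L = "liminf (\<lambda>n. ereal_exp (- \<psi> (X n) y))"
    assume "\<not> ereal_exp (- \<psi> x y) \<le> ?L"
    then have "ennreal_ln ?L < - \<psi> x y" by (simp add: le_ennreal_ln_iff[symmetric] not_le)
    \<comment> \<open>A level strictly between the two sides: near \<open>(x, y)\<close> the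
      function \<open>- \<psi>\<close> exceeds \<open>t\<close>, so the lower limit cannot lie below
      \<open>ereal_exp t\<close>.\<close>
    then obtain t where t: "ennreal_ln ?L < t" "t < - \<psi> x y" using dense by blast
    have "open {w \<in> \<Omega> \<times> UNIV. (\<lambda>(x, y). \<psi> x y) w < - t}" by (rule open_usc_sublevel[OF open' usc])
    moreover have "(x, y) \<in> {w \<in> \<Omega> \<times> UNIV. (\<lambda>(x, y). \<psi> x y) w < - t}"
      using x t(2) by (simp add: ereal_less_uminus_reorder)
    moreover have "(\<lambda>n. (X n, y)) \<longlonglongrightarrow> (x, y)" by (intro tendsto_intros lim)
    ultimately have "eventually (\<lambda>n. (X n, y) \<in> {w \<in> \<Omega> \<times> UNIV. (\<lambda>(x, y). \<psi> x y) w < - t}) sequentially"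
      by (rule topological_tendstoD[rotated])
    then have "eventually (\<lambda>n. ereal_exp t \<le> ereal_exp (- \<psi> (X n) y)) sequentially"
    proof eventually_elim
      case (elim n)
      then have "\<psi> (X n) y \<le> - t" by (simp add: less_imp_le)
      from iffD1[OF ereal_le_uminus_iff this] show ?case unfolding ereal_exp_le_iff .
    qed
    then have "ereal_exp t \<le> ?L" by (rule Liminf_bounded)
    then have "t \<le> ennreal_ln ?L" by (simp add: le_ennreal_ln_iff)
    with t(1) show False using leD by blast
  qed
  also have "\<dots> \<le> liminf (\<lambda>n. \<integral>\<^sup>+ y. ereal_exp (- \<psi> (X n) y) \<partial>lborel)"
  proof (rule nn_integral_liminf)
    fix n
    show "(\<lambda>y. ereal_exp (- \<psi> (X n) y)) \<in> borel_measurable lborel"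
      using lower_section_measurable[OF \<Omega> usc X[of n]] by measurable
  qed
  also have "\<dots> \<le> ereal_exp (- c)"
    by (rule order_trans[OF Liminf_le_Limsup[OF sequentially_bot] Limsup_bounded]) (simp add: ge')
  finally show "c \<le> - ennreal_ln (\<integral>\<^sup>+ y. ereal_exp (- \<psi> x y) \<partial>lborel)"
    unfolding ereal_le_uminus_iff[of c] ennreal_ln_le_iff .
qed

text \<open>The truncated integrals over growing cubes increase, so their negative logarithms
  \<open>H n\<close> decrease to the function in question. At the centre it is at most
  \<open>H n x\<close>, hence at most the ball average of \<open>H n\<close>; these averages
  converge by \<open>ereal_integral_decseq\<close>.\<close>

theorem subharmonic_neg_log_integral:
  fixes \<psi> :: "'a::euclidean_space \<Rightarrow> 'b::euclidean_space \<Rightarrow> ereal"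
  assumes \<Omega>: "open \<Omega>" and ninf: "\<And>x y. x \<in> \<Omega> \<Longrightarrow> \<psi> x y \<noteq> \<infinity>"
    and usc: "usc_on (\<Omega> \<times> UNIV) (\<lambda>(x, y). \<psi> x y)" and conv: "\<And>x. x \<in> \<Omega> \<Longrightarrow> ereal_convex (\<psi> x)"
    and sub: "\<And>A b. linear A \<Longrightarrow> subharmonic_on \<Omega> (\<lambda>x. \<psi> x (A x + b))"
  shows "subharmonic_on \<Omega> (\<lambda>x. - ennreal_ln (\<integral>\<^sup>+ y. ereal_exp (- \<psi> x y) \<partial>lborel))"
  unfolding subharmonic_on_def
proof (intro conjI ballI allI impI)
  let ?G = "\<lambda>x. - ennreal_ln (\<integral>\<^sup>+ y. ereal_exp (- \<psi> x y) \<partial>lborel)"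
  have me: "(\<lambda>y. ereal_exp (- \<psi> x y)) \<in> borel_measurable borel" if "x \<in> \<Omega>" for x
    using lower_section_measurable[OF \<Omega> usc that] by measurable
  \<comment> \<open>The value \<infinity> would make the integral vanish and \<open>\<psi> x\<close>
    infinite almost everywhere, whereas \<open>lborel\<close> is not the zero measure.\<close>
  show "?G x \<noteq> \<infinity>" if x: "x \<in> \<Omega>" for x
  proof
    assume "?G x = \<infinity>"
    then have "ennreal_ln (\<integral>\<^sup>+ y. ereal_exp (- \<psi> x y) \<partial>lborel) \<le> -\<infinity>"
      by (simp add: ereal_uminus_eq_reorder)
    moreover have "ereal_exp (-\<infinity>) = 0" by (simp add: ereal_exp_def)
    ultimately have "(\<integral>\<^sup>+ y. ereal_exp (- \<psi> x y) \<partial>lborel) = 0" unfolding ennreal_ln_le_iff by simp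
    then have "AE y in lborel. ereal_exp (- \<psi> x y) = 0"
      using me[OF x] by (subst (asm) nn_integral_0_iff_AE) auto
    then have "AE y in (lborel :: 'b measure). False"
    proof eventually_elim
      case (elim y)
      then have "- \<psi> x y \<le> -\<infinity>" using ereal_exp_le_iff[of "- \<psi> x y" "-\<infinity>"] by (simp add: ereal_exp_def)
      then show False using ninf[OF x, of y] by (simp add: ereal_uminus_eq_reorder)
    qed
    then show False by (simp add: eventually_False ae_filter_eq_bot_iff)
  qed
  show usc_G: "usc_on \<Omega> ?G" by (rule usc_neg_log_integral[OF \<Omega> usc])
  fix x r assume "0 < r \<and> cball x r \<subseteq> \<Omega>"
  then have r: "r > 0" "cball x r \<subseteq> \<Omega>" by auto
  let ?M = "restrict_space lborel (cball x r)" and ?V = "measure lborel (cball x r)"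
  have V: "?V > 0" using content_cball_pos[OF r(1)] by simp
  \<comment> \<open>One index controls both truncations. \<open>Suc n\<close> instead of
    \<open>n\<close> makes the cube size positive, as \<open>submean_level\<close> demands.\<close>
  define a where "a n x' = (\<integral>\<^sup>+y. ereal_exp (- max (\<psi> x' y) (ereal (- real (Suc n)))) * indicator (cube (real (Suc n))) y \<partial>lborel)" for n x'
  define H where "H n x' = - ennreal_ln (a n x')" for n x'
  define good where "good n F \<longleftrightarrow> (\<forall>x'\<in>cball x r. ereal (F x') = H n x') \<and> (\<exists>K. \<forall>x'\<in>cball x r. \<bar>F x'\<bar> \<le> K) \<and>
    integrable lborel (\<lambda>x'. indicator (cball x r) x' * F x') \<and>
    ?V * F x \<le> (\<integral>x'. indicator (cball x r) x' * F x' \<partial>lborel)" for n and F :: "'a \<Rightarrow> real"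
  have "\<forall>n. \<exists>F. good n F"
  proof
    fix n
    show "\<exists>F. good n F"
    proof (rule submean_level[OF \<Omega> ninf usc conv sub r])
      show "real (Suc n) > 0" by simp
      fix F K
      assume "\<And>x'. x' \<in> cball x r \<Longrightarrow> ereal (F x') = - ennreal_ln
          (\<integral>\<^sup>+y. ereal_exp (- max (\<psi> x' y) (ereal (- real (Suc n)))) * indicator (cube (real (Suc n))) y \<partial>lborel)"
        and K: "\<And>x'. x' \<in> cball x r \<Longrightarrow> \<bar>F x'\<bar> \<le> K" and "integrable lborel (\<lambda>x'. indicator (cball x r) x' * F x')"
        "?V * F x \<le> (\<integral>x'. indicator (cball x r) x' * F x' \<partial>lborel)"
      then have "good n F" unfolding good_def H_def a_def by (intro conjI ballI exI[of _ K])
      then show "\<exists>F. good n F" by (intro exI[of _ F])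
    qed
  qed
  from choice[OF this] obtain F where good: "\<And>n. good n (F n)" by blast
  have F: "ereal (F n x') = H n x'" if "x' \<in> cball x r" for n x' using good[of n] that by (simp add: good_def)
  have FK: "\<exists>K. \<forall>x'\<in>cball x r. \<bar>F n x'\<bar> \<le> K" for n using good[of n] by (simp add: good_def)
  then obtain K where K: "\<And>x'. x' \<in> cball x r \<Longrightarrow> \<bar>F 0 x'\<bar> \<le> K" by blast
  have Fint: "integrable lborel (\<lambda>x'. indicator (cball x r) x' * F n x')" for n using good[of n] by (simp add: good_def)
  have Fsub: "?V * F n x \<le> (\<integral>x'. indicator (cball x r) x' * F n x' \<partial>lborel)" for n using good[of n] by (simp add: good_def)
  have inc: "ereal_exp (- max (\<psi> x' y) (ereal (- real (Suc n)))) * indicator (cube (real (Suc n))) y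
     \<le> ereal_exp (- max (\<psi> x' y) (ereal (- real (Suc (Suc n))))) * indicator (cube (real (Suc (Suc n)))) y" for n x' y
  proof (rule mult_mono)
    have "max (\<psi> x' y) (ereal (- real (Suc (Suc n)))) \<le> max (\<psi> x' y) (ereal (- real (Suc n)))"
      by (rule max.mono) auto
    then show "ereal_exp (- max (\<psi> x' y) (ereal (- real (Suc n)))) \<le> ereal_exp (- max (\<psi> x' y) (ereal (- real (Suc (Suc n)))))"
      by (simp only: ereal_exp_le_iff ereal_minus_le_minus)
    have "cube (real (Suc n)) \<subseteq> (cube (real (Suc (Suc n))) :: 'b set)" by (force simp: cube_def)
    then show "indicator (cube (real (Suc n))) y \<le> (indicator (cube (real (Suc (Suc n)))) y :: ennreal)"
      by (auto simp: indicator_def)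
  qed auto
  have sup: "(SUP n. ereal_exp (- max (\<psi> x' y) (ereal (- real (Suc n)))) * indicator (cube (real (Suc n))) y) = ereal_exp (- \<psi> x' y)" for x' y
  proof (rule antisym)
    show "(SUP n. ereal_exp (- max (\<psi> x' y) (ereal (- real (Suc n)))) * indicator (cube (real (Suc n))) y) \<le> ereal_exp (- \<psi> x' y)"
    proof (rule SUP_least)
      fix n
      have "ereal_exp (- max (\<psi> x' y) (ereal (- real (Suc n)))) \<le> ereal_exp (- \<psi> x' y)"
        by (simp only: ereal_exp_le_iff ereal_minus_le_minus max.cobounded1)
      then show "ereal_exp (- max (\<psi> x' y) (ereal (- real (Suc n)))) * indicator (cube (real (Suc n))) y \<le> ereal_exp (- \<psi> x' y)"
        by (auto simp: indicator_def)
    qed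
    show "ereal_exp (- \<psi> x' y) \<le> (SUP n. ereal_exp (- max (\<psi> x' y) (ereal (- real (Suc n)))) * indicator (cube (real (Suc n))) y)" (is "_ \<le> ?S")
      unfolding le_ennreal_ln_iff[symmetric]
    proof (rule ccontr)
      assume "\<not> - \<psi> x' y \<le> ennreal_ln ?S"
      then obtain t where t: "ennreal_ln ?S < ereal t" "ereal t < - \<psi> x' y" using ereal_dense2[of "ennreal_ln ?S" "- \<psi> x' y"] by (auto simp: not_le)
      \<comment> \<open>For such \<open>n\<close> the point \<open>y\<close> lies in the cube and
        the truncation level is below \<open>- t\<close>, so the truncated function is still at most
        \<open>- t\<close>.\<close>
      obtain n where n: "real n > max \<bar>t\<bar> (norm y)" using reals_Archimedean2 by blast
      have "y \<in> cube (real (Suc n))"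
        using n Basis_le_norm[of _ y] by (force simp: cube_def)
      then have "ereal_exp (- max (\<psi> x' y) (ereal (- real (Suc n)))) \<le> ?S"
        by (intro SUP_upper2[of n]) auto
      moreover have "max (\<psi> x' y) (ereal (- real (Suc n))) \<le> - ereal t"
      proof (rule max.boundedI)
        show "\<psi> x' y \<le> - ereal t" by (rule iffD1[OF ereal_le_uminus_iff less_imp_le[OF t(2)]])
        have "\<bar>t\<bar> < real n" using n by simp
        then have "- real (Suc n) \<le> - t" by linarith
        then show "ereal (- real (Suc n)) \<le> - ereal t" by simp
      qed
      then have "ereal t \<le> - max (\<psi> x' y) (ereal (- real (Suc n)))" by (rule iffD1[OF ereal_le_uminus_iff])
      then have "ereal_exp (ereal t) \<le> ereal_exp (- max (\<psi> x' y) (ereal (- real (Suc n))))" by (simp only: ereal_exp_le_iff)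
      ultimately have "ereal_exp (ereal t) \<le> ?S" by (rule order_trans[rotated])
      then have "ereal t \<le> ennreal_ln ?S" by (simp only: le_ennreal_ln_iff)
      with t(1) show False using leD by blast
    qed
  qed
  have a_inc: "a n x' \<le> a (Suc n) x'" for n x' unfolding a_def by (intro nn_integral_mono inc)
  have a_sup: "(SUP n. a n x') = (\<integral>\<^sup>+ y. ereal_exp (- \<psi> x' y) \<partial>lborel)" if x': "x' \<in> \<Omega>" for x'
    unfolding a_def sup[symmetric]
  proof (rule nn_integral_monotone_convergence_SUP[symmetric])
    have [measurable]: "\<psi> x' \<in> borel_measurable borel" by (rule lower_section_measurable[OF \<Omega> usc x'])
    have [measurable]: "cube R \<in> sets (borel :: 'b measure)" for R by (simp add: cube_eq_cbox)
    show "(\<lambda>y. ereal_exp (- max (\<psi> x' y) (ereal (- real (Suc n)))) * indicator (cube (real (Suc n))) y) \<in> borel_measurable lborel" for n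
      by measurable
  qed (intro incseq_SucI le_funI inc)
  have H_dec: "H (Suc n) x' \<le> H n x'" for n x'
    unfolding H_def by (simp add: ennreal_ln_mono[OF a_inc])
  have H_lim: "(\<lambda>n. H n x') \<longlonglongrightarrow> ?G x'" if x': "x' \<in> \<Omega>" for x'
  proof -
    have "(\<lambda>n. ennreal_ln (a n x')) \<longlonglongrightarrow> (SUP n. ennreal_ln (a n x'))"
      by (intro LIMSEQ_SUP incseq_SucI ennreal_ln_mono a_inc)
    then have "(\<lambda>n. ennreal_ln (a n x')) \<longlonglongrightarrow> ennreal_ln (\<integral>\<^sup>+ y. ereal_exp (- \<psi> x' y) \<partial>lborel)"
      unfolding ennreal_ln_SUP[symmetric] a_sup[OF x'] .
    then show ?thesis unfolding H_def by (rule tendsto_uminus_ereal)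
  qed
  have HI: "ereal_integral ?M (H n) = ereal (\<integral>x'. indicator (cball x r) x' * F n x' \<partial>lborel)" for n
    by (rule ereal_integral_real_restrict[OF _ Fint]) (simp_all add: F)
  have "(\<lambda>n. ereal_integral ?M (H n)) \<longlonglongrightarrow> ereal_integral ?M ?G"
  proof (rule ereal_integral_decseq)
    show "H n \<in> borel_measurable ?M" for n
    proof -
      have "F n \<in> borel_measurable ?M" using Fint[of n]
        by (subst borel_measurable_restrict_space_iff) (auto dest: borel_measurable_integrable)
      then have "(\<lambda>x'. ereal (F n x')) \<in> borel_measurable ?M" by measurable
      then show ?thesis by (rule measurable_cong[THEN iffD1, rotated]) (simp add: F space_restrict_space)
    qed
    show "?G \<in> borel_measurable ?M" by (rule usc_measurable[OF \<Omega> usc_G _ r(2)]) simp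
    show "(\<lambda>n. H n x') \<longlonglongrightarrow> ?G x'" if "x' \<in> space ?M" for x'
      using that r(2) by (intro H_lim) (auto simp: space_restrict_space)
    show "H 0 x' \<le> ereal K" if "x' \<in> space ?M" for x'
    proof -
      have x': "x' \<in> cball x r" using that by (simp add: space_restrict_space)
      show ?thesis using K[OF x'] unfolding F[OF x', of 0, symmetric] by simp
    qed
    show "finite_measure ?M"
      by (rule finite_measureI)
        (use emeasure_lborel_cball_finite[of x r] in \<open>auto simp: emeasure_restrict_space space_restrict_space\<close>)
  qed (rule H_dec)
  then have lim: "(\<lambda>n. ereal (1 / ?V) * ereal_integral ?M (H n)) \<longlonglongrightarrow> ereal (1 / ?V) * ereal_integral ?M ?G"
    by (intro tendsto_cmult_ereal) auto
  have le: "?G x \<le> ereal (1 / ?V) * ereal_integral ?M (H n)" for n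
  proof -
    have xB: "x \<in> cball x r" "x \<in> \<Omega>" using r by auto
    have "decseq (\<lambda>n. H n x)" by (intro decseq_SucI H_dec)
    then have "?G x \<le> H n x" using H_lim[OF xB(2)] by (rule decseq_ge)
    also have "\<dots> = ereal (F n x)" by (simp add: F[OF xB(1)])
    also have "\<dots> \<le> ereal (1 / ?V * (\<integral>x'. indicator (cball x r) x' * F n x' \<partial>lborel))"
      using Fsub[of n] V by (simp add: field_simps)
    finally show ?thesis by (simp add: HI)
  qed
  show "?G x \<le> ereal (1 / ?V) * ereal_integral ?M ?G"
    by (rule LIMSEQ_le_const[OF lim]) (intro exI allI impI le)
qed

section \<open>Harmonic interpolation\<close>

text \<open>The sub-mean inequality is applied to \<open>u\<close> and to
  \<open>- u\<close>.\<close>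

lemma (in pure_second_partials) mean_value_of_laplacian_zero:
  assumes sub: "cball x R \<subseteq> S" and R: "R > 0" and z: "\<And>y. y \<in> cball x R \<Longrightarrow> (\<Sum>b\<in>Basis. h b y) = 0"
  shows "measure lborel (cball x R) * u x = (\<integral>y. indicator (cball x R) y * u y \<partial>lborel)"
proof (rule antisym)
  show "measure lborel (cball x R) * u x \<le> (\<integral>y. indicator (cball x R) y * u y \<partial>lborel)"
    by (rule submean_of_laplacian_nonneg[OF sub R]) (simp add: z)
  interpret neg: pure_second_partials S "\<lambda>x. - u x" "\<lambda>b x. - g b x" "\<lambda>b x. - h b x"
  proof
    fix y v assume y: "y \<in> S"
    show "((\<lambda>s. - u (y + s *\<^sub>R v)) has_real_derivative (\<Sum>b\<in>Basis. (v \<bullet> b) * - g b y)) (at 0)"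
      using DERIV_minus[OF du[OF y, of v]] by (simp add: sum_negf)
  next
    fix y b :: 'a assume "y \<in> S" "b \<in> Basis"
    from DERIV_minus[OF dg[OF this]]
    show "((\<lambda>s. - g b (y + s *\<^sub>R b)) has_real_derivative - h b y) (at 0)" .
  qed (auto intro!: continuous_intros cu cg ch)
  have "measure lborel (cball x R) * - u x \<le> (\<integral>y. indicator (cball x R) y * - u y \<partial>lborel)"
    by (rule neg.submean_of_laplacian_nonneg[OF sub R]) (simp add: sum_negf z)
  then show "(\<integral>y. indicator (cball x R) y * u y \<partial>lborel) \<le> measure lborel (cball x R) * u x" by simp
qed

lemma affine_mean_value:
  fixes l :: "'a::euclidean_space \<Rightarrow> real"
  assumes l: "linear l" and R: "R > 0"
  shows "measure lborel (cball x R) * (l x + c) = (\<integral>y. indicator (cball x R) y * (l y + c) \<partial>lborel)"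
proof -
  have cl: "continuous_on UNIV l" using l by (simp add: linear_continuous_on linear_conv_bounded_linear)
  interpret pure_second_partials UNIV "\<lambda>x. l x + c" "\<lambda>b _. l b" "\<lambda>_ _. 0"
  proof
    fix y v :: 'a
    have "l v = l (\<Sum>b\<in>Basis. (v \<bullet> b) *\<^sub>R b)" by (simp add: euclidean_representation)
    also have "\<dots> = (\<Sum>b\<in>Basis. (v \<bullet> b) * l b)" by (simp add: linear_sum[OF l] linear_scale[OF l])
    finally show "((\<lambda>s. l (y + s *\<^sub>R v) + c) has_real_derivative (\<Sum>b\<in>Basis. (v \<bullet> b) * l b)) (at 0)"
      unfolding linear_add[OF l] linear_scale[OF l] by (auto intro!: derivative_eq_intros)
  qed (auto intro!: continuous_intros cl)
  show ?thesis by (rule mean_value_of_laplacian_zero[OF subset_UNIV R]) simp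
qed

text \<open>A bridge between two notions of derivative: \<open>Ck_on\<close> speaks of total
  derivatives and \<open>laplacian\<close> of iterated one-dimensional ones, while the ball means
  work with derivatives along lines.\<close>

lemma harmonic_on_pure_second_partials:
  fixes h :: "'a::euclidean_space \<Rightarrow> real"
  assumes \<Omega>: "open \<Omega>" and h: "harmonic_on \<Omega> h"
  shows "pure_second_partials \<Omega> h (\<lambda>b x. frechet_derivative h (at x) b)
      (\<lambda>b x. frechet_derivative (\<lambda>x. frechet_derivative h (at x) b) (at x) b)"
    and "x \<in> \<Omega> \<Longrightarrow> (\<Sum>b\<in>Basis. frechet_derivative (\<lambda>x. frechet_derivative h (at x) b) (at x) b) = 0"
proof -
  define g where "g b x = frechet_derivative h (at x) b" for b x
  define k where "k b x = frechet_derivative (g b) (at x) b" for b x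
  have Ck: "h differentiable_on \<Omega>" "\<And>b. b \<in> Basis \<Longrightarrow> g b differentiable_on \<Omega>"
    "\<And>b. b \<in> Basis \<Longrightarrow> continuous_on \<Omega> (k b)"
    using h by (auto simp: harmonic_on_def numeral_2_eq_2 g_def[abs_def] k_def[abs_def])
  have line: "((\<lambda>s. f (x + s *\<^sub>R v)) has_real_derivative frechet_derivative f (at x) v) (at 0)"
    if f: "f differentiable_on \<Omega>" and x: "x \<in> \<Omega>" for f :: "'a \<Rightarrow> real" and x v
  proof -
    have "f differentiable (at x)" using f x \<Omega> by (simp add: differentiable_on_eq_differentiable_at)
    then have "(f has_derivative frechet_derivative f (at x)) (at (x + 0 *\<^sub>R v))"
      by (simp add: frechet_derivative_works)
    moreover have "((\<lambda>s. x + s *\<^sub>R v) has_derivative (\<lambda>s. s *\<^sub>R v)) (at 0)"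
      by (auto intro!: derivative_eq_intros)
    ultimately have "((\<lambda>s. f (x + s *\<^sub>R v)) has_derivative (\<lambda>s. frechet_derivative f (at x) (s *\<^sub>R v))) (at 0)"
      using diff_chain_at[of "\<lambda>s. x + s *\<^sub>R v" "\<lambda>s. s *\<^sub>R v" 0 f] by (simp add: o_def)
    moreover have "linear (frechet_derivative f (at x))"
      using \<open>f differentiable (at x)\<close> by (rule linear_frechet_derivative)
    ultimately show ?thesis
      by (simp add: linear_scale has_field_derivative_def mult.commute[of "frechet_derivative f (at x) v"] mult_commute_abs)
  qed
  have lin: "frechet_derivative h (at x) v = (\<Sum>b\<in>Basis. (v \<bullet> b) * g b x)" if x: "x \<in> \<Omega>" for x v
  proof -
    have "h differentiable (at x)" using Ck(1) x \<Omega> by (simp add: differentiable_on_eq_differentiable_at)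
    then have l: "linear (frechet_derivative h (at x))" by (rule linear_frechet_derivative)
    have "frechet_derivative h (at x) v = frechet_derivative h (at x) (\<Sum>b\<in>Basis. (v \<bullet> b) *\<^sub>R b)"
      by (simp add: euclidean_representation)
    also have "\<dots> = (\<Sum>b\<in>Basis. (v \<bullet> b) * g b x)" by (simp add: linear_sum[OF l] linear_scale[OF l] g_def)
    finally show ?thesis .
  qed
  have "pure_second_partials \<Omega> h g k"
  proof
    show "((\<lambda>s. h (y + s *\<^sub>R v)) has_real_derivative (\<Sum>b\<in>Basis. (v \<bullet> b) * g b y)) (at 0)" if "y \<in> \<Omega>" for y v
      using line[OF Ck(1) that] lin[OF that] by simp
    show "((\<lambda>s. g b (y + s *\<^sub>R b)) has_real_derivative k b y) (at 0)" if "y \<in> \<Omega>" "b \<in> Basis" for y b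
      unfolding k_def by (rule line[OF Ck(2)[OF that(2)] that(1)])
  qed (use Ck differentiable_imp_continuous_on in auto)
  then show "pure_second_partials \<Omega> h (\<lambda>b x. frechet_derivative h (at x) b)
      (\<lambda>b x. frechet_derivative (\<lambda>x. frechet_derivative h (at x) b) (at x) b)"
    by (simp add: g_def[abs_def] k_def[abs_def])
  assume x: "x \<in> \<Omega>"
  have "(deriv ^^ 2) (\<lambda>t. h (x + t *\<^sub>R b)) 0 = k b x" if b: "b \<in> Basis" for b
  proof -
    have "open ((\<lambda>t. x + t *\<^sub>R b) -` \<Omega>)" using \<Omega> by (intro open_vimage continuous_intros)
    moreover have "0 \<in> (\<lambda>t. x + t *\<^sub>R b) -` \<Omega>" using x by simp
    ultimately have "eventually (\<lambda>t. t \<in> (\<lambda>t. x + t *\<^sub>R b) -` \<Omega>) (nhds 0)" by (rule eventually_nhds_in_open)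
    \<comment> \<open>The second derivative at 0 depends on the first one near 0 only, and there the
      line stays inside the open set \<open>\<Omega>\<close>.\<close>
    then have "eventually (\<lambda>t. deriv (\<lambda>t. h (x + t *\<^sub>R b)) t = g b (x + t *\<^sub>R b)) (nhds 0)"
    proof eventually_elim
      case (elim t)
      have "((\<lambda>s. h ((x + t *\<^sub>R b) + (s + - t) *\<^sub>R b)) has_real_derivative g b (x + t *\<^sub>R b)) (at t)"
        using DERIV_shift[of "\<lambda>s. h ((x + t *\<^sub>R b) + s *\<^sub>R b)" "g b (x + t *\<^sub>R b)" t "-t"]
          line[OF Ck(1), of "x + t *\<^sub>R b" b] elim by (simp add: g_def)
      then show ?case by (intro DERIV_imp_deriv) (simp add: algebra_simps)
    qed
    then have "deriv (deriv (\<lambda>t. h (x + t *\<^sub>R b))) 0 = deriv (\<lambda>t. g b (x + t *\<^sub>R b)) 0"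
      by (rule deriv_cong_ev) simp
    also have "\<dots> = k b x" unfolding k_def by (rule DERIV_imp_deriv[OF line[OF Ck(2)[OF b] x]])
    finally show ?thesis by (simp add: numeral_2_eq_2)
  qed
  then have "laplacian h x = (\<Sum>b\<in>Basis. k b x)" by (simp add: laplacian_def)
  then show "(\<Sum>b\<in>Basis. frechet_derivative (\<lambda>x. frechet_derivative h (at x) b) (at x) b) = 0"
    using h x by (simp add: harmonic_on_def k_def g_def[abs_def])
qed

lemma harmonic_mean_value:
  fixes h :: "'a::euclidean_space \<Rightarrow> real"
  assumes "open \<Omega>" "harmonic_on \<Omega> h" "cball x R \<subseteq> \<Omega>" "R > 0"
  shows "measure lborel (cball x R) * h x = (\<integral>y. indicator (cball x R) y * h y \<partial>lborel)"
proof -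
  note P = harmonic_on_pure_second_partials[OF assms(1,2)]
  show ?thesis
    by (rule pure_second_partials.mean_value_of_laplacian_zero[OF P(1) assms(3,4)]) (use P(2) assms(3) in auto)
qed

lemma harmonic_on_continuous:
  assumes "open \<Omega>" "harmonic_on \<Omega> h" shows "continuous_on \<Omega> h"
  using assms differentiable_imp_continuous_on by (auto simp: harmonic_on_def numeral_2_eq_2)

text \<open>Negation exchanges positive and negative parts. Finiteness of the negative part rules
  out \<infinity> - \<infinity>, for which the exchange would not amount to a change of
  sign.\<close>

lemma ereal_integral_uminus:
  assumes "(\<integral>\<^sup>+x. e2ennreal (- f x) \<partial>M) < \<infinity>"
  shows "ereal_integral M (\<lambda>x. - f x) = - ereal_integral M f"
proof -
  have "enn2ereal b - enn2ereal a = - (enn2ereal a - enn2ereal b)" if "b < \<infinity>" for a b :: ennreal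
    using that by (cases a; cases b) (auto simp: enn2ereal_ennreal)
  from this[OF assms] show ?thesis by (simp add: ereal_integral_def)
qed

section \<open>Legendre transforms as limits of finite maxima\<close>

fun max_affine :: "(nat \<Rightarrow> 'b::real_inner) \<Rightarrow> ('b \<Rightarrow> real) \<Rightarrow> nat \<Rightarrow> 'b \<Rightarrow> real"
  where "max_affine d f 0 u = d 0 \<bullet> u - f (d 0)"
  | "max_affine d f (Suc k) u = max (max_affine d f k u) (d (Suc k) \<bullet> u - f (d (Suc k)))"

lemma max_affine_mono: "max_affine d f k u \<le> max_affine d f (Suc k) u"
  by simp

lemma affine_lipschitz: "\<bar>(y \<bullet> u - c) - (y \<bullet> u' - c)\<bar> \<le> norm y * norm (u - u')"
  using Cauchy_Schwarz_ineq2[of y "u - u'"] by (simp add: inner_diff_right)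

text \<open>The slopes \<open>d j\<close> alone determine the constant. Its independence of
  \<open>f\<close> is what makes later estimates uniform over the boundary.\<close>

lemma max_affine_lipschitz:
  "\<exists>C\<ge>0. \<forall>f u u'. \<bar>max_affine d f k u - max_affine d f k u'\<bar> \<le> C * norm (u - u')"
proof (induction k)
  case 0
  show ?case using affine_lipschitz by (intro exI[of _ "norm (d 0)"]) auto
next
  case (Suc k)
  then obtain C where C: "C \<ge> 0" "\<And>f u u'. \<bar>max_affine d f k u - max_affine d f k u'\<bar> \<le> C * norm (u - u')" by blast
  let ?C = "max C (norm (d (Suc k)))"
  have "\<bar>max_affine d f (Suc k) u - max_affine d f (Suc k) u'\<bar> \<le> ?C * norm (u - u')" for f u u'
  proof -
    have "\<bar>max a b - max a' b'\<bar> \<le> B" if "\<bar>a - a'\<bar> \<le> B" "\<bar>b - b'\<bar> \<le> B" for a b a' b' B :: real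
      using that by (auto simp: max_def abs_le_iff)
    moreover have "\<bar>max_affine d f k u - max_affine d f k u'\<bar> \<le> ?C * norm (u - u')"
      by (rule order_trans[OF C(2)]) (simp add: mult_right_mono)
    moreover have "\<bar>(d (Suc k) \<bullet> u - f (d (Suc k))) - (d (Suc k) \<bullet> u' - f (d (Suc k)))\<bar> \<le> ?C * norm (u - u')"
      by (rule order_trans[OF affine_lipschitz]) (simp add: mult_right_mono)
    ultimately show ?thesis by simp
  qed
  then show ?case using C(1) by (intro exI[of _ ?C]) auto
qed

lemma max_affine_continuous_param:
  assumes "\<And>y. continuous_on T (\<lambda>\<tau>. \<phi> \<tau> y)"
  shows "continuous_on T (\<lambda>\<tau>. max_affine d (\<phi> \<tau>) k u)"
  by (induction k) (auto intro!: continuous_intros assms)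

lemma max_affine_ge: "j \<le> k \<Longrightarrow> d j \<bullet> u - f (d j) \<le> max_affine d f k u"
  by (induction k) (auto simp: le_Suc_eq le_max_iff_disj)

lemma affine_le_legendre: "ereal (y \<bullet> u - f y) \<le> legendre (\<lambda>y. ereal (f y)) u"
  unfolding legendre_def by (rule SUP_upper2[of y]) auto

lemma max_affine_le_legendre: "ereal (max_affine d f k u) \<le> legendre (\<lambda>y. ereal (f y)) u"
proof (induction k)
  case 0
  show ?case using affine_le_legendre[of "d 0" u f] by simp
next
  case (Suc k)
  then show ?case using affine_le_legendre[of "d (Suc k)" u f] by (simp add: max_def)
qed

text \<open>Any level below the supremum is exceeded on a nonempty open set, by continuity of
  \<open>f\<close>, and a dense sequence meets that set.\<close>

lemma max_affine_tendsto_legendre: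
  fixes f :: "'b::euclidean_space \<Rightarrow> real"
  assumes f: "continuous_on UNIV f" and dense: "\<And>X. open X \<Longrightarrow> X \<noteq> {} \<Longrightarrow> \<exists>n. d n \<in> X"
  shows "(\<lambda>k. ereal (max_affine d f k u)) \<longlonglongrightarrow> legendre (\<lambda>y. ereal (f y)) u"
proof -
  have "legendre (\<lambda>y. ereal (f y)) u = (SUP k. ereal (max_affine d f k u))"
  proof (rule antisym)
    show "legendre (\<lambda>y. ereal (f y)) u \<le> (SUP k. ereal (max_affine d f k u))"
      unfolding legendre_def
    proof (rule SUP_least, rule ccontr)
      fix y
      let ?S = "SUP k. ereal (max_affine d f k u)"
      assume "\<not> ereal (y \<bullet> u) - ereal (f y) \<le> ?S"
      then have lt: "?S < ereal (y \<bullet> u - f y)" by simp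
      obtain c where c: "?S < ereal c" "c < y \<bullet> u - f y" using ereal_dense2[OF lt] by auto
      have "open {z. c < z \<bullet> u - f z}" by (intro open_Collect_less continuous_intros f)
      then obtain n where "d n \<in> {z. c < z \<bullet> u - f z}" using dense[of "{z. c < z \<bullet> u - f z}"] c(2) by blast
      then have "ereal c \<le> ereal (max_affine d f n u)" using max_affine_ge[of n n d u f] by simp
      also have "\<dots> \<le> ?S" by (rule SUP_upper) simp
      finally show False using c(1) leD by blast
    qed
  qed (auto intro!: SUP_least max_affine_le_legendre)
  moreover have "(\<lambda>k. ereal (max_affine d f k u)) \<longlonglongrightarrow> (SUP k. ereal (max_affine d f k u))"
    by (intro LIMSEQ_SUP incseq_SucI) (simp only: ereal_less_eq max_affine_mono)
  ultimately show ?thesis by simp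
qed

section \<open>The mean Legendre transform and the interpolation as its conjugate\<close>

locale interpolation_data =
  fixes \<Omega> :: "'a::euclidean_space set" and \<mu> :: "'a \<Rightarrow> 'a measure" and \<phi> :: "'a \<Rightarrow> 'b::euclidean_space \<Rightarrow> real"
    and d :: "nat \<Rightarrow> 'b"
  assumes open_domain: "open \<Omega>" and bounded_domain: "bounded \<Omega>"
    and harmonic_measure: "harmonic_measure \<Omega> \<mu>"
    and cont: "continuous_on (frontier \<Omega> \<times> UNIV) (\<lambda>(\<tau>, y). \<phi> \<tau> y)"
    and dense: "\<And>X. open X \<Longrightarrow> X \<noteq> {} \<Longrightarrow> \<exists>n. d n \<in> X"
begin

definition boundary_transform :: "'a \<Rightarrow> 'b \<Rightarrow> ereal"
  where "boundary_transform \<tau> u = legendre (\<lambda>y. ereal (\<phi> \<tau> y)) u"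

definition mean_transform :: "'a \<Rightarrow> 'b \<Rightarrow> ereal"
  where "mean_transform x u = ereal_integral (\<mu> x) (\<lambda>\<tau>. boundary_transform \<tau> u)"

text \<open>Unlike the full transform, a finite maximum is continuous in the boundary point, so its
  integral against the harmonic measure is a harmonic function of \<open>x\<close>.\<close>

definition approx_transform :: "nat \<Rightarrow> 'b \<Rightarrow> 'a \<Rightarrow> real"
  where "approx_transform k u x = (\<integral>\<tau>. max_affine d (\<phi> \<tau>) k u \<partial>\<mu> x)"

lemma harmonic_interpolation_eq: "harmonic_interpolation \<mu> \<phi> x y = (SUP u. ereal (u \<bullet> y) - mean_transform x u)"
  unfolding harmonic_interpolation_def mean_transform_def boundary_transform_def
  by (subst legendre_def) (rule refl)

lemma compact_boundary: "compact (frontier \<Omega>)"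
  using bounded_domain by (simp add: compact_frontier_bounded)

lemma measure_props:
  assumes "x \<in> \<Omega>"
  shows "prob_space (\<mu> x)" "sets (\<mu> x) = sets (restrict_space borel (frontier \<Omega>))" "space (\<mu> x) = frontier \<Omega>"
  using assms harmonic_measure sets_eq_imp_space_eq[of "\<mu> x" "restrict_space borel (frontier \<Omega>)"]
  by (auto simp: harmonic_measure_def space_restrict_space)

lemma continuous_measurable:
  assumes "x \<in> \<Omega>" "continuous_on (frontier \<Omega>) g" shows "(g :: 'a \<Rightarrow> real) \<in> borel_measurable (\<mu> x)"
  using borel_measurable_continuous_on_restrict[OF assms(2)] measurable_cong_sets[OF measure_props(2)[OF assms(1)] refl] by blast

lemma continuous_integrable:
  assumes "x \<in> \<Omega>" "continuous_on (frontier \<Omega>) g" shows "integrable (\<mu> x) (g :: 'a \<Rightarrow> real)"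
proof -
  interpret prob_space "\<mu> x" by (rule measure_props[OF assms(1)])
  obtain C where C: "\<And>\<tau>. \<tau> \<in> frontier \<Omega> \<Longrightarrow> \<bar>g \<tau>\<bar> \<le> C"
    using compact_abs_bound[OF compact_boundary assms(2)] by blast
  show ?thesis
    by (rule integrable_const_bound[of _ C])
       (use C measure_props(3)[OF assms(1)] continuous_measurable[OF assms] in auto)
qed

lemma section_continuous: "continuous_on (frontier \<Omega>) (\<lambda>\<tau>. \<phi> \<tau> y)"
proof -
  have "continuous_on (frontier \<Omega>) (\<lambda>\<tau>. (\<lambda>(\<tau>, y). \<phi> \<tau> y) (\<tau>, y))"
    by (rule continuous_on_compose2[OF cont]) (auto intro!: continuous_intros)
  then show ?thesis by simp
qed

lemma section_continuous': "\<tau> \<in> frontier \<Omega> \<Longrightarrow> continuous_on UNIV (\<phi> \<tau>)"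
proof -
  assume \<tau>: "\<tau> \<in> frontier \<Omega>"
  have "continuous_on UNIV (\<lambda>y. (\<lambda>(\<tau>, y). \<phi> \<tau> y) (\<tau>, y))"
    by (rule continuous_on_compose2[OF cont]) (use \<tau> in \<open>auto intro!: continuous_intros\<close>)
  then show ?thesis by simp
qed

lemma approx_continuous: "continuous_on (frontier \<Omega>) (\<lambda>\<tau>. max_affine d (\<phi> \<tau>) k u)"
  by (intro max_affine_continuous_param section_continuous)

lemma approx_integrable:
  "x \<in> \<Omega> \<Longrightarrow> integrable (\<mu> x) (\<lambda>\<tau>. max_affine d (\<phi> \<tau>) k u)"
  by (intro continuous_integrable approx_continuous)

lemma approx_harmonic: "harmonic_on \<Omega> (approx_transform k u)"
proof -
  have "\<forall>g :: 'a \<Rightarrow> real. continuous_on (frontier \<Omega>) g \<longrightarrow> harmonic_on \<Omega> (\<lambda>x. \<integral>\<tau>. g \<tau> \<partial>\<mu> x)"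
    using harmonic_measure by (simp add: harmonic_measure_def)
  from this[rule_format, OF approx_continuous] show ?thesis by (simp add: approx_transform_def[abs_def])
qed

lemma approx_mono: "x \<in> \<Omega> \<Longrightarrow> approx_transform k u x \<le> approx_transform (Suc k) u x"
  unfolding approx_transform_def
  by (intro Bochner_Integration.integral_mono approx_integrable max_affine_mono)

text \<open>Probability measures preserve the Lipschitz constant of the integrand, which holds for
  all boundary points at once; so it is uniform in \<open>x\<close>.\<close>

lemma approx_lipschitz: "\<exists>C\<ge>0. \<forall>x\<in>\<Omega>. \<forall>u u'. \<bar>approx_transform k u x - approx_transform k u' x\<bar> \<le> C * norm (u - u')"
proof -
  obtain C where C: "C \<ge> 0" "\<And>f u u'. \<bar>max_affine d f k u - max_affine d f k u'\<bar> \<le> C * norm (u - u')"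
    using max_affine_lipschitz[of d k] by blast
  have "\<bar>approx_transform k u x - approx_transform k u' x\<bar> \<le> C * norm (u - u')" if x: "x \<in> \<Omega>" for x u u'
  proof -
    interpret prob_space "\<mu> x" by (rule measure_props[OF x])
    have "approx_transform k u x - approx_transform k u' x = (\<integral>\<tau>. max_affine d (\<phi> \<tau>) k u - max_affine d (\<phi> \<tau>) k u' \<partial>\<mu> x)"
      unfolding approx_transform_def by (intro Bochner_Integration.integral_diff[symmetric] approx_integrable x)
    also have "\<bar>\<dots>\<bar> \<le> (\<integral>\<tau>. \<bar>max_affine d (\<phi> \<tau>) k u - max_affine d (\<phi> \<tau>) k u'\<bar> \<partial>\<mu> x)" by (rule integral_abs_bound)
    also have "\<dots> \<le> (\<integral>\<tau>. C * norm (u - u') \<partial>\<mu> x)"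
      by (intro Bochner_Integration.integral_mono integrable_abs Bochner_Integration.integrable_diff approx_integrable x C(2)) simp
    also have "\<dots> = C * norm (u - u')" by (simp add: prob_space)
    finally show ?thesis .
  qed
  then show ?thesis using C(1) by blast
qed

text \<open>The signs are reversed to fit \<open>ereal_integral_decseq\<close>: the negated maxima
  decrease, and the first of them is bounded above since it is continuous on the compact boundary.
  The limit may be \<infinity>.\<close>

lemma approx_tendsto:
  assumes x: "x \<in> \<Omega>" shows "(\<lambda>k. ereal (approx_transform k u x)) \<longlonglongrightarrow> mean_transform x u"
proof -
  interpret prob_space "\<mu> x" by (rule measure_props[OF x])
  note sp = measure_props(3)[OF x]
  define F where "F k \<tau> = ereal (- max_affine d (\<phi> \<tau>) k u)" for k \<tau>
  have lim: "(\<lambda>k. F k \<tau>) \<longlonglongrightarrow> - boundary_transform \<tau> u" if "\<tau> \<in> space (\<mu> x)" for \<tau>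
  proof -
    have "(\<lambda>k. ereal (max_affine d (\<phi> \<tau>) k u)) \<longlonglongrightarrow> boundary_transform \<tau> u"
      unfolding boundary_transform_def using that
      by (intro max_affine_tendsto_legendre dense section_continuous') (simp_all add: sp)
    from tendsto_uminus_ereal[OF this] show ?thesis by (simp add: F_def)
  qed
  have m: "F k \<in> borel_measurable (\<mu> x)" for k
    unfolding F_def using borel_measurable_integrable[OF approx_integrable[OF x, of k u]] by measurable
  have m': "(\<lambda>\<tau>. - boundary_transform \<tau> u) \<in> borel_measurable (\<mu> x)"
    by (rule borel_measurable_LIMSEQ_order[OF lim m])
  obtain C where C: "\<And>\<tau>. \<tau> \<in> frontier \<Omega> \<Longrightarrow> \<bar>max_affine d (\<phi> \<tau>) 0 u\<bar> \<le> C"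
    using compact_abs_bound[OF compact_boundary approx_continuous[of 0 u]] by blast
  have "(\<lambda>k. ereal_integral (\<mu> x) (F k)) \<longlonglongrightarrow> ereal_integral (\<mu> x) (\<lambda>\<tau>. - boundary_transform \<tau> u)"
  proof (rule ereal_integral_decseq[OF m m' _ lim])
    show "F (Suc k) \<tau> \<le> F k \<tau>" for k \<tau> unfolding F_def using max_affine_mono[of d "\<phi> \<tau>" k u] by simp
    show "F 0 \<tau> \<le> ereal C" if "\<tau> \<in> space (\<mu> x)" for \<tau>
      using C[of \<tau>] that unfolding F_def sp by (simp only: ereal_less_eq abs_le_iff)
    show "finite_measure (\<mu> x)" by unfold_locales
  qed
  moreover have "ereal_integral (\<mu> x) (F k) = ereal (- approx_transform k u x)" for k
  proof -
    have "ereal_integral (\<mu> x) (F k) = ereal (\<integral>\<tau>. - max_affine d (\<phi> \<tau>) k u \<partial>\<mu> x)"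
      by (rule ereal_integral_real) (simp_all add: F_def approx_integrable[OF x])
    then show ?thesis by (simp add: approx_transform_def)
  qed
  moreover have "ereal_integral (\<mu> x) (\<lambda>\<tau>. - boundary_transform \<tau> u) = - mean_transform x u"
    unfolding mean_transform_def
  proof (rule ereal_integral_uminus)
    have "- boundary_transform \<tau> u \<le> ereal C" if "\<tau> \<in> space (\<mu> x)" for \<tau>
    proof -
      have "ereal (max_affine d (\<phi> \<tau>) 0 u) \<le> boundary_transform \<tau> u"
        unfolding boundary_transform_def by (rule max_affine_le_legendre)
      then have "- boundary_transform \<tau> u \<le> - ereal (max_affine d (\<phi> \<tau>) 0 u)" by (simp only: ereal_minus_le_minus)
      also have "\<dots> \<le> ereal C" using C[of \<tau>] that unfolding sp by (simp only: uminus_ereal.simps ereal_less_eq abs_le_iff)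
      finally show ?thesis .
    qed
    then have "(\<integral>\<^sup>+\<tau>. e2ennreal (- boundary_transform \<tau> u) \<partial>\<mu> x) \<le> (\<integral>\<^sup>+\<tau>. ennreal C \<partial>\<mu> x)"
      by (intro nn_integral_mono) (metis e2ennreal_ereal e2ennreal_mono)
    also have "\<dots> < \<infinity>" by (simp add: emeasure_space_1)
    finally show "(\<integral>\<^sup>+\<tau>. e2ennreal (- boundary_transform \<tau> u) \<partial>\<mu> x) < \<infinity>" .
  qed
  ultimately have "(\<lambda>k. ereal (- approx_transform k u x)) \<longlonglongrightarrow> - mean_transform x u" by simp
  from tendsto_uminus_ereal[OF this] show ?thesis by simp
qed

lemma approx_le:
  assumes x: "x \<in> \<Omega>" shows "ereal (approx_transform k u x) \<le> mean_transform x u"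
  by (rule incseq_le[OF _ approx_tendsto[OF x]]) (intro incseq_SucI, simp only: ereal_less_eq approx_mono[OF x])

text \<open>The Fenchel--Young inequality integrated over the boundary. It excludes the value
  -\<infinity> of the mean transform, bounds the interpolation above, and gives coercivity.\<close>

lemma mean_transform_ge:
  assumes x: "x \<in> \<Omega>" shows "ereal (y \<bullet> u - (\<integral>\<tau>. \<phi> \<tau> y \<partial>\<mu> x)) \<le> mean_transform x u"
proof -
  interpret prob_space "\<mu> x" by (rule measure_props[OF x])
  have i: "integrable (\<mu> x) (\<lambda>\<tau>. y \<bullet> u - \<phi> \<tau> y)"
    by (intro continuous_integrable[OF x] continuous_intros section_continuous)
  have "ereal (y \<bullet> u - (\<integral>\<tau>. \<phi> \<tau> y \<partial>\<mu> x)) = ereal (\<integral>\<tau>. y \<bullet> u - \<phi> \<tau> y \<partial>\<mu> x)"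
    by (subst Bochner_Integration.integral_diff) (auto simp: prob_space intro: continuous_integrable[OF x section_continuous])
  also have "\<dots> = ereal_integral (\<mu> x) (\<lambda>\<tau>. ereal (y \<bullet> u - \<phi> \<tau> y))"
    by (rule ereal_integral_real[OF i, symmetric]) simp
  also have "\<dots> \<le> mean_transform x u"
    unfolding mean_transform_def
  proof (rule ereal_integral_mono)
    fix \<tau>
    show "ereal (y \<bullet> u - \<phi> \<tau> y) \<le> boundary_transform \<tau> u"
      unfolding boundary_transform_def by (rule affine_le_legendre)
  qed
  finally show ?thesis .
qed

lemma mean_transform_not_MInfty: "x \<in> \<Omega> \<Longrightarrow> mean_transform x u \<noteq> - \<infinity>"
  using mean_transform_ge[of x 0 u] by auto

lemma interpolation_le:
  assumes x: "x \<in> \<Omega>" shows "harmonic_interpolation \<mu> \<phi> x y \<le> ereal (\<integral>\<tau>. \<phi> \<tau> y \<partial>\<mu> x)"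
  unfolding harmonic_interpolation_eq
proof (rule SUP_least)
  fix u
  show "ereal (u \<bullet> y) - mean_transform x u \<le> ereal (\<integral>\<tau>. \<phi> \<tau> y \<partial>\<mu> x)"
    using mean_transform_ge[OF x, of y u] by (cases "mean_transform x u") (auto simp: inner_commute)
qed

lemma interpolation_not_PInfty: "x \<in> \<Omega> \<Longrightarrow> harmonic_interpolation \<mu> \<phi> x y \<noteq> \<infinity>"
  using interpolation_le[of x y] by auto

text \<open>A supremum of affine functions of the second variable. Slopes with infinite mean
  transform contribute -\<infinity> and impose no condition.\<close>

lemma interpolation_convex:
  assumes x: "x \<in> \<Omega>" shows "ereal_convex (harmonic_interpolation \<mu> \<phi> x)"
  unfolding ereal_convex_def
proof (intro allI ballI)
  fix y z and t :: real assume t: "t \<in> {0..1}"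
  let ?\<psi> = "harmonic_interpolation \<mu> \<phi> x"
  show "?\<psi> ((1 - t) *\<^sub>R y + t *\<^sub>R z) \<le> ereal (1 - t) * ?\<psi> y + ereal t * ?\<psi> z"
    unfolding harmonic_interpolation_eq[of x "(1 - t) *\<^sub>R y + t *\<^sub>R z"]
  proof (rule SUP_least)
    fix u
    show "ereal (u \<bullet> ((1 - t) *\<^sub>R y + t *\<^sub>R z)) - mean_transform x u \<le> ereal (1 - t) * ?\<psi> y + ereal t * ?\<psi> z"
    proof (cases "mean_transform x u")
      case (real h)
      have ge: "ereal (u \<bullet> w - h) \<le> ?\<psi> w" for w
        unfolding harmonic_interpolation_eq by (rule SUP_upper2[of u]) (auto simp: real)
      have "ereal (u \<bullet> ((1 - t) *\<^sub>R y + t *\<^sub>R z)) - mean_transform x u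
         = ereal (1 - t) * ereal (u \<bullet> y - h) + ereal t * ereal (u \<bullet> z - h)"
        by (simp add: real inner_add_right algebra_simps)
      also have "\<dots> \<le> ereal (1 - t) * ?\<psi> y + ereal t * ?\<psi> z"
        using t by (intro add_mono ereal_mult_left_mono ge) auto
      finally show ?thesis .
    next
      case MInf
      then show ?thesis using mean_transform_not_MInfty[OF x] by blast
    qed simp
  qed
qed

text \<open>Maximising slopes stay bounded because the transforms grow superlinearly, uniformly in the base point.\<close>

lemma interpolation_usc: "usc_on (\<Omega> \<times> UNIV) (\<lambda>(x, y). harmonic_interpolation \<mu> \<phi> x y)"
proof (rule usc_onI_sequentially)
  show "open (\<Omega> \<times> (UNIV :: 'b set))" using open_domain by (simp add: open_Times)
  fix W :: "nat \<Rightarrow> 'a \<times> 'b" and w and c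
  assume W: "\<And>n. W n \<in> \<Omega> \<times> UNIV" and w: "w \<in> \<Omega> \<times> UNIV" and lim: "W \<longlonglongrightarrow> w"
    and ge: "\<And>n. c \<le> (\<lambda>(x, y). harmonic_interpolation \<mu> \<phi> x y) (W n)"
  define X Y x y where "X = (\<lambda>n. fst (W n))" and "Y = (\<lambda>n. snd (W n))" and "x = fst w" and "y = snd w"
  have X: "X n \<in> \<Omega>" for n using W[of n] by (auto simp: X_def)
  have x: "x \<in> \<Omega>" using w by (auto simp: x_def)
  have limX: "X \<longlonglongrightarrow> x" and limY: "Y \<longlonglongrightarrow> y"
    unfolding X_def Y_def x_def y_def by (intro tendsto_fst tendsto_snd lim)+
  have geXY: "c \<le> harmonic_interpolation \<mu> \<phi> (X n) (Y n)" for n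
    using ge[of n] by (simp add: X_def Y_def case_prod_beta)
  have "c \<le> harmonic_interpolation \<mu> \<phi> x y"
  proof (rule ccontr)
    assume "\<not> ?thesis"
    then obtain c' where c': "harmonic_interpolation \<mu> \<phi> x y < ereal c'" "ereal c' < c"
      using ereal_dense2[of "harmonic_interpolation \<mu> \<phi> x y" c] by (auto simp: not_le)
    have "\<exists>u. ereal c' < ereal (u \<bullet> Y n) - mean_transform (X n) u" for n
    proof -
      have "ereal c' < harmonic_interpolation \<mu> \<phi> (X n) (Y n)" using c'(2) geXY[of n] by (rule less_le_trans)
      then show ?thesis unfolding harmonic_interpolation_eq less_SUP_iff by blast
    qed
    then have "\<forall>n. \<exists>u. ereal c' < ereal (u \<bullet> Y n) - mean_transform (X n) u" by blast
    from choice[OF this] obtain U where U: "\<And>n. ereal c' < ereal (U n \<bullet> Y n) - mean_transform (X n) (U n)" by blast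
    obtain R where R: "R > 0" "\<And>n. norm (Y n) \<le> R"
      using convergent_imp_Bseq[OF convergentI[OF limY]] by (auto simp: Bseq_def)
    have c1: "compact (frontier \<Omega> \<times> cball (0::'b) (R + 1))" by (intro compact_Times compact_boundary compact_cball)
    have c2: "continuous_on (frontier \<Omega> \<times> cball (0::'b) (R + 1)) (\<lambda>(\<tau>, y). \<phi> \<tau> y)"
      by (rule continuous_on_subset[OF cont]) auto
    obtain M where M: "M \<ge> 0" "\<And>p. p \<in> frontier \<Omega> \<times> cball (0::'b) (R + 1) \<Longrightarrow> \<bar>(\<lambda>(\<tau>, y). \<phi> \<tau> y) p\<bar> \<le> M"
      using compact_abs_bound[OF c1 c2] by blast
    \<comment> \<open>The growth rate \<open>R + 1\<close> exceeds the bound \<open>R\<close> on the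
      points \<open>Y n\<close>, so in \<open>U n \<bullet> Y n\<close> minus the transform the norm
      of \<open>U n\<close> survives with a minus sign and is bounded.\<close>
    have coercive: "ereal ((R + 1) * norm u - M) \<le> mean_transform z u" if z: "z \<in> \<Omega>" for z u
    proof -
      interpret prob_space "\<mu> z" by (rule measure_props[OF z])
      \<comment> \<open>The point of norm \<open>R + 1\<close> in direction \<open>u\<close>. For
        \<open>u = 0\<close> the quotient is 0 by convention, and both facts about \<open>v\<close>
        remain true.\<close>
      define v where "v = ((R + 1) / norm u) *\<^sub>R u"
      have v: "norm v \<le> R + 1" "v \<bullet> u = (R + 1) * norm u"
        using R(1) by (auto simp: v_def dot_square_norm power2_eq_square)
      have "(\<integral>\<tau>. \<phi> \<tau> v \<partial>\<mu> z) \<le> (\<integral>\<tau>. M \<partial>\<mu> z)"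
      proof (rule Bochner_Integration.integral_mono)
        show "integrable (\<mu> z) (\<lambda>\<tau>. \<phi> \<tau> v)" by (rule continuous_integrable[OF z section_continuous])
        show "\<phi> \<tau> v \<le> M" if "\<tau> \<in> space (\<mu> z)" for \<tau>
          using M(2)[of "(\<tau>, v)"] v(1) that by (auto simp: measure_props(3)[OF z])
      qed simp
      also have "\<dots> = M" by (simp add: prob_space)
      finally have "ereal ((R + 1) * norm u - M) \<le> ereal (v \<bullet> u - (\<integral>\<tau>. \<phi> \<tau> v \<partial>\<mu> z))" by (simp add: v(2))
      also have "\<dots> \<le> mean_transform z u" by (rule mean_transform_ge[OF z])
      finally show ?thesis .
    qed
    have lower: "c' < U n \<bullet> Y n - h" if "ereal h \<le> mean_transform (X n) (U n)" for n h
      using U[of n] that by (cases "mean_transform (X n) (U n)") auto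
    have Ub: "norm (U n) \<le> M - c'" for n
    proof -
      have "c' < U n \<bullet> Y n - ((R + 1) * norm (U n) - M)" by (rule lower[OF coercive[OF X]])
      moreover have "U n \<bullet> Y n \<le> norm (U n) * R"
        by (rule order_trans[OF norm_cauchy_schwarz]) (simp add: R(2) mult_left_mono)
      ultimately show ?thesis by (simp add: algebra_simps)
    qed
    then have "\<forall>n. U n \<in> cball 0 (M - c')" by simp
    then obtain u s where s: "strict_mono s" and limU: "(U \<circ> s) \<longlonglongrightarrow> u"
      using compact_cball[of "0::'b" "M - c'"] unfolding compact_def by blast
    \<comment> \<open>The limit along the subsequence is taken at a fixed \<open>k\<close>: there
      the transform is continuous in the base point, being harmonic, and changing the slope from
      \<open>U (s j)\<close> to \<open>u\<close> costs a Lipschitz term independent of the base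
      point. The limit in \<open>k\<close> comes last.\<close>
    have "c' \<le> u \<bullet> y - approx_transform k u x" for k
    proof -
      obtain C where C: "C \<ge> 0" "\<And>z u u'. z \<in> \<Omega> \<Longrightarrow> \<bar>approx_transform k u z - approx_transform k u' z\<bar> \<le> C * norm (u - u')"
        using approx_lipschitz[of k] by blast
      have "isCont (approx_transform k u) x"
        using harmonic_on_continuous[OF open_domain approx_harmonic] x open_domain continuous_on_eq_continuous_at by blast
      then have l1: "(\<lambda>j. approx_transform k u (X (s j))) \<longlonglongrightarrow> approx_transform k u x"
        using LIMSEQ_subseq_LIMSEQ[OF limX s] by (auto intro: isCont_tendsto_compose simp: o_def)
      have l2: "(\<lambda>j. U (s j) \<bullet> Y (s j)) \<longlonglongrightarrow> u \<bullet> y"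
        using limU LIMSEQ_subseq_LIMSEQ[OF limY s] by (intro tendsto_inner) (simp_all add: o_def)
      have "(\<lambda>j. norm (u - U (s j))) \<longlonglongrightarrow> norm (u - u)"
        using limU by (intro tendsto_intros) (simp add: o_def)
      then have l3: "(\<lambda>j. C * norm (u - U (s j))) \<longlonglongrightarrow> C * 0" by (intro tendsto_mult_left) simp
      have "c' \<le> U (s j) \<bullet> Y (s j) - approx_transform k u (X (s j)) + C * norm (u - U (s j))" for j
        using lower[OF approx_le[OF X[of "s j"], of k "U (s j)"]] C(2)[OF X[of "s j"], of u "U (s j)"] by linarith
      moreover have "(\<lambda>j. U (s j) \<bullet> Y (s j) - approx_transform k u (X (s j)) + C * norm (u - U (s j)))
         \<longlonglongrightarrow> u \<bullet> y - approx_transform k u x + C * 0"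
        by (intro tendsto_add tendsto_diff l1 l2 l3)
      ultimately show ?thesis using LIMSEQ_le_const[of _ "u \<bullet> y - approx_transform k u x + C * 0" c'] by simp
    qed
    then have "ereal c' \<le> ereal (u \<bullet> y) - ereal (approx_transform k u x)" for k by simp
    moreover have "(\<lambda>k. ereal (u \<bullet> y) - ereal (approx_transform k u x)) \<longlonglongrightarrow> ereal (u \<bullet> y) - mean_transform x u"
      by (intro tendsto_diff_ereal_general approx_tendsto[OF x] tendsto_const) auto
    ultimately have "ereal c' \<le> ereal (u \<bullet> y) - mean_transform x u" by (intro LIMSEQ_le_const) auto
    also have "\<dots> \<le> harmonic_interpolation \<mu> \<phi> x y" unfolding harmonic_interpolation_eq by (rule SUP_upper) simp
    finally show False using c'(1) leD by blast
  qed
  then show "c \<le> (\<lambda>(x, y). harmonic_interpolation \<mu> \<phi> x y) w" by (simp add: x_def y_def case_prod_beta)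
qed

text \<open>For a fixed slope \<open>u\<close> the function \<open>L\<close> is a decreasing limit
  of affine functions minus harmonic ones, so it equals its ball average at the centre. Each such
  \<open>L\<close> lies below the interpolation, and the supremum over \<open>u\<close> yields the
  sub-mean inequality.\<close>

lemma interpolation_subharmonic:
  assumes A: "linear A"
  shows "subharmonic_on \<Omega> (\<lambda>x. harmonic_interpolation \<mu> \<phi> x (A x + b))"
  unfolding subharmonic_on_def
proof (intro conjI ballI allI impI)
  let ?f = "\<lambda>x. harmonic_interpolation \<mu> \<phi> x (A x + b)"
  show "?f x \<noteq> \<infinity>" if "x \<in> \<Omega>" for x by (rule interpolation_not_PInfty[OF that])
  have cA: "continuous_on UNIV A" using A by (simp add: linear_continuous_on linear_conv_bounded_linear)
  have openU: "open (\<Omega> \<times> (UNIV :: 'b set))" using open_domain by (simp add: open_Times)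
  show "usc_on \<Omega> ?f"
    unfolding usc_on_def openin_open_eq[OF open_domain]
  proof (intro allI conjI)
    fix c
    have "open ((\<lambda>x. (x, A x + b)) -` {w \<in> \<Omega> \<times> UNIV. (\<lambda>(x, y). harmonic_interpolation \<mu> \<phi> x y) w < c})"
      by (intro open_vimage open_usc_sublevel[OF openU interpolation_usc] continuous_intros cA)
    moreover have "(\<lambda>x. (x, A x + b)) -` {w \<in> \<Omega> \<times> UNIV. (\<lambda>(x, y). harmonic_interpolation \<mu> \<phi> x y) w < c} = {x \<in> \<Omega>. ?f x < c}"
      by auto
    ultimately show "open {x \<in> \<Omega>. ?f x < c}" by simp
  qed auto
  fix x r assume "0 < r \<and> cball x r \<subseteq> \<Omega>"
  then have r: "r > 0" "cball x r \<subseteq> \<Omega>" by auto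
  let ?M = "restrict_space lborel (cball x r)" and ?V = "measure lborel (cball x r)"
  have V: "?V > 0" using content_cball_pos[OF r(1)] by simp
  have xB: "x \<in> \<Omega>" using r by auto
  have sp: "space ?M = cball x r" by (simp add: space_restrict_space)
  show "?f x \<le> ereal (1 / ?V) * ereal_integral ?M ?f"
    unfolding harmonic_interpolation_eq[of x "A x + b"]
  proof (rule SUP_least)
    fix u
    define K where "K k z = u \<bullet> A z + u \<bullet> b - approx_transform k u z" for k z
    define L where "L z = ereal (u \<bullet> (A z + b)) - mean_transform z u" for z
    have lin: "linear (\<lambda>z. u \<bullet> A z)"
      by (auto simp: linear_iff linear_add[OF A] linear_scale[OF A] inner_add_right)
    have cK: "continuous_on (cball x r) (K k)" for k
      unfolding K_def
      by (intro continuous_intros continuous_on_subset[OF cA] continuous_on_subset[OF harmonic_on_continuous[OF open_domain approx_harmonic] r(2)]) auto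
    have iK: "integrable lborel (\<lambda>z. indicator (cball x r) z * K k z)" for k
      by (rule integrable_indicator_compact[OF compact_cball cK])
    have mean: "(\<integral>z. indicator (cball x r) z * K k z \<partial>lborel) = ?V * K k x" for k
    proof -
      have i1: "integrable lborel (\<lambda>z. indicator (cball x r) z * (u \<bullet> A z + u \<bullet> b))"
        by (intro integrable_indicator_compact compact_cball continuous_intros continuous_on_subset[OF cA]) auto
      have i2: "integrable lborel (\<lambda>z. indicator (cball x r) z * approx_transform k u z)"
        by (intro integrable_indicator_compact compact_cball continuous_on_subset[OF harmonic_on_continuous[OF open_domain approx_harmonic] r(2)])
      have "(\<integral>z. indicator (cball x r) z * K k z \<partial>lborel)
        = (\<integral>z. indicator (cball x r) z * (u \<bullet> A z + u \<bullet> b) \<partial>lborel) - (\<integral>z. indicator (cball x r) z * approx_transform k u z \<partial>lborel)"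
        unfolding K_def by (subst Bochner_Integration.integral_diff[OF i1 i2, symmetric]) (simp add: right_diff_distrib)
      then show ?thesis
        using affine_mean_value[OF lin r(1), of x "u \<bullet> b"] harmonic_mean_value[OF open_domain approx_harmonic r(2,1), of k u]
        by (simp add: K_def right_diff_distrib)
    qed
    have limK: "(\<lambda>k. ereal (K k z)) \<longlonglongrightarrow> L z" if "z \<in> \<Omega>" for z
    proof -
      have "(\<lambda>k. ereal (u \<bullet> (A z + b)) - ereal (approx_transform k u z)) \<longlonglongrightarrow> L z"
        unfolding L_def by (intro tendsto_diff_ereal_general approx_tendsto[OF that] tendsto_const) auto
      then show ?thesis by (simp add: K_def inner_add_right)
    qed
    obtain C where C: "\<And>z. z \<in> cball x r \<Longrightarrow> \<bar>K 0 z\<bar> \<le> C"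
      using compact_abs_bound[OF compact_cball cK[of 0]] by blast
    have mK: "(\<lambda>z. ereal (K k z)) \<in> borel_measurable ?M" for k
    proof -
      have "K k \<in> borel_measurable ?M" using borel_measurable_integrable[OF iK[of k]]
        by (subst borel_measurable_restrict_space_iff) auto
      then show ?thesis by measurable
    qed
    have mL: "L \<in> borel_measurable ?M"
      by (rule borel_measurable_LIMSEQ_order[OF limK mK]) (use r(2) sp in auto)
    have "(\<lambda>k. ereal_integral ?M (\<lambda>z. ereal (K k z))) \<longlonglongrightarrow> ereal_integral ?M L"
    proof (rule ereal_integral_decseq[OF mK mL])
      show "ereal (K (Suc k) z) \<le> ereal (K k z)" if "z \<in> space ?M" for z k
        using approx_mono[of z k u] that r(2) sp by (auto simp: K_def)
      show "(\<lambda>k. ereal (K k z)) \<longlonglongrightarrow> L z" if "z \<in> space ?M" for z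
        using that r(2) sp by (intro limK) auto
      show "ereal (K 0 z) \<le> ereal C" if "z \<in> space ?M" for z
        using C[of z] that unfolding sp by (simp add: abs_le_iff)
      show "finite_measure ?M"
        by (rule finite_measureI)
          (use emeasure_lborel_cball_finite[of x r] in \<open>auto simp: emeasure_restrict_space space_restrict_space\<close>)
    qed
    moreover have "ereal_integral ?M (\<lambda>z. ereal (K k z)) = ereal (?V * K k x)" for k
      unfolding mean[symmetric] by (rule ereal_integral_real_restrict[OF _ iK]) auto
    ultimately have "(\<lambda>k. ereal (?V * K k x)) \<longlonglongrightarrow> ereal_integral ?M L" by simp
    then have "(\<lambda>k. ereal (1 / ?V) * ereal (?V * K k x)) \<longlonglongrightarrow> ereal (1 / ?V) * ereal_integral ?M L"
      by (intro tendsto_cmult_ereal) auto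
    then have "(\<lambda>k. ereal (K k x)) \<longlonglongrightarrow> ereal (1 / ?V) * ereal_integral ?M L" using V by simp
    from LIMSEQ_unique[OF limK[OF xB] this]
    have "L x = ereal (1 / ?V) * ereal_integral ?M L" .
    also have "\<dots> \<le> ereal (1 / ?V) * ereal_integral ?M ?f"
    proof (rule ereal_mult_left_mono)
      show "ereal_integral ?M L \<le> ereal_integral ?M ?f"
      proof (rule ereal_integral_mono)
        fix z
        show "L z \<le> ?f z" unfolding L_def harmonic_interpolation_eq by (rule SUP_upper) simp
      qed
    qed simp
    finally show "ereal (u \<bullet> (A x + b)) - mean_transform x u \<le> ereal (1 / ?V) * ereal_integral ?M ?f" by (simp only: L_def)
  qed
qed

end

theorem theorem1p4:
  fixes \<Omega> :: "(real ^ 'n) set"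
  assumes "open \<Omega>" and "bounded \<Omega>" and "smooth_boundary \<Omega>"
  shows
    "(\<forall>\<psi> :: real ^ 'n \<Rightarrow> real ^ 'm \<Rightarrow> ereal.
        (\<forall>x\<in>\<Omega>. \<forall>y. \<psi> x y \<noteq> \<infinity>) \<and>
        usc_on (\<Omega> \<times> UNIV) (\<lambda>(x, y). \<psi> x y) \<and>
        (\<forall>x\<in>\<Omega>. ereal_convex (\<psi> x)) \<and>
        (\<forall>A b. linear A \<longrightarrow> subharmonic_on \<Omega> (\<lambda>x. \<psi> x (A x + b)))
        \<longrightarrow> subharmonic_on \<Omega> (\<lambda>x. - ennreal_ln (\<integral>\<^sup>+ y. ereal_exp (- \<psi> x y) \<partial>lborel)))
     \<and>
     (\<forall>(\<mu> :: real ^ 'n \<Rightarrow> (real ^ 'n) measure) (\<phi> :: real ^ 'n \<Rightarrow> real ^ 'm \<Rightarrow> real) \<psi>.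
        harmonic_measure \<Omega> \<mu> \<and>
        (\<forall>\<tau>\<in>frontier \<Omega>. convex_on UNIV (\<phi> \<tau>)) \<and>
        continuous_on (frontier \<Omega> \<times> UNIV) (\<lambda>(\<tau>, y). \<phi> \<tau> y) \<and>
        \<psi> = harmonic_interpolation \<mu> \<phi>
        \<longrightarrow>
        (\<forall>x\<in>\<Omega>. \<forall>y. \<psi> x y \<noteq> \<infinity>) \<and>
        usc_on (\<Omega> \<times> UNIV) (\<lambda>(x, y). \<psi> x y) \<and>
        (\<forall>x\<in>\<Omega>. ereal_convex (\<psi> x)) \<and>
        (\<forall>A b. linear A \<longrightarrow> subharmonic_on \<Omega> (\<lambda>x. \<psi> x (A x + b))) \<and>
        subharmonic_on \<Omega> (\<lambda>x. - ennreal_ln (\<integral>\<^sup>+ y. ereal_exp (- \<psi> x y) \<partial>lborel)))"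
proof (intro conjI allI impI ballI; (elim conjE)?)
  fix \<psi> :: "real ^ 'n \<Rightarrow> real ^ 'm \<Rightarrow> ereal"
  assume "\<forall>x\<in>\<Omega>. \<forall>y. \<psi> x y \<noteq> \<infinity>" "usc_on (\<Omega> \<times> UNIV) (\<lambda>(x, y). \<psi> x y)" "\<forall>x\<in>\<Omega>. ereal_convex (\<psi> x)"
    "\<forall>A b. linear A \<longrightarrow> subharmonic_on \<Omega> (\<lambda>x. \<psi> x (A x + b))"
  then show "subharmonic_on \<Omega> (\<lambda>x. - ennreal_ln (\<integral>\<^sup>+ y. ereal_exp (- \<psi> x y) \<partial>lborel))"
    by (intro subharmonic_neg_log_integral \<open>open \<Omega>\<close>) auto
next
  fix \<mu> :: "real ^ 'n \<Rightarrow> (real ^ 'n) measure" and \<phi> :: "real ^ 'n \<Rightarrow> real ^ 'm \<Rightarrow> real" and \<psi>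
  assume \<mu>: "harmonic_measure \<Omega> \<mu>" and \<phi>: "continuous_on (frontier \<Omega> \<times> UNIV) (\<lambda>(\<tau>, y). \<phi> \<tau> y)"
    and \<psi>: "\<psi> = harmonic_interpolation \<mu> \<phi>"
  \<comment> \<open>A countable dense set of points reduces each Legendre transform to a limit of
    maxima over initial pieces of an enumeration.\<close>
  obtain D :: "(real ^ 'm) set" where D: "countable D" "\<And>X. open X \<Longrightarrow> X \<noteq> {} \<Longrightarrow> \<exists>d\<in>D. d \<in> X"
    using countable_dense_exists by blast
  then have "D \<noteq> {}" using D(2)[of UNIV] by auto
  then have range: "range (from_nat_into D) = D" using D(1) by (rule range_from_nat_into)
  interpret interpolation_data \<Omega> \<mu> \<phi> "from_nat_into D"
  proof
    fix X :: "(real ^ 'm) set" assume "open X" "X \<noteq> {}"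
    then obtain y where "y \<in> range (from_nat_into D)" "y \<in> X" using D(2) range by blast
    then show "\<exists>n. from_nat_into D n \<in> X" by blast
  qed (fact assms \<mu> \<phi>)+
  show 1: "\<And>x y. x \<in> \<Omega> \<Longrightarrow> \<psi> x y \<noteq> \<infinity>" unfolding \<psi> by (rule interpolation_not_PInfty)
  show 2: "usc_on (\<Omega> \<times> UNIV) (\<lambda>(x, y). \<psi> x y)" unfolding \<psi> by (rule interpolation_usc)
  show 3: "\<And>x. x \<in> \<Omega> \<Longrightarrow> ereal_convex (\<psi> x)" unfolding \<psi> by (rule interpolation_convex)
  show 4: "\<And>A b. linear A \<Longrightarrow> subharmonic_on \<Omega> (\<lambda>x. \<psi> x (A x + b))" unfolding \<psi> by (rule interpolation_subharmonic)
  show "subharmonic_on \<Omega> (\<lambda>x. - ennreal_ln (\<integral>\<^sup>+ y. ereal_exp (- \<psi> x y) \<partial>lborel))"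
    by (rule subharmonic_neg_log_integral[OF \<open>open \<Omega>\<close> 1 2 3 4])
qed

end
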